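(* Let $R>1$ and $\theta\in(-\pi/2,\pi/2)$, $\theta\neq0$, satisfy $R\cos\theta>\frac32$, put $b=1-Re^{i\theta}$, and let $F_n$, $n\ge1$, be the Faber polynomials of the Joukowski airfoil $K$ with parameters $R,\theta$. Then the zeros of $F_n$ accumulate on $\mathcal A_b\cup\mathcal L_b^+$ (that is, for every open neighborhood $N$ of $\mathcal A_b\cup\mathcal L_b^+$, all zeros of $F_n$ lie in $N$ for all sufficiently large $n$), where $\mathcal A_b$ is the portion of the arc $\mathcal A$ from the point $i_b$ to the point $1$, and $\mathcal L_b^+=\{z:|\phi_b(z)|=1\}$ is a loop containing the point $i_b$, where it has a corner. Moreover, $$\lim_{n\to\infty}\mu_n=(U^{-1})_*(\mu_{[-1,1]})|_{\mathcal A_b}+(\phi_b^{-1})_*(\eta|_{(c_+,c_-)})\quad\text{weak-*},$$ where $\mu_n$ is the normalized counting measure of the zeros of $F_n$, and $(c_+,c_-)$ is the arc of the unit circle $\mathbb T$ from $c_+$ to $c_-$ (traversed counterclockwise), with $c_\pm=(\phi_b)_\pm(i_b)\in\mathbb T$.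
   Context: Let $J(\zeta)=\frac12(\zeta+1/\zeta)$ and, for $R>1$, $\theta\in(-\pi/2,\pi/2)$ with $R\cos\theta>1$, let $a=Re^{i\theta}$, $b=1-Re^{i\theta}$ (so $\operatorname{Re}b<0$), $T(z)=az+b$ and $\Psi=J\circ T$. The map $\Psi$ is a conformal map of $\{|z|>1\}\cup\{\infty\}$ onto $\overline{\mathbb C}\setminus K$ with $\Psi(\infty)=\infty$, where $K$ is a compact set called the Joukowski airfoil with parameters $R,\theta$. The Faber polynomials $F_n$ of $K$ are defined, for $|w|$ large, by $$\frac{\Psi'(w)}{\Psi(w)-z}=\sum_{n=0}^\infty\frac{F_n(z)}{w^{n+1}};$$ $F_n$ is a polynomial of degree $n$ (normalizing $\Psi'(\infty)>0$ instead would only multiply $F_n$ by a constant of modulus one). If $z_1^{(n)},\dots,z_n^{(n)}$ are its zeros (with multiplicity), then $\mu_n=\frac1n\sum_{j=1}^n\delta_{z_j^{(n)}}$. Let $V(z)=b^2+1-2bz$, $c=\frac12(b+\frac1b)$ (so $V(c)=0$), and $$U(z)=\frac{z-b}{V(z)^{1/2}},\qquad \mathcal A=\{z\in\mathbb C:\ U(z)\in[-1,1]\}$$ (the set $\mathcal A$ does not depend on the choice of the square root). Since $b$ is non-real here, $\mathcal A$ is a simple arc joining $-1$ and $1$ and not containing $c$; the branch of $V^{1/2}$ is taken holomorphic outside a cut from $c$ to $\infty$ that avoids $\mathcal A$, with $V(1)^{1/2}=1-b$. Then $U$ is a bijection from $\mathcal A$ onto $[-1,1]$ with $U(\pm1)=\pm1$,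 and $U^{-1}:[-1,1]\to\mathcal A$ denotes its inverse. The circle $\mathcal C_b=\{z:|z-c|=|b|/2\}$ meets $\mathcal A$ in exactly one point when $R\cos\theta\ge3/2$; this point is denoted $i_b$. The measure $\mu_{[-1,1]}=\frac1\pi\frac{dx}{\sqrt{1-x^2}}$ is the equilibrium measure of $[-1,1]$; $f_*(\nu)$ denotes the push-forward of $\nu$ by $f$; and $(U^{-1})_*(\mu_{[-1,1]})|_{\mathcal A_b}$ is the restriction to $\mathcal A_b$ of the push-forward measure on $\mathcal A$. Let $$\phi_b(z)=\frac{b-z-\sqrt{z^2-1}}{b},$$ where $\sqrt{z^2-1}$ has the arc $\mathcal A$ as branch cut and behaves like $z$ at infinity. The arc $\mathcal A$ is oriented from $-1$ to $1$, and for $x\in\mathcal A$, $(\phi_b)_+(x)$ and $(\phi_b)_-(x)$ denote the limits of $\phi_b(z)$ as $z\to x$ from the left side and the right side of $\mathcal A$, respectively. In the definition $\mathcal L_b^+=\{z\in\mathbb C:|\phi_b(z)|=1\}$, a point of the cut is included when the boundary values of $\phi_b$ there have modulus one. The map $\phi_b$ is injective off the cut and never takes the value $1$; it maps $\mathcal L_b^+\setminus\{i_b\}$ bijectively onto the open arc $(c_+,c_-)$, and $\phi_b^{-1}$ denotes the inverse of this bijection. Finally $\eta=\frac1{2\pi}d\theta$ is the normalized arc-length measure on $\mathbb T$, and $\eta|_{(c_+,c_-)}$ is its restriction to the arc. *)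

theory Defs
  imports "HOL-Analysis.Analysis"
begin

section \<open>Faber polynomials of the Joukowski airfoil\<close>

definition joukowski :: "complex \<Rightarrow> complex" where
  "joukowski \<zeta> = (\<zeta> + 1 / \<zeta>) / 2"

text \<open>The airfoil with parameters \<open>R\<close>, \<open>\<theta>\<close> is the complement of the image of \<open>{w. 1 < norm w}\<close> under
  the following map; its Faber polynomials are defined through this exterior map.\<close>

definition airfoil_map :: "real \<Rightarrow> real \<Rightarrow> complex \<Rightarrow> complex" where
  "airfoil_map R \<theta> w =
     joukowski ((of_real R * cis \<theta>) * w + (1 - of_real R * cis \<theta>))"

definition faber_polynomials :: "(complex \<Rightarrow> complex) \<Rightarrow> (nat \<Rightarrow> complex poly) \<Rightarrow> bool" where
  "faber_polynomials \<Psi> F \<longleftrightarrow>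
     (\<forall>z. \<forall>\<^sub>F w in at_infinity.
        (\<lambda>n. poly (F n) z / w ^ (n + 1)) sums (deriv \<Psi> w / (\<Psi> w - z)))"

section \<open>The arc and its uniformization\<close>

definition airfoil_V :: "complex \<Rightarrow> complex \<Rightarrow> complex" where
  "airfoil_V b z = b\<^sup>2 + 1 - 2 * b * z"

definition airfoil_c :: "complex \<Rightarrow> complex" where
  "airfoil_c b = (b + 1 / b) / 2"

text \<open>Here \<open>v\<close> is either of the two square roots of \<open>V(z)\<close>; the condition \<open>v \<noteq> 0\<close> excludes \<open>z = c\<close>,
  where \<open>U\<close> is infinite.\<close>

definition airfoil_arc :: "complex \<Rightarrow> complex set" where
  "airfoil_arc b =
     {z. \<exists>v. v\<^sup>2 = airfoil_V b z \<and> v \<noteq> 0 \<and> (z - b) / v \<in> of_real ` {-1..1}}"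

text \<open>\<open>r\<close> is a branch of the square root of \<open>V\<close>, holomorphic outside some cut \<open>\<gamma>\<close> from \<open>c\<close> to infinity
  that avoids the arc, and normalized at \<open>1\<close>.\<close>

definition is_sqrt_V :: "complex \<Rightarrow> (complex \<Rightarrow> complex) \<Rightarrow> bool" where
  "is_sqrt_V b r \<longleftrightarrow>
     (\<exists>\<gamma> :: real \<Rightarrow> complex.
        continuous_on {0..} \<gamma> \<and> inj_on \<gamma> {0..} \<and>
        \<gamma> 0 = airfoil_c b \<and> filterlim \<gamma> at_infinity at_top \<and>
        \<gamma> ` {0..} \<inter> airfoil_arc b = {} \<and>
        r holomorphic_on - \<gamma> ` {0..} \<and>
        (\<forall>z \<in> - \<gamma> ` {0..}. (r z)\<^sup>2 = airfoil_V b z)) \<and>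
     r 1 = 1 - b"

definition airfoil_U :: "complex \<Rightarrow> (complex \<Rightarrow> complex) \<Rightarrow> complex \<Rightarrow> complex" where
  "airfoil_U b r z = (z - b) / r z"

definition airfoil_Uinv :: "complex \<Rightarrow> (complex \<Rightarrow> complex) \<Rightarrow> real \<Rightarrow> complex" where
  "airfoil_Uinv b r t = inv_into (airfoil_arc b) (airfoil_U b r) (of_real t)"

definition airfoil_i :: "complex \<Rightarrow> complex" where
  "airfoil_i b = (THE z. z \<in> airfoil_arc b \<and> dist z (airfoil_c b) = norm b / 2)"

text \<open>The part of the arc from \<open>i\<^sub>b\<close> to \<open>1\<close>.\<close>

definition airfoil_subarc :: "complex \<Rightarrow> (complex \<Rightarrow> complex) \<Rightarrow> complex set" where
  "airfoil_subarc b r = airfoil_Uinv b r ` {Re (airfoil_U b r (airfoil_i b))..1}"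

section \<open>The function \<open>\<phi>\<^sub>b\<close> and its boundary values\<close>

text \<open>\<open>s\<close> is the branch of the square root of \<open>z\<^sup>2 - 1\<close> that is cut along the arc and behaves like \<open>z\<close> at
  infinity.\<close>

definition is_sqrt_arc :: "complex \<Rightarrow> (complex \<Rightarrow> complex) \<Rightarrow> bool" where
  "is_sqrt_arc b s \<longleftrightarrow>
     s holomorphic_on - airfoil_arc b \<and>
     (\<forall>z \<in> - airfoil_arc b. (s z)\<^sup>2 = z\<^sup>2 - 1) \<and>
     ((\<lambda>z. s z / z) \<longlongrightarrow> 1) at_infinity"

definition airfoil_phi :: "complex \<Rightarrow> (complex \<Rightarrow> complex) \<Rightarrow> complex \<Rightarrow> complex" where
  "airfoil_phi b s z = (b - z - s z) / b"

text \<open>One-sided limits at an arc, for an arc parametrized by a smooth \<open>g\<close> on \<open>[-1,1]\<close> and oriented by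
  increasing parameter. The left side of the arc consists of the points of a thin collar obtained by
  moving from points of the arc in the direction \<open>\<i> * g'\<close> of the left normal; the right side is
  obtained by moving in the direction \<open>- \<i> * g'\<close>.\<close>

definition side_collar :: "(real \<Rightarrow> complex) \<Rightarrow> complex \<Rightarrow> real \<Rightarrow> complex set" where
  "side_collar g d \<delta> =
     {g t + of_real \<epsilon> * d * vector_derivative g (at t within {-1..1}) | t \<epsilon>.
        t \<in> {-1..1} \<and> 0 < \<epsilon> \<and> \<epsilon> < \<delta>}"

definition left_limit :: "(real \<Rightarrow> complex) \<Rightarrow> (complex \<Rightarrow> complex) \<Rightarrow> complex \<Rightarrow> complex" where
  "left_limit g f x = (THE l. \<exists>\<delta>>0. (f \<longlongrightarrow> l) (at x within side_collar g \<i> \<delta>))"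

definition right_limit :: "(real \<Rightarrow> complex) \<Rightarrow> (complex \<Rightarrow> complex) \<Rightarrow> complex \<Rightarrow> complex" where
  "right_limit g f x = (THE l. \<exists>\<delta>>0. (f \<longlongrightarrow> l) (at x within side_collar g (- \<i>) \<delta>))"

definition phi_plus ::
    "complex \<Rightarrow> (complex \<Rightarrow> complex) \<Rightarrow> (complex \<Rightarrow> complex) \<Rightarrow> complex \<Rightarrow> complex" where
  "phi_plus b r s x = left_limit (airfoil_Uinv b r) (airfoil_phi b s) x"

definition phi_minus ::
    "complex \<Rightarrow> (complex \<Rightarrow> complex) \<Rightarrow> (complex \<Rightarrow> complex) \<Rightarrow> complex \<Rightarrow> complex" where
  "phi_minus b r s x = right_limit (airfoil_Uinv b r) (airfoil_phi b s) x"

text \<open>On the cut the values of \<open>\<phi>\<^sub>b\<close> itself carry no meaning; there the two boundary values decide.\<close>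

definition airfoil_loop ::
    "complex \<Rightarrow> (complex \<Rightarrow> complex) \<Rightarrow> (complex \<Rightarrow> complex) \<Rightarrow> complex set" where
  "airfoil_loop b r s =
     {z. z \<notin> airfoil_arc b \<and> norm (airfoil_phi b s z) = 1} \<union>
     {x \<in> airfoil_arc b. norm (phi_plus b r s x) = 1 \<and> norm (phi_minus b r s x) = 1}"

definition phi_inv ::
    "complex \<Rightarrow> (complex \<Rightarrow> complex) \<Rightarrow> (complex \<Rightarrow> complex) \<Rightarrow> complex \<Rightarrow> complex" where
  "phi_inv b r s = inv_into (airfoil_loop b r s - {airfoil_i b}) (airfoil_phi b s)"

text \<open>\<open>L\<close> is a Jordan curve through \<open>p\<close> whose two one-sided tangent directions at \<open>p\<close> exist and are
  linearly independent over the reals (so the curve is neither smooth at \<open>p\<close> nor has a cusp there).\<close>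

definition loop_with_corner :: "complex set \<Rightarrow> complex \<Rightarrow> bool" where
  "loop_with_corner L p \<longleftrightarrow>
     (\<exists>g u v. simple_path g \<and> path_image g = L \<and> pathstart g = p \<and> pathfinish g = p \<and>
        (g has_vector_derivative u) (at 0 within {0..1}) \<and>
        (g has_vector_derivative v) (at 1 within {0..1}) \<and>
        Im (v * cnj u) \<noteq> 0)"

section \<open>Measures\<close>

definition arcsine_measure :: "real measure" where
  "arcsine_measure =
     density lborel (\<lambda>x. ennreal (indicator {-1..1} x / (pi * sqrt (1 - x\<^sup>2))))"

definition circle_measure :: "complex measure" where
  "circle_measure =
     distr (density lborel (\<lambda>t. ennreal (indicator {0..<2 * pi} t / (2 * pi)))) borel cis"

text \<open>The open arc of the unit circle traversed counterclockwise from \<open>u\<close> to \<open>v\<close>.\<close>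

definition circle_arc :: "complex \<Rightarrow> complex \<Rightarrow> complex set" where
  "circle_arc u v = {u * cis t | t. 0 < t \<and> t < Arg2pi (v / u)}"

definition restrict_measure :: "'a measure \<Rightarrow> 'a set \<Rightarrow> 'a measure" where
  "restrict_measure M A = density M (indicator A)"

definition add_measure :: "'a measure \<Rightarrow> 'a measure \<Rightarrow> 'a measure" where
  "add_measure M N = measure_of (space M) (sets M) (\<lambda>A. emeasure M A + emeasure N A)"

text \<open>Each zero is weighted by its multiplicity.\<close>

definition zero_measure :: "nat \<Rightarrow> complex poly \<Rightarrow> complex measure" where
  "zero_measure n p =
     distr (point_measure {z. poly p z = 0} (\<lambda>z. ennreal (real (order z p) / real n)))
       borel (\<lambda>z. z)"

definition weak_star_limit :: "(nat \<Rightarrow> complex measure) \<Rightarrow> complex measure \<Rightarrow> bool" where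
  "weak_star_limit M N \<longleftrightarrow>
     (\<forall>f :: complex \<Rightarrow> real. continuous_on UNIV f \<and> bounded (range f) \<longrightarrow>
        (\<lambda>n. integral\<^sup>L (M n) f) \<longlonglongrightarrow> integral\<^sup>L N f)"

definition airfoil_limit_measure ::
    "complex \<Rightarrow> (complex \<Rightarrow> complex) \<Rightarrow> (complex \<Rightarrow> complex) \<Rightarrow> complex measure" where
  "airfoil_limit_measure b r s =
     add_measure
       (restrict_measure (distr arcsine_measure borel (airfoil_Uinv b r)) (airfoil_subarc b r))
       (distr
          (restrict_measure circle_measure
             (circle_arc (phi_plus b r s (airfoil_i b)) (phi_minus b r s (airfoil_i b))))
          borel (phi_inv b r s))"

section \<open>Existence of the branches\<close>

text \<open>The two branch predicates are satisfiable for every non-real \<open>b\<close> in the left half-plane: for the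
  square root of \<open>V\<close> the ray from \<open>c\<close> in the direction \<open>- b\<close> is a possible cut.\<close>

lemma square_notin_Reals:
  assumes "Re b < 0" "Im b \<noteq> 0"
  shows "b\<^sup>2 \<notin> \<real>"
  using assms by (auto simp: complex_is_Real_iff power2_eq_square)

lemma is_sqrt_V_exists:
  assumes "Re b < 0" "Im b \<noteq> 0"
  shows "\<exists>r. is_sqrt_V b r"
proof -
  have b2: "b\<^sup>2 \<notin> \<real>" and b0: "b \<noteq> 0"
    using square_notin_Reals[OF assms] assms by auto
  define \<gamma> where "\<gamma> = (\<lambda>t::real. airfoil_c b - of_real t * b)"
  define k where "k = (\<lambda>z. csqrt (- airfoil_V b z / b\<^sup>2) * (\<i> * b))"
  have V: "airfoil_V b (\<gamma> t) = 2 * of_real t * b\<^sup>2" for t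
    using b0 by (simp add: airfoil_V_def airfoil_c_def \<gamma>_def power2_eq_square field_simps)
  have avoid: "\<gamma> t \<notin> airfoil_arc b" if "t \<ge> 0" for t
  proof
    assume "\<gamma> t \<in> airfoil_arc b"
    then obtain v \<sigma> where v: "v\<^sup>2 = 2 * of_real t * b\<^sup>2" "(\<gamma> t - b) = of_real \<sigma> * v"
      by (auto simp: airfoil_arc_def V field_simps)
    define q where "q = v / b"
    have q: "q\<^sup>2 = of_real (2 * t)" using v(1) b0 by (simp add: q_def power_divide)
    have "csqrt (of_real (2*t)) \<in> \<real>" using that by simp
    moreover have "q = csqrt (of_real (2*t)) \<or> q = - csqrt (of_real (2*t))"
      using q by (metis power2_csqrt power2_eq_iff)
    ultimately have qr: "q \<in> \<real>" by auto
    have "1 / b\<^sup>2 = 2 * (\<gamma> t - b) / b + 1 + 2 * of_real t"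
      using b0 by (simp add: \<gamma>_def airfoil_c_def field_simps power2_eq_square)
    also have "\<dots> = 2 * of_real \<sigma> * q + 1 + 2 * of_real t"
      by (simp add: v(2) q_def)
    also have "\<dots> \<in> \<real>" using qr by simp
    finally have "1 / b\<^sup>2 \<in> \<real>" .
    from Reals_divide[OF Reals_1 this] b2 show False by simp
  qed
  have notin: "- airfoil_V b z / b\<^sup>2 \<notin> \<real>\<^sub>\<le>\<^sub>0" if "z \<in> - \<gamma> ` {0..}" for z
  proof
    assume "- airfoil_V b z / b\<^sup>2 \<in> \<real>\<^sub>\<le>\<^sub>0"
    then obtain u where u: "- airfoil_V b z / b\<^sup>2 = of_real u" "u \<le> 0"
      by (rule nonpos_Reals_cases)
    have "airfoil_V b z = airfoil_V b (\<gamma> (- u / 2))"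
      using u(1) b0 unfolding V by (simp add: field_simps flip: minus_equation_iff) (metis minus_minus)
    then have "z = \<gamma> (- u / 2)" using b0 by (simp add: airfoil_V_def)
    with that u(2) show False by auto
  qed
  have hol: "k holomorphic_on - \<gamma> ` {0..}"
    unfolding k_def using notin b0
    by (intro holomorphic_intros holomorphic_on_compose_gen) (auto simp: airfoil_V_def intro!: holomorphic_intros)
  have sq: "(k z)\<^sup>2 = airfoil_V b z" for z
    using b0 by (simp add: k_def power_mult_distrib)
  have "(k 1)\<^sup>2 = (1 - b)\<^sup>2" unfolding sq by (simp add: airfoil_V_def power2_eq_square algebra_simps)
  then obtain e :: complex where e: "e\<^sup>2 = 1" "e * k 1 = 1 - b"
    by (metis mult_1 mult_minus_left power2_eq_iff power_one minus_minus power2_minus)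
  have lim: "filterlim \<gamma> at_infinity at_top"
  proof -
    have "filterlim (\<lambda>t::real. of_real t * (- b)) at_infinity at_top"
      by (subst mult.commute, rule tendsto_mult_filterlim_at_infinity[OF tendsto_const])
        (use b0 in \<open>auto intro!: filterlim_of_real_at_infinity\<close>)
    from tendsto_add_filterlim_at_infinity[OF tendsto_const[of "airfoil_c b"] this]
    show ?thesis by (simp add: \<gamma>_def)
  qed
  have "is_sqrt_V b (\<lambda>z. e * k z)"
    unfolding is_sqrt_V_def
  proof (intro conjI exI[of _ \<gamma>] ballI)
    show "continuous_on {0..} \<gamma>" unfolding \<gamma>_def by (intro continuous_intros)
    show "inj_on \<gamma> {0..}" using b0 by (auto simp: \<gamma>_def inj_on_def)
    show "\<gamma> 0 = airfoil_c b" by (simp add: \<gamma>_def)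
    show "\<gamma> ` {0..} \<inter> airfoil_arc b = {}" using avoid by auto
    show "(\<lambda>z. e * k z) holomorphic_on - \<gamma> ` {0..}" by (intro holomorphic_intros hol)
    show "(e * k z)\<^sup>2 = airfoil_V b z" for z by (simp add: power_mult_distrib e(1) sq)
  qed (use lim e in auto)
  then show ?thesis by blast
qed

lemma is_sqrt_arc_exists:
  assumes "Re b < 0" "Im b \<noteq> 0"
  shows "\<exists>s. is_sqrt_arc b s"
proof -
  define h where "h = (\<lambda>z::complex. (z\<^sup>2 - 1) / (z - b)\<^sup>2)"
  define s where "s = (\<lambda>z. (z - b) * csqrt (h z))"
  have b1: "b\<^sup>2 \<noteq> 1" using square_notin_Reals[OF assms] by auto
  have b_in: "b \<in> airfoil_arc b"
  proof -
    define v where "v = csqrt (1 - b\<^sup>2)"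
    have "v\<^sup>2 = airfoil_V b b" unfolding v_def power2_csqrt by (simp add: airfoil_V_def power2_eq_square)
    moreover have "v \<noteq> 0" using b1 by (auto simp: v_def)
    moreover have "(b - b) / v \<in> of_real ` {-1..1}" by (auto intro!: image_eqI[of _ _ 0])
    ultimately show ?thesis unfolding airfoil_arc_def by blast
  qed
  have notin: "h z \<notin> \<real>\<^sub>\<le>\<^sub>0" if z: "z \<notin> airfoil_arc b" for z
  proof
    assume "h z \<in> \<real>\<^sub>\<le>\<^sub>0"
    then obtain u where u: "h z = of_real u" "u \<le> 0" by (auto elim: nonpos_Reals_cases)
    have zb: "z \<noteq> b" using z b_in by auto
    define w where "w = sqrt (1 - u)"
    have w1: "w \<ge> 1" "w\<^sup>2 = 1 - u" using u(2) by (auto simp: w_def)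
    have "airfoil_V b z = (z - b)\<^sup>2 * (1 - h z)"
      using zb by (simp add: h_def airfoil_V_def divide_simps) (simp add: power2_eq_square algebra_simps)
    also have "1 - h z = (of_real w)\<^sup>2" using w1(2) u(1) by (metis of_real_1 of_real_diff of_real_power)
    finally have V: "((z - b) * of_real w)\<^sup>2 = airfoil_V b z" by (simp add: power_mult_distrib)
    have "(z - b) / ((z - b) * of_real w) = of_real (1 / w)" using zb w1 by simp
    moreover have "1 / w \<in> {-1..1}" using w1 by (simp add: divide_simps)
    ultimately have "(z - b) / ((z - b) * of_real w) \<in> of_real ` {-1..1}" by (metis imageI)
    then have "z \<in> airfoil_arc b"
      unfolding airfoil_arc_def using V zb w1(1)
      by (intro CollectI exI[of _ "(z - b) * of_real w"] conjI) auto
    with z show False by simp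
  qed
  have "is_sqrt_arc b s"
    unfolding is_sqrt_arc_def
  proof (intro conjI ballI)
    have "h holomorphic_on - airfoil_arc b"
      unfolding h_def using b_in by (intro holomorphic_intros) auto
    then show "s holomorphic_on - airfoil_arc b"
      unfolding s_def using notin by (intro holomorphic_intros) auto
    show "(s z)\<^sup>2 = z\<^sup>2 - 1" if "z \<in> - airfoil_arc b" for z
      using that b_in by (auto simp: s_def h_def power_mult_distrib)
    have i: "((\<lambda>z::complex. c / z) \<longlongrightarrow> 0) at_infinity" for c
      by (rule tendsto_divide_0[OF tendsto_const filterlim_ident])
    have "isCont csqrt ((1 - 0\<^sup>2) / (1 - 0)\<^sup>2)" by (rule continuous_at_csqrt) auto
    have "((\<lambda>z::complex. (1 - b / z) * csqrt ((1 - (1 / z)\<^sup>2) / (1 - b / z)\<^sup>2)) \<longlongrightarrow>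
             (1 - 0) * csqrt ((1 - 0\<^sup>2) / (1 - 0)\<^sup>2)) at_infinity"
      by (intro tendsto_mult isCont_tendsto_compose[OF \<open>isCont csqrt _\<close>]
          tendsto_divide tendsto_diff tendsto_power tendsto_const i) auto
    moreover have "\<forall>\<^sub>F z::complex in at_infinity.
        (1 - b / z) * csqrt ((1 - (1 / z)\<^sup>2) / (1 - b / z)\<^sup>2) = s z / z"
      using eventually_not_equal_at_infinity[of 0]
    proof eventually_elim
      case (elim z)
      then have "(1 - (1 / z)\<^sup>2) / (1 - b / z)\<^sup>2 = h z"
        by (simp add: h_def divide_simps power2_eq_square)
      then show ?case using elim by (simp add: s_def field_simps)
    qed
    ultimately show "((\<lambda>z. s z / z) \<longlongrightarrow> 1) at_infinity"
      using Lim_transform_eventually by fastforce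
  qed
  then show ?thesis by blast
qed

end

theory Submission
  imports Defs "HOL-Complex_Analysis.Complex_Analysis"
begin

text \<open>
  The point of departure is that the Faber polynomials of the airfoil are explicit.  For given \<open>z\<close> let
  \<open>p\<close> and \<open>q\<close> be the two solutions of \<open>p + q = 2 - 2z/b\<close>, \<open>(1 - p)(1 - q) = 1/b\<^sup>2\<close>; then
  \<open>F\<^sub>n(z) = (-b/a)\<^sup>n (p\<^sup>n + q\<^sup>n - 1)\<close> with \<open>a = 1 - b\<close> (lemma \<open>faber_closed_form\<close>).  So the zeros of
  \<open>F\<^sub>n\<close> are the points at which the three exponentials \<open>p\<^sup>n\<close>, \<open>q\<^sup>n\<close>, \<open>1\<close> balance.

  Where one of the moduli \<open>|p|\<close>, \<open>|q|\<close>, \<open>1\<close> strictly exceeds the other two there is no zero nearby for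
  large \<open>n\<close> (\<open>locally_zero_free\<close>), and compactness makes this uniform (\<open>zeros_accumulate\<close>).  The
  remaining points satisfy \<open>|p| = |q| \<ge> 1\<close> or \<open>max |p| |q| = 1\<close>.  The arc is exactly the set
  \<open>|p| = |q|\<close>: it is parametrized by \<open>t \<in> [-1,1]\<close> through \<open>z = b + t v(t)\<close> with
  \<open>v(t) = (1 - b\<^sup>2(1 - t\<^sup>2))\<^sup>1\<^sup>/\<^sup>2 - b t\<close>, and there \<open>p, q = -(v/b) e\<^sup>\<plusminus>\<^sup>i\<^sup>\<alpha>\<close> with \<open>t = cos \<alpha>\<close>.  Off the arc
  \<open>\<phi>\<^sub>b\<close> is the root of larger modulus, because the complement of the arc is connected and the claim
  holds near infinity (\<open>norm_phi_conj_less\<close>).  Moreover \<open>|v| = |b|\<close> at a single parameter, where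
  \<open>v\<close> is minus the conjugate of \<open>b\<close>; this gives \<open>i\<^sub>b\<close> and \<open>c\<^sub>\<plusminus>\<close> in closed form.  The inverse of \<open>\<phi>\<^sub>b\<close> is
  \<open>p \<mapsto> J(b(1 - p))\<close>, and the condition that \<open>p\<close> is the larger root cuts the unit circle by a
  half-plane, which leaves the arc from \<open>c\<^sub>+\<close> to \<open>c\<^sub>-\<close>.  That the loop is a Jordan curve with a corner is
  then a computation.

  For the distribution of the zeros, put \<open>p, q = -(v/b) e\<^sup>\<plusminus>\<^sup>i\<^sup>y\<close> near the arc and \<open>p = e\<^sup>i\<^sup>y\<close> near the loop.  The
  equation becomes \<open>cos (n y) = (-b/v)\<^sup>n / 2\<close> or \<open>e\<^sup>i\<^sup>n\<^sup>y = 1 - q\<^sup>n\<close>, in both cases \<open>n y = c + k d + E(y)\<close>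
  with an integer \<open>k\<close> and an exponentially small \<open>E\<close>, and Brouwer's theorem gives a zero for each
  \<open>k\<close> (\<open>zeros_along_curve\<close>).  By Fatou's lemma, \<open>liminf \<integral> f d\<mu>\<^sub>n \<ge> \<integral> f d\<mu>\<close> for every continuous
  \<open>f \<ge> 0\<close>, where \<open>\<mu>\<close> is the asserted limit.  Since \<open>\<mu>\<^sub>n\<close> has mass at most one and \<open>\<mu>\<close> has mass at
  least one, the lower bounds for \<open>B + f\<close> and \<open>B - f\<close> together are the weak convergence
  (\<open>weak_star_limit_of_lower_bounds\<close>).
\<close>

section \<open>The Faber polynomials in closed form\<close>

text \<open>If \<open>\<xi>\<close> and \<open>1/\<xi>\<close> are the two preimages of \<open>z\<close> under the Joukowski map, then \<open>p = 1 - \<xi>/b\<close> and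
  \<open>q = 1 - 1/(\<xi> b)\<close>.  The relation is symmetric in \<open>p\<close> and \<open>q\<close>, which avoids a choice of the
  square root of \<open>z\<^sup>2 - 1\<close>.\<close>
definition root_pair :: "complex \<Rightarrow> complex \<Rightarrow> complex \<Rightarrow> complex \<Rightarrow> bool" where
  "root_pair b z p q \<longleftrightarrow> p + q = 2 - 2 * z / b \<and> (1 - p) * (1 - q) = 1 / b\<^sup>2"

lemma root_pair_exists:
  assumes "b \<noteq> 0"
  obtains p q where "root_pair b z p q"
proof
  have "(csqrt (z\<^sup>2 - 1))\<^sup>2 = z\<^sup>2 - 1" by simp
  then have "(z + csqrt (z\<^sup>2 - 1)) * (z - csqrt (z\<^sup>2 - 1)) = 1"
    by (simp add: algebra_simps power2_eq_square)
  then show "root_pair b z (1 - (z + csqrt (z\<^sup>2 - 1)) / b) (1 - (z - csqrt (z\<^sup>2 - 1)) / b)"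
    using assms by (simp add: root_pair_def field_simps power2_eq_square)
qed

lemma root_pair_commute: "root_pair b z p q \<Longrightarrow> root_pair b z q p"
  by (auto simp: root_pair_def algebra_simps)

lemma root_pair_prod:
  assumes "b \<noteq> 0" "root_pair b z p q"
  shows "p * q = airfoil_V b z / b\<^sup>2"
proof -
  have "p * q = (1 - p) * (1 - q) - 1 + (p + q)" by (simp add: algebra_simps)
  also have "\<dots> = airfoil_V b z / b\<^sup>2"
    using assms(2)[unfolded root_pair_def] assms(1)
    by (simp only:) (simp add: airfoil_V_def field_simps power2_eq_square)
  finally show ?thesis .
qed

lemma root_pair_unique:
  assumes "root_pair b z p q" "root_pair b z p' q'"
  shows "p' = p \<and> q' = q \<or> p' = q \<and> q' = p"
proof -
  have e: "p' + q' = p + q" "(1 - p') * (1 - q') = (1 - p) * (1 - q)"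
    using assms by (auto simp: root_pair_def)
  have "(p' - p) * (p' - q) = 0" using e by algebra
  then have "p' = p \<or> p' = q" by simp
  then show ?thesis using e(1) by (metis add.commute add_left_cancel)
qed

lemma geometric_at_infinity:
  fixes \<alpha> :: complex
  shows "\<forall>\<^sub>F w in at_infinity. (\<lambda>n. \<alpha> ^ n / w ^ (n + 1)) sums (1 / (w - \<alpha>))"
  unfolding eventually_at_infinity
proof (intro exI[of _ "norm \<alpha> + 1"] allI impI)
  fix w :: complex assume w: "norm \<alpha> + 1 \<le> norm w"
  then have w0: "w \<noteq> 0" using norm_ge_zero[of \<alpha>] by (metis add_increasing less_le_not_le norm_zero zero_less_one add_pos_nonneg add.commute)
  have "norm (\<alpha> / w) < 1" using w w0 by (simp add: norm_divide)
  from sums_mult[OF geometric_sums[OF this], of "1 / w"]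
  have "(\<lambda>n. 1 / w * (\<alpha> / w) ^ n) sums (1 / w * (1 / (1 - \<alpha> / w)))" .
  moreover have "1 / w * (1 / (1 - \<alpha> / w)) = 1 / (w - \<alpha>)"
    using w0 by (simp add: right_diff_distrib)
  moreover have "1 / w * (\<alpha> / w) ^ n = \<alpha> ^ n / w ^ (n + 1)" for n
    by (simp add: power_divide)
  ultimately show "(\<lambda>n. \<alpha> ^ n / w ^ (n + 1)) sums (1 / (w - \<alpha>))" by simp
qed

text \<open>With \<open>u = 1/w\<close> both series are power series in \<open>u\<close>.  The coefficients are shifted by one place, so
  that both sums vanish at \<open>u = 0\<close>, where the hypotheses say nothing.\<close>
lemma laurent_coefficients_unique:
  fixes f g :: "nat \<Rightarrow> complex" and h :: "complex \<Rightarrow> complex"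
  assumes f: "\<forall>\<^sub>F w in at_infinity. (\<lambda>n. f n / w ^ (n + 1)) sums h w"
    and g: "\<forall>\<^sub>F w in at_infinity. (\<lambda>n. g n / w ^ (n + 1)) sums h w"
  shows "f = g"
proof -
  have shift: "(\<lambda>n. (case n of 0 \<Rightarrow> 0 | Suc m \<Rightarrow> F m) * u ^ n) sums H"
    if "(\<lambda>n. F n / (1 / u) ^ (n + 1)) sums H" for F and u H :: complex
  proof -
    have "(\<lambda>n. F n * u ^ Suc n) sums H" using that by (simp add: power_divide field_simps)
    from sums_Suc[where f = "\<lambda>n. (case n of 0 \<Rightarrow> 0 | Suc m \<Rightarrow> F m) * u ^ n"] this
    show ?thesis by simp
  qed
  have ev: "\<forall>\<^sub>F u in nhds 0. u \<noteq> 0 \<longrightarrow>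
      eval_fps (Abs_fps (\<lambda>n. case n of 0 \<Rightarrow> 0 | Suc m \<Rightarrow> F m)) u = h (1 / u) \<and>
      summable (\<lambda>n. (case n of 0 \<Rightarrow> 0 | Suc m \<Rightarrow> F m) * u ^ n)"
    if "\<forall>\<^sub>F w in at_infinity. (\<lambda>n. F n / w ^ (n + 1)) sums h w" for F
  proof -
    have "\<forall>\<^sub>F u in at 0. (\<lambda>n. F n / (1 / u) ^ (n + 1)) sums h (1 / u)"
      using that unfolding at_to_infinity by (simp add: eventually_filtermap inverse_eq_divide)
    then have "\<forall>\<^sub>F u in nhds 0. u \<noteq> 0 \<longrightarrow> (\<lambda>n. F n / (1 / u) ^ (n + 1)) sums h (1 / u)"
      by (simp add: eventually_at_filter)
    then show ?thesis
    proof eventually_elim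
      case (elim u)
      show ?case
      proof
        assume "u \<noteq> 0"
        with elim have "(\<lambda>n. F n / (1 / u) ^ (n + 1)) sums h (1 / u)" by simp
        from shift[OF this] show "eval_fps (Abs_fps (\<lambda>n. case n of 0 \<Rightarrow> 0 | Suc m \<Rightarrow> F m)) u = h (1 / u) \<and>
            summable (\<lambda>n. (case n of 0 \<Rightarrow> 0 | Suc m \<Rightarrow> F m) * u ^ n)"
          by (simp add: eval_fps_def sums_iff)
      qed
    qed
  qed
  have rad: "fps_conv_radius (Abs_fps (\<lambda>n. case n of 0 \<Rightarrow> 0 | Suc m \<Rightarrow> F m)) > 0"
    if F: "\<forall>\<^sub>F w in at_infinity. (\<lambda>n. F n / w ^ (n + 1)) sums h w" for F
  proof -
    obtain e where e: "e > 0" and sm: "\<And>u. u \<noteq> 0 \<Longrightarrow> norm u < e \<Longrightarrow>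
        summable (\<lambda>n. (case n of 0 \<Rightarrow> 0 | Suc m \<Rightarrow> F m) * u ^ n)"
      using ev[OF F] unfolding eventually_nhds_metric dist_norm by auto
    have "summable (\<lambda>n. (case n of 0 \<Rightarrow> 0 | Suc m \<Rightarrow> F m) * of_real (e / 2) ^ n)"
      using e by (intro sm) auto
    then have "ereal (norm (of_real (e / 2) :: complex))
        \<le> conv_radius (\<lambda>n. case n of 0 \<Rightarrow> 0 | Suc m \<Rightarrow> F m)"
      by (intro conv_radius_geI)
    then show ?thesis using e
      by (auto simp: fps_conv_radius_def intro: less_le_trans[of _ "ereal (e / 2)"])
  qed
  have "Abs_fps (\<lambda>n. case n of 0 \<Rightarrow> 0 | Suc m \<Rightarrow> f m) = Abs_fps (\<lambda>n. case n of 0 \<Rightarrow> 0 | Suc m \<Rightarrow> g m)"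
  proof (rule eval_fps_eqD[OF rad[OF f] rad[OF g]])
    show "\<forall>\<^sub>F u in nhds 0. eval_fps (Abs_fps (\<lambda>n. case n of 0 \<Rightarrow> 0 | Suc m \<Rightarrow> f m)) u =
        eval_fps (Abs_fps (\<lambda>n. case n of 0 \<Rightarrow> 0 | Suc m \<Rightarrow> g m)) u"
      using ev[OF f] ev[OF g]
    proof eventually_elim
      case (elim u)
      then show ?case by (cases "u = 0") (auto simp: eval_fps_at_0)
    qed
  qed
  then have "(case Suc n of 0 \<Rightarrow> 0 | Suc m \<Rightarrow> f m) = (case Suc n of 0 \<Rightarrow> 0 | Suc m \<Rightarrow> g m)" for n
    by (metis fps_nth_Abs_fps)
  then show "f = g" by auto
qed

text \<open>Partial fractions: with \<open>T = a w + b\<close>, the function \<open>J(T) - z\<close> vanishes at \<open>T = \<xi>\<close> and \<open>T = 1/\<xi>\<close>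
  and has a pole at \<open>T = 0\<close>.\<close>
lemma airfoil_map_logarithmic_derivative:
  assumes a: "a = of_real R * cis \<theta>" "a \<noteq> 0" and b: "b = 1 - a" "b \<noteq> 0"
    and pq: "root_pair b z p q"
  shows "\<forall>\<^sub>F w in at_infinity. deriv (airfoil_map R \<theta>) w / (airfoil_map R \<theta> w - z) =
     1 / (w - (- b / a * p)) + 1 / (w - (- b / a * q)) - 1 / (w - (- b / a))"
proof -
  have "\<forall>\<^sub>F w in at_infinity. w \<noteq> - b / a \<and> w \<noteq> - b / a * p \<and> w \<noteq> - b / a * q"
    by (intro eventually_conj eventually_not_equal_at_infinity)
  then show ?thesis
  proof eventually_elim
    case (elim w)
    define T where "T = a * w + b"
    define \<xi> \<eta> where "\<xi> = b * (1 - p)" and "\<eta> = b * (1 - q)"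
    have \<xi>\<eta>: "\<xi> * \<eta> = 1" "\<xi> + \<eta> = 2 * z"
      using pq b(2) by (auto simp: root_pair_def \<xi>_def \<eta>_def field_simps power2_eq_square)
    have T0: "T \<noteq> 0" using elim a(2) by (auto simp: T_def field_simps add_eq_0_iff)
    have T1: "T - \<xi> \<noteq> 0" "T - \<eta> \<noteq> 0"
      using elim a(2) by (auto simp: T_def \<xi>_def \<eta>_def field_simps add_eq_0_iff)
    have "airfoil_map R \<theta> = (\<lambda>w. ((a * w + b) + 1 / (a * w + b)) / 2)"
      by (simp add: airfoil_map_def joukowski_def fun_eq_iff flip: a(1) b(1))
    moreover have "((\<lambda>w. ((a * w + b) + 1 / (a * w + b)) / 2) has_field_derivative (a - a / T\<^sup>2) / 2) (at w)"
      using T0 unfolding T_def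
      by (auto intro!: derivative_eq_intros simp: power2_eq_square)
    ultimately have "(airfoil_map R \<theta> has_field_derivative (a - a / T\<^sup>2) / 2) (at w)" by simp
    then have d: "deriv (airfoil_map R \<theta>) w = (a - a / T\<^sup>2) / 2" by (rule DERIV_imp_deriv)
    have v: "airfoil_map R \<theta> w - z = (T - \<xi>) * (T - \<eta>) / (2 * T)"
    proof -
      have "(T - \<xi>) * (T - \<eta>) = T\<^sup>2 - 2 * z * T + 1"
        using \<xi>\<eta> by (simp add: algebra_simps power2_eq_square) (metis distrib_left mult.commute mult.left_commute)
      moreover have "airfoil_map R \<theta> w = (T + 1 / T) / 2"
        by (simp add: airfoil_map_def joukowski_def T_def flip: a(1) b(1))
      ultimately show ?thesis using T0 by (simp add: field_simps power2_eq_square)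
    qed
    have w1: "w - (- b / a * p) = (T - \<xi>) / a" "w - (- b / a * q) = (T - \<eta>) / a" "w - (- b / a) = T / a"
      using a(2) by (simp_all add: T_def \<xi>_def \<eta>_def field_simps)
    have "a / (T - \<xi>) + a / (T - \<eta>) - a / T = a * (T * (2 * T - (\<xi> + \<eta>)) - (T - \<xi>) * (T - \<eta>)) / (T * ((T - \<xi>) * (T - \<eta>)))"
      using T0 T1 by (simp add: divide_simps) (simp add: algebra_simps)
    also have "T * (2 * T - (\<xi> + \<eta>)) - (T - \<xi>) * (T - \<eta>) = T\<^sup>2 - 1"
      using \<xi>\<eta>(1) by (simp add: algebra_simps power2_eq_square)
    also have "a * (T\<^sup>2 - 1) / (T * ((T - \<xi>) * (T - \<eta>))) = (a - a / T\<^sup>2) / 2 / ((T - \<xi>) * (T - \<eta>) / (2 * T))"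
      using T0 T1 by (simp add: divide_simps) (simp add: algebra_simps power2_eq_square)
    finally show ?case unfolding d v w1 by simp
  qed
qed

lemma faber_closed_form:
  assumes F: "faber_polynomials (airfoil_map R \<theta>) F"
    and a: "a = of_real R * cis \<theta>" "a \<noteq> 0" and b: "b = 1 - a" "b \<noteq> 0"
    and pq: "root_pair b z p q"
  shows "poly (F n) z = (- b / a) ^ n * (p ^ n + q ^ n - 1)"
proof -
  have 1: "\<forall>\<^sub>F w in at_infinity. (\<lambda>n. poly (F n) z / w ^ (n + 1)) sums
      (deriv (airfoil_map R \<theta>) w / (airfoil_map R \<theta> w - z))"
    using F by (simp add: faber_polynomials_def)
  have 2: "\<forall>\<^sub>F w in at_infinity.
      (\<lambda>n. ((- b / a * p) ^ n + (- b / a * q) ^ n - (- b / a) ^ n) / w ^ (n + 1)) sums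
      (deriv (airfoil_map R \<theta>) w / (airfoil_map R \<theta> w - z))"
    using geometric_at_infinity[of "- b / a * p"] geometric_at_infinity[of "- b / a * q"]
      geometric_at_infinity[of "- b / a"] airfoil_map_logarithmic_derivative[OF a b pq]
  proof eventually_elim
    case (elim w)
    from sums_diff[OF sums_add[OF elim(1,2)] elim(3)] show ?case
      unfolding elim(4) by (simp add: add_divide_distrib diff_divide_distrib)
  qed
  from laurent_coefficients_unique[OF 1 2]
  have "poly (F n) z = (- b / a * p) ^ n + (- b / a * q) ^ n - (- b / a) ^ n" by metis
  then show ?thesis by (simp add: algebra_simps flip: power_mult_distrib)
qed

text \<open>Newton's recurrence for \<open>p\<^sup>n + q\<^sup>n\<close> has coefficients \<open>p + q\<close> and \<open>pq\<close>, both of degree one in \<open>z\<close>;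
  hence the degree grows by at most one in each step.\<close>
lemma power_sum_polynomial:
  assumes "b \<noteq> 0"
  shows "\<exists>P. degree P \<le> n \<and> (\<forall>z p q. root_pair b z p q \<longrightarrow> poly P z = p ^ n + q ^ n)"
proof (induction n rule: less_induct)
  case (less n)
  consider "n = 0" | "n = 1" | m where "n = Suc (Suc m)" by (metis One_nat_def old.nat.exhaust)
  then show ?case
  proof cases
    case 1
    then show ?thesis by (intro exI[of _ "[:2:]"]) auto
  next
    case 2
    then show ?thesis by (intro exI[of _ "[:2, - 2 / b:]"]) (auto simp: root_pair_def)
  next
    case 3
    obtain P0 where P0: "degree P0 \<le> m" "\<And>z p q. root_pair b z p q \<Longrightarrow> poly P0 z = p ^ m + q ^ m"
      using less.IH[of m] 3 by auto
    obtain P1 where P1: "degree P1 \<le> Suc m"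
      "\<And>z p q. root_pair b z p q \<Longrightarrow> poly P1 z = p ^ Suc m + q ^ Suc m"
      using less.IH[of "Suc m"] 3 by blast
    have "degree ([:2, - 2 / b:] * P1 - [:1 + 1 / b\<^sup>2, - 2 / b:] * P0) \<le> n"
    proof (intro degree_diff_le)
      show "degree ([:2, - 2 / b:] * P1) \<le> n"
        using degree_mult_le[of "[:2, - 2 / b:]" P1] P1(1) 3 by (simp split: if_splits)
      show "degree ([:1 + 1 / b\<^sup>2, - 2 / b:] * P0) \<le> n"
        using degree_mult_le[of "[:1 + 1 / b\<^sup>2, - 2 / b:]" P0] P0(1) 3 by (simp split: if_splits)
    qed
    moreover have "poly ([:2, - 2 / b:] * P1 - [:1 + 1 / b\<^sup>2, - 2 / b:] * P0) z = p ^ n + q ^ n"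
      if pq: "root_pair b z p q" for z p q
    proof -
      have "poly [:2, - 2 / b:] z = p + q" using pq by (simp add: root_pair_def)
      moreover have "poly [:1 + 1 / b\<^sup>2, - 2 / b:] z = p * q"
        using assms by (simp add: root_pair_prod[OF assms pq] airfoil_V_def field_simps power2_eq_square)
      ultimately show ?thesis
        unfolding poly_diff poly_mult P0(2)[OF pq] P1(2)[OF pq] 3
        by (simp only:) (simp add: algebra_simps)
    qed
    ultimately show ?thesis by blast
  qed
qed

lemma degree_faber_le:
  assumes F: "faber_polynomials (airfoil_map R \<theta>) F"
    and a: "a = of_real R * cis \<theta>" "a \<noteq> 0" and b: "b = 1 - a" "b \<noteq> 0"
  shows "degree (F n) \<le> n"
proof -
  obtain P where P: "degree P \<le> n" "\<And>z p q. root_pair b z p q \<Longrightarrow> poly P z = p ^ n + q ^ n"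
    using power_sum_polynomial[OF b(2)] by blast
  have "poly (F n) z = poly (smult ((- b / a) ^ n) (P - 1)) z" for z
  proof -
    obtain p q where pq: "root_pair b z p q" using root_pair_exists[OF b(2)] .
    show ?thesis using P(2)[OF pq] faber_closed_form[OF F a b pq] by simp
  qed
  then have "F n = smult ((- b / a) ^ n) (P - 1)" by (intro poly_ext) auto
  moreover have "degree (P - 1) \<le> n" using P(1) by (intro degree_diff_le) auto
  ultimately show ?thesis using degree_smult_le order_trans by metis
qed

section \<open>The larger and the smaller of the two moduli\<close>

text \<open>\<open>|p|\<close> and \<open>|q|\<close> depend continuously on \<open>z\<close> only as an unordered pair.  The next two functions are
  \<open>|p|\<^sup>2 + |q|\<^sup>2\<close>, by the parallelogram law with \<open>(p - q)\<^sup>2 = (p + q)\<^sup>2 - 4pq\<close>, and \<open>| |p|\<^sup>2 - |q|\<^sup>2 |\<close>,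
  both written in terms of the coefficients \<open>p + q\<close> and \<open>pq\<close>, so that continuity is visible.\<close>
definition moduli_sum :: "complex \<Rightarrow> complex \<Rightarrow> real" where
  "moduli_sum b z =
     ((norm (2 - 2 * z / b))\<^sup>2 + norm ((2 - 2 * z / b)\<^sup>2 - 4 * airfoil_V b z / b\<^sup>2)) / 2"

definition moduli_gap :: "complex \<Rightarrow> complex \<Rightarrow> real" where
  "moduli_gap b z = sqrt ((moduli_sum b z)\<^sup>2 - 4 * (norm (airfoil_V b z / b\<^sup>2))\<^sup>2)"

definition larger_modulus :: "complex \<Rightarrow> complex \<Rightarrow> real" where
  "larger_modulus b z = sqrt ((moduli_sum b z + moduli_gap b z) / 2)"

definition smaller_modulus :: "complex \<Rightarrow> complex \<Rightarrow> real" where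
  "smaller_modulus b z = sqrt ((moduli_sum b z - moduli_gap b z) / 2)"

lemma continuous_moduli:
  assumes "b \<noteq> 0"
  shows "continuous_on S (larger_modulus b)" "continuous_on S (smaller_modulus b)"
  unfolding larger_modulus_def smaller_modulus_def moduli_gap_def moduli_sum_def airfoil_V_def
  using assms by (auto intro!: continuous_intros)

lemma larger_smaller_modulus:
  assumes b: "b \<noteq> 0" and pq: "root_pair b z p q"
  shows "larger_modulus b z = max (norm p) (norm q)"
    and "smaller_modulus b z = min (norm p) (norm q)"
proof -
  have V: "airfoil_V b z / b\<^sup>2 = p * q" using root_pair_prod[OF b pq] by simp
  have V4: "4 * airfoil_V b z / b\<^sup>2 = 4 * (p * q)" unfolding V[symmetric] by (rule times_divide_eq_right[symmetric])
  have S: "2 - 2 * z / b = p + q" using pq by (simp add: root_pair_def)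
  have d: "(p + q)\<^sup>2 - 4 * (p * q) = (p - q)\<^sup>2" by (simp add: power2_eq_square algebra_simps)
  have ms: "moduli_sum b z = (norm p)\<^sup>2 + (norm q)\<^sup>2"
  proof -
    have "moduli_sum b z = ((norm (p + q))\<^sup>2 + (norm (p - q))\<^sup>2) / 2"
    proof -
      have "norm ((2 - 2 * z / b)\<^sup>2 - 4 * airfoil_V b z / b\<^sup>2) = norm ((p - q)\<^sup>2)"
        by (simp only: S V4 d)
      then have "norm ((2 - 2 * z / b)\<^sup>2 - 4 * airfoil_V b z / b\<^sup>2) = (norm (p - q))\<^sup>2"
        by (rule trans) (rule norm_power)
      then show ?thesis unfolding moduli_sum_def by (simp only: S)
    qed
    also have "\<dots> = (norm p)\<^sup>2 + (norm q)\<^sup>2"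
      unfolding cmod_power2 by (simp add: power2_eq_square algebra_simps)
    finally show ?thesis .
  qed
  have gap: "moduli_gap b z = \<bar>(norm p)\<^sup>2 - (norm q)\<^sup>2\<bar>"
  proof -
    have "(moduli_sum b z)\<^sup>2 - 4 * (norm (airfoil_V b z / b\<^sup>2))\<^sup>2 = ((norm p)\<^sup>2 - (norm q)\<^sup>2)\<^sup>2"
      unfolding ms V norm_mult by (simp add: power2_eq_square algebra_simps)
    then show ?thesis by (simp add: moduli_gap_def)
  qed
  have "larger_modulus b z = max (norm p) (norm q) \<and> smaller_modulus b z = min (norm p) (norm q)"
  proof (cases "norm p \<le> norm q")
    case True
    then have "\<bar>(norm p)\<^sup>2 - (norm q)\<^sup>2\<bar> = (norm q)\<^sup>2 - (norm p)\<^sup>2" by (simp add: power_mono)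
    then show ?thesis
      unfolding larger_modulus_def smaller_modulus_def ms gap using True by simp
  next
    case False
    then have "\<bar>(norm p)\<^sup>2 - (norm q)\<^sup>2\<bar> = (norm p)\<^sup>2 - (norm q)\<^sup>2" by (simp add: power_mono)
    then show ?thesis
      unfolding larger_modulus_def smaller_modulus_def ms gap using False by simp
  qed
  then show "larger_modulus b z = max (norm p) (norm q)" "smaller_modulus b z = min (norm p) (norm q)"
    by auto
qed

lemma larger_modulus_le:
  assumes "b \<noteq> 0"
  shows "norm z \<le> norm b * (larger_modulus b z + 1)"
proof -
  obtain p q where pq: "root_pair b z p q" using root_pair_exists[OF assms] .
  have "p + q = 2 - 2 * z / b" using pq by (simp add: root_pair_def)
  then have "z = b * (1 - (p + q) / 2)" using assms by (simp add: diff_divide_distrib)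
  then have "norm z = norm b * norm (1 - (p + q) / 2)" by (metis norm_mult)
  moreover have "norm (1 - (p + q) / 2) \<le> 1 + norm ((p + q) / 2)"
    by (metis norm_triangle_ineq4 norm_one)
  moreover have "norm ((p + q) / 2) \<le> (norm p + norm q) / 2"
    using norm_triangle_ineq[of p q] by (simp add: norm_divide)
  moreover have "(norm p + norm q) / 2 \<le> larger_modulus b z"
    by (simp add: larger_smaller_modulus[OF assms pq])
  ultimately show ?thesis by (simp add: mult_left_mono)
qed

text \<open>As \<open>(1 - p)(1 - q) = 1/b\<^sup>2\<close>, a large \<open>p\<close> keeps \<open>q\<close> close to \<open>1\<close>, and \<open>p\<^sup>n\<close> dominates from \<open>n = 1\<close>
  on.  This confines the zeros to a disc that does not depend on \<open>n\<close>.\<close>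
lemma far_zero_free:
  assumes b: "b \<noteq> 0" and pq: "root_pair b z p q" and n: "n \<ge> 1"
    and large: "larger_modulus b z \<ge> 4 + 1 / (norm b)\<^sup>2"
  shows "p ^ n + q ^ n \<noteq> 1"
proof -
  have main: "p ^ n + q ^ n \<noteq> 1"
    if pq: "root_pair b z p q" and le: "norm q \<le> norm p" for p q
  proof
    assume eq: "p ^ n + q ^ n = 1"
    have p: "norm p \<ge> 4 + 1 / (norm b)\<^sup>2"
      using large larger_smaller_modulus[OF b pq] le by simp
    have prod: "norm (1 - p) * norm (1 - q) = 1 / (norm b)\<^sup>2"
      using pq by (metis root_pair_def norm_divide norm_mult norm_one norm_power)
    have "norm (1 - p) \<ge> norm p - 1" by (metis norm_minus_commute norm_one norm_triangle_ineq2)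
    then have p1: "norm (1 - p) \<ge> 1 + 1 / (norm b)\<^sup>2" using p by simp
    have "norm (1 - q) \<le> 1"
    proof (rule ccontr)
      assume "\<not> norm (1 - q) \<le> 1"
      then have "norm (1 - p) * 1 \<le> norm (1 - p) * norm (1 - q)" by (intro mult_left_mono) auto
      with p1 prod show False by simp
    qed
    then have q: "norm q \<le> 2"
      using norm_triangle_ineq4[of 1 "1 - q"] by simp
    have "norm p \<ge> 4" using p by (smt (verit) divide_nonneg_nonneg zero_le_power2)
    then have "4 ^ n \<le> norm (p ^ n)" by (simp add: norm_power power_mono)
    moreover have "norm (q ^ n) \<le> 2 ^ n" using q by (simp add: norm_power power_mono)
    moreover have "norm (p ^ n) \<le> 1 + norm (q ^ n)"
      using eq by (metis add_diff_cancel_right' norm_one norm_triangle_ineq4)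
    ultimately have "(4::real) ^ n \<le> 1 + 2 ^ n" by linarith
    moreover have "(4::real) ^ n = 2 ^ n * 2 ^ n" by (simp flip: power_mult_distrib)
    moreover have "(2::real) ^ n \<ge> 2" using n self_le_power[of "2::real" n] by simp
    ultimately have "(2::real) ^ n * 2 ^ n \<le> 1 + 2 ^ n" "2 * (2::real)^n \<le> 2 ^ n * 2 ^ n"
      by (simp_all add: mult_right_mono)
    then show False using \<open>(2::real) ^ n \<ge> 2\<close> by linarith
  qed
  show ?thesis
  proof (cases "norm q \<le> norm p")
    case True then show ?thesis using main[OF pq] by simp
  next
    case False then show ?thesis using main[OF root_pair_commute[OF pq]] by (simp add: add.commute)
  qed
qed

text \<open>Near a point where the larger modulus is below \<open>1\<close>, or above \<open>1\<close> and not equalled by the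
  smaller one, a single term of \<open>p ^ n + q ^ n = 1\<close> dominates geometrically.\<close>

lemma locally_zero_free:
  assumes b: "b \<noteq> 0"
    and z0: "larger_modulus b z0 < 1 \<or>
       larger_modulus b z0 > 1 \<and> smaller_modulus b z0 < larger_modulus b z0"
  shows "\<exists>U. open U \<and> z0 \<in> U \<and> (\<forall>\<^sub>F n in sequentially.
           \<forall>z\<in>U. \<forall>p q. root_pair b z p q \<longrightarrow> p ^ n + q ^ n \<noteq> 1)"
proof -
  note cont = continuous_moduli[OF b, of UNIV]
  have lim0: "\<forall>\<^sub>F n in sequentially. x ^ n < e" if "0 \<le> x" "x < 1" "e > 0" for x e :: real
    using that by (intro order_tendstoD(2)[OF LIMSEQ_power_zero]) auto
  have half: "(0::real) < 1 / 2" by simp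
  from z0 show ?thesis
  proof
    assume "larger_modulus b z0 < 1"
    then obtain \<rho> where \<rho>: "larger_modulus b z0 < \<rho>" "\<rho> < 1" using dense by blast
    define U where "U = {z. larger_modulus b z < \<rho>}"
    have "open U" unfolding U_def by (intro open_Collect_less cont continuous_intros)
    moreover have "z0 \<in> U" using \<rho> by (simp add: U_def)
    moreover have "\<forall>\<^sub>F n in sequentially. \<forall>z\<in>U. \<forall>p q. root_pair b z p q \<longrightarrow> p ^ n + q ^ n \<noteq> 1"
    proof -
      obtain p0 q0 where "root_pair b z0 p0 q0" using root_pair_exists[OF b] .
      then have "larger_modulus b z0 \<ge> 0"
        using larger_smaller_modulus[OF b] by (simp add: le_max_iff_disj)
      then have "\<rho> \<ge> 0" using \<rho> by simp
      from lim0[OF this \<rho>(2), of "1 / 2", OF half] show ?thesis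
      proof eventually_elim
        case n: (elim n)
        show ?case
        proof (intro ballI allI impI notI)
          fix z p q
          assume z: "z \<in> U" and pq: "root_pair b z p q" and eq: "p ^ n + q ^ n = 1"
          have "norm p \<le> \<rho>" "norm q \<le> \<rho>"
            using z larger_smaller_modulus[OF b pq] by (auto simp: U_def)
          then have "norm (p ^ n) \<le> \<rho> ^ n" "norm (q ^ n) \<le> \<rho> ^ n"
            by (auto simp: norm_power intro: power_mono)
          moreover have "1 \<le> norm (p ^ n) + norm (q ^ n)" using eq by (metis norm_one norm_triangle_ineq)
          ultimately show False using n by simp
        qed
      qed
    qed
    ultimately show ?thesis by blast
  next
    assume h: "larger_modulus b z0 > 1 \<and> smaller_modulus b z0 < larger_modulus b z0"
    then obtain \<rho> where \<rho>: "1 < \<rho>" "\<rho> < larger_modulus b z0" using dense by blast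
    obtain \<sigma>0 where \<sigma>0: "smaller_modulus b z0 / larger_modulus b z0 < \<sigma>0" "\<sigma>0 < 1"
      using dense[of "smaller_modulus b z0 / larger_modulus b z0" 1] h by auto
    have pos: "larger_modulus b z \<ge> 0" "smaller_modulus b z \<ge> 0" for z
    proof -
      obtain p q where "root_pair b z p q" using root_pair_exists[OF b] .
      then show "larger_modulus b z \<ge> 0" "smaller_modulus b z \<ge> 0"
        using larger_smaller_modulus[OF b] by (simp_all add: le_max_iff_disj)
    qed
    have "0 < larger_modulus b z0" using h by linarith
    then have \<sigma>1: "smaller_modulus b z0 < \<sigma>0 * larger_modulus b z0"
      using \<sigma>0(1) by (simp only: pos_divide_less_eq)
    have "0 \<le> smaller_modulus b z0 / larger_modulus b z0" by (intro divide_nonneg_nonneg pos)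
    then have \<sigma>2: "0 \<le> \<sigma>0" using \<sigma>0(1) by linarith
    note \<sigma> = \<sigma>1 \<sigma>2
    define U where "U = {z. \<rho> < larger_modulus b z} \<inter> {z. smaller_modulus b z < \<sigma>0 * larger_modulus b z}"
    have "open U" unfolding U_def by (intro open_Int open_Collect_less cont continuous_intros)
    moreover have "z0 \<in> U" using \<rho> \<sigma> by (simp add: U_def)
    moreover have "\<forall>\<^sub>F n in sequentially. \<forall>z\<in>U. \<forall>p q. root_pair b z p q \<longrightarrow> p ^ n + q ^ n \<noteq> 1"
    proof -
      have "\<forall>\<^sub>F n in sequentially. (1 / \<rho>) ^ n < 1 / 2" by (rule lim0) (use \<rho> in auto)
      with lim0[OF \<sigma>(2) \<sigma>0(2), of "1 / 2", OF half] show ?thesis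
      proof eventually_elim
        case n: (elim n)
        show ?case
        proof (intro ballI allI impI notI)
          fix z p q
          assume z: "z \<in> U" and pq: "root_pair b z p q"
            and eq: "p ^ n + q ^ n = 1"
          define M m where "M = max (norm p) (norm q)" and "m = min (norm p) (norm q)"
          have Mm: "\<rho> < M" "m < \<sigma>0 * M" "0 \<le> m"
            using z larger_smaller_modulus[OF b pq] by (auto simp: U_def M_def m_def)
          have "M ^ n \<le> 1 + m ^ n"
          proof (cases "norm q \<le> norm p")
            case True
            have "norm (p ^ n) \<le> 1 + norm (q ^ n)"
              using eq by (metis add_diff_cancel_right' norm_one norm_triangle_ineq4)
            then show ?thesis using True by (simp add: M_def m_def norm_power)
          next
            case False
            have "norm (q ^ n) \<le> 1 + norm (p ^ n)"
              using eq by (metis add_diff_cancel_left' norm_one norm_triangle_ineq4)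
            then show ?thesis using False by (simp add: M_def m_def norm_power)
          qed
          moreover have "m ^ n \<le> \<sigma>0 ^ n * M ^ n"
            unfolding power_mult_distrib[symmetric] using Mm by (intro power_mono) auto
          moreover have "2 < \<rho> ^ n" using n(2) \<rho>(1) by (simp add: power_divide field_simps)
          moreover have "\<rho> ^ n \<le> M ^ n" using Mm(1) \<rho>(1) by (intro power_mono) auto
          moreover have "\<sigma>0 ^ n * M ^ n \<le> 1 / 2 * M ^ n" using n(1) Mm(1) \<rho>(1) by (intro mult_right_mono) auto
          ultimately show False by linarith
        qed
      qed
    qed
    ultimately show ?thesis by blast
  qed
qed

lemma zeros_accumulate:
  assumes b: "b \<noteq> 0" and N: "open N"
    and sub: "{z. larger_modulus b z = 1} \<union>
       {z. larger_modulus b z > 1 \<and> smaller_modulus b z = larger_modulus b z} \<subseteq> N"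
  shows "\<forall>\<^sub>F n in sequentially. \<forall>z p q. root_pair b z p q \<longrightarrow> p ^ n + q ^ n = 1 \<longrightarrow> z \<in> N"
proof -
  define K where "K = cball 0 (norm b * (4 + 1 / (norm b)\<^sup>2 + 1)) - N"
  have "compact K" unfolding K_def using N by (intro compact_diff) auto
  have le: "smaller_modulus b z \<le> larger_modulus b z" for z
  proof -
    obtain p q where "root_pair b z p q" using root_pair_exists[OF b] .
    from larger_smaller_modulus[OF b this] show ?thesis by simp
  qed
  define good where "good z U \<longleftrightarrow> open U \<and> z \<in> U \<and> (\<forall>\<^sub>F n in sequentially.
           \<forall>z\<in>U. \<forall>p q. root_pair b z p q \<longrightarrow> p ^ n + q ^ n \<noteq> 1)" for z U
  have "\<exists>U. good z U" if "z \<in> K" for z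
    unfolding good_def
  proof (rule locally_zero_free[OF b])
    have zN: "z \<notin> N" using that by (simp add: K_def)
    have "larger_modulus b z \<noteq> 1" using sub zN by blast
    moreover have "smaller_modulus b z \<noteq> larger_modulus b z" if "larger_modulus b z > 1"
      using sub zN that by blast
    ultimately show "larger_modulus b z < 1 \<or>
       larger_modulus b z > 1 \<and> smaller_modulus b z < larger_modulus b z"
      using le[of z] by linarith
  qed
  then have "\<forall>z\<in>K. \<exists>U. good z U" by blast
  from bchoice[OF this] obtain U where U0: "\<forall>z\<in>K. good z (U z)" by (elim exE)
  have U: "\<And>z. z \<in> K \<Longrightarrow> open (U z)" "\<And>z. z \<in> K \<Longrightarrow> z \<in> U z"
    "\<And>z. z \<in> K \<Longrightarrow> \<forall>\<^sub>F n in sequentially. \<forall>z\<in>U z. \<forall>p q. root_pair b z p q \<longrightarrow> p ^ n + q ^ n \<noteq> 1"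
    using U0 unfolding good_def by auto
  have cov: "K \<subseteq> (\<Union>z\<in>K. U z)" using U(2) by auto
  obtain C where C: "C \<subseteq> K" "finite C" "K \<subseteq> (\<Union>z\<in>C. U z)"
    using compactE_image[OF \<open>compact K\<close> U(1) cov] by metis
  have "\<forall>\<^sub>F n in sequentially. \<forall>z\<in>C. \<forall>z\<in>U z. \<forall>p q. root_pair b z p q \<longrightarrow> p ^ n + q ^ n \<noteq> 1"
    using C U(3) by (intro eventually_ball_finite) auto
  with eventually_ge_at_top[of 1] show ?thesis
  proof eventually_elim
    case (elim n)
    show ?case
    proof (intro allI impI, rule ccontr)
      fix z p q assume *: "root_pair b z p q" "p ^ n + q ^ n = 1" "z \<notin> N"
      have "larger_modulus b z < 4 + 1 / (norm b)\<^sup>2"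
        using far_zero_free[OF b *(1) elim(1)] *(2) by linarith
      then have "norm z \<le> norm b * (4 + 1 / (norm b)\<^sup>2 + 1)"
        by (intro order_trans[OF larger_modulus_le[OF b, of z]] mult_left_mono) auto
      then have "z \<in> K" using *(3) by (simp add: K_def)
      then obtain c where "c \<in> C" "z \<in> U c" using C(3) by auto
      then show False using elim(2) *(1,2) by metis
    qed
  qed
qed

lemma exists_far_point:
  assumes b: "b \<noteq> 0"
  obtains z where "larger_modulus b z \<ge> 4 + 1 / (norm b)\<^sup>2"
proof
  define M where "M = 4 + 1 / (norm b)\<^sup>2"
  have M0: "0 \<le> norm b * (M + 1)" by (simp add: M_def)
  have "norm (of_real (norm b * (M + 1)) :: complex) = norm b * (M + 1)"
    by (simp only: norm_of_real abs_of_nonneg[OF M0])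
  from larger_modulus_le[OF b, of "of_real (norm b * (M + 1))", unfolded this]
  have "norm b * (M + 1) \<le> norm b * (larger_modulus b (of_real (norm b * (M + 1))) + 1)" .
  then show "larger_modulus b (of_real (norm b * (M + 1))) \<ge> 4 + 1 / (norm b)\<^sup>2"
    using b by (simp add: M_def)
qed

section \<open>The arc\<close>

lemma sign_constant_on_connected:
  fixes f :: "'a::topological_space \<Rightarrow> real"
  assumes "connected S" "continuous_on S f" "\<And>x. x \<in> S \<Longrightarrow> f x \<noteq> 0" "a \<in> S" "f a > 0" "x \<in> S"
  shows "f x > 0"
proof (rule ccontr)
  assume "\<not> f x > 0"
  then have "f x \<le> 0" "0 \<le> f a" using assms(5) by auto
  moreover have "connected (f ` S)" using assms by (intro connected_continuous_image)
  ultimately have "0 \<in> f ` S" using assms(4,6) by (auto intro: connectedD_interval)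
  then show False using assms(3) by auto
qed

lemma Re_csqrt_pos:
  assumes "z \<notin> \<real>\<^sub>\<le>\<^sub>0"
  shows "0 < Re (csqrt z)"
proof (rule ccontr)
  assume "\<not> 0 < Re (csqrt z)"
  then have "Re (csqrt z) = 0" using Re_csqrt[of z] by linarith
  then have "csqrt z = \<i> * of_real (Im (csqrt z))" by (simp add: complex_eq_iff)
  then have "(csqrt z)\<^sup>2 = of_real (- ((Im (csqrt z))\<^sup>2))"
    by (subst \<open>csqrt z = \<i> * of_real (Im (csqrt z))\<close>) (simp add: power_mult_distrib del: power2_csqrt)
  then have "z = of_real (- ((Im (csqrt z))\<^sup>2))" by (simp only: power2_csqrt)
  moreover have "of_real (- ((Im (csqrt z))\<^sup>2)) \<in> (\<real>\<^sub>\<le>\<^sub>0 :: complex set)" by (subst complex_nonpos_Reals_iff) simp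
  ultimately show False using assms by simp
qed

text \<open>In terms of \<open>b\<close> the hypothesis \<open>R cos \<theta> > 3/2\<close> says \<open>Re b < -1/2\<close>, and
  \<open>\<theta> \<noteq> 0\<close> makes \<open>b\<close> and hence \<open>b\<^sup>2\<close> non-real.\<close>
locale airfoil =
  fixes b :: complex
  assumes Re_b: "Re b < - 1 / 2" and Im_b: "Im b \<noteq> 0"
begin

lemma b_nz: "b \<noteq> 0" using Re_b by auto

lemma b_sq_not_real: "b\<^sup>2 \<notin> \<real>" using square_notin_Reals[of b] Re_b Im_b by simp

lemma b_sq_ne_1: "b\<^sup>2 \<noteq> 1" using b_sq_not_real by auto

text \<open>Solving \<open>U(z) = t\<close>, that is \<open>(z - b)\<^sup>2 = t\<^sup>2 V(z)\<close>, for \<open>z\<close>: with \<open>z = b + t v\<close> and \<open>v\<^sup>2 = V(z)\<close> one gets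
  \<open>(v + b t)\<^sup>2 = 1 - b\<^sup>2(1 - t\<^sup>2)\<close>.  As \<open>b\<^sup>2\<close> is not real, the right-hand side avoids the negative axis for
  real \<open>t\<close>, so the principal root \<open>arc_w\<close> is holomorphic on a neighbourhood of \<open>[-1,1]\<close>.\<close>
definition arc_w :: "complex \<Rightarrow> complex" where "arc_w t = csqrt (1 - b\<^sup>2 * (1 - t\<^sup>2))"
definition arc_v :: "complex \<Rightarrow> complex" where "arc_v t = arc_w t - b * t"
definition arc_point :: "complex \<Rightarrow> complex" where "arc_point t = b + t * arc_v t"
abbreviation arc_at :: "real \<Rightarrow> complex" where "arc_at t \<equiv> arc_point (of_real t)"
abbreviation v_at :: "real \<Rightarrow> complex" where "v_at t \<equiv> arc_v (of_real t)"
definition arc_domain :: "complex set" where "arc_domain = {t. 1 - b\<^sup>2 * (1 - t\<^sup>2) \<notin> \<real>\<^sub>\<le>\<^sub>0}"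

lemma arc_v_quadratic: "(arc_v t)\<^sup>2 + 2 * b * t * arc_v t = 1 - b\<^sup>2"
proof -
  have "(arc_v t)\<^sup>2 + 2 * b * t * arc_v t = (arc_w t)\<^sup>2 - b\<^sup>2 * t\<^sup>2"
    by (simp add: arc_v_def power2_eq_square algebra_simps)
  also have "\<dots> = 1 - b\<^sup>2" by (simp add: arc_w_def algebra_simps)
  finally show ?thesis .
qed

lemma arc_v_nz: "arc_v t \<noteq> 0"
  using arc_v_quadratic[of t] b_sq_ne_1 by auto

lemma V_arc_point: "airfoil_V b (arc_point t) = (arc_v t)\<^sup>2"
  using arc_v_quadratic[of t]
  by (simp add: airfoil_V_def arc_point_def power2_eq_square algebra_simps)

text \<open>On the arc this is used with \<open>t = cos \<alpha>\<close> and \<open>X = e\<^sup>i\<^sup>\<alpha>\<close>.  A complex \<open>X\<close> covers a neighbourhood of the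
  arc.\<close>
lemma root_pair_arc_point:
  assumes "X \<noteq> 0" "t = (X + 1 / X) / 2"
  shows "root_pair b (arc_point t) (- (arc_v t / b) * X) (- (arc_v t / b) / X)"
proof -
  have X: "X + 1 / X = 2 * t" unfolding assms(2) by simp
  have "- (arc_v t / b) * X + - (arc_v t / b) / X = - (arc_v t / b) * (X + 1 / X)"
    by (simp add: distrib_left)
  also have "\<dots> = 2 - 2 * arc_point t / b"
    unfolding X using b_nz by (simp add: arc_point_def field_simps)
  finally have 1: "- (arc_v t / b) * X + - (arc_v t / b) / X = 2 - 2 * arc_point t / b" .
  have "(1 - - (arc_v t / b) * X) * (1 - - (arc_v t / b) / X)
      = 1 + arc_v t / b * (X + 1 / X) + (arc_v t)\<^sup>2 / b\<^sup>2"
    using assms(1) b_nz by (simp add: field_simps power2_eq_square)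
  also have "\<dots> = (b\<^sup>2 + ((arc_v t)\<^sup>2 + 2 * b * t * arc_v t)) / b\<^sup>2"
    unfolding X using b_nz by (simp add: field_simps power2_eq_square)
  also have "\<dots> = 1 / b\<^sup>2" unfolding arc_v_quadratic by simp
  finally show ?thesis using 1 by (simp add: root_pair_def)
qed

text \<open>The point determines \<open>v\<close> up to sign, hence \<open>t\<close> up to sign; both signs at once would force
  \<open>arc_w t = 0\<close>.\<close>
lemma inj_on_arc_point: "inj_on arc_point arc_domain"
proof (rule inj_onI)
  fix t u assume t: "t \<in> arc_domain" and eq: "arc_point t = arc_point u"
  have "(arc_v t)\<^sup>2 = (arc_v u)\<^sup>2" unfolding V_arc_point[symmetric] eq ..
  then consider "arc_v u = arc_v t" | "arc_v u = - arc_v t" by (auto simp: power2_eq_iff)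
  then show "t = u"
  proof cases
    case 1
    then have "t * arc_v t = u * arc_v t" using eq unfolding arc_point_def by (simp only: add_left_cancel)
    then show ?thesis using arc_v_nz[of t] by (metis mult_right_cancel)
  next
    case 2
    then have "t * arc_v t = (- u) * arc_v t" using eq by (simp add: arc_point_def)
    then have "t = - u" using arc_v_nz[of t] by (metis mult_right_cancel)
    then have u: "u = - t" by simp
    then have "arc_w u = arc_w t" by (simp add: arc_w_def)
    then have "arc_w t = 0" using 2 u by (simp add: arc_v_def)
    then have "1 - b\<^sup>2 * (1 - t\<^sup>2) = 0" by (simp only: arc_w_def csqrt_eq_0)
    with t show ?thesis unfolding arc_domain_def by simp
  qed
qed

lemma open_arc_domain: "open arc_domain"
proof -
  have "arc_domain = (\<lambda>t. 1 - b\<^sup>2 * (1 - t\<^sup>2)) -` (- \<real>\<^sub>\<le>\<^sub>0)"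
    by (auto simp: arc_domain_def)
  then show ?thesis by (auto intro!: open_vimage continuous_intros simp: open_Compl)
qed

lemma real_in_arc_domain: "of_real t \<in> arc_domain"
proof -
  have "1 - b\<^sup>2 * (1 - (of_real t)\<^sup>2) \<notin> \<real>\<^sub>\<le>\<^sub>0"
  proof
    assume a: "1 - b\<^sup>2 * (1 - (of_real t)\<^sup>2) \<in> \<real>\<^sub>\<le>\<^sub>0"
    have c: "1 - (of_real t)\<^sup>2 = (of_real (1 - t\<^sup>2) :: complex)" by simp
    from a have "1 - b\<^sup>2 * of_real (1 - t\<^sup>2) \<in> \<real>" unfolding c by (rule nonpos_Reals_subset_Reals[THEN subsetD])
    then have r: "b\<^sup>2 * of_real (1 - t\<^sup>2) \<in> \<real>"
      using Reals_diff[OF Reals_1, of "1 - b\<^sup>2 * of_real (1 - t\<^sup>2)"] by simp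
    show False
    proof (cases "1 - t\<^sup>2 = 0")
      case True
      with a show False unfolding c by simp
    next
      case False
      have "b\<^sup>2 * of_real (1 - t\<^sup>2) / of_real (1 - t\<^sup>2) \<in> \<real>" using r by (intro Reals_divide) auto
      then have "b\<^sup>2 \<in> \<real>" using False by (simp del: of_real_diff)
      then show False using b_sq_not_real by simp
    qed
  qed
  then show ?thesis by (simp add: arc_domain_def)
qed

lemma holomorphic_arc:
  "arc_w holomorphic_on arc_domain" "arc_v holomorphic_on arc_domain" "arc_point holomorphic_on arc_domain"
proof -
  show w: "arc_w holomorphic_on arc_domain"
    unfolding arc_w_def by (intro holomorphic_intros) (auto simp: arc_domain_def)
  show v: "arc_v holomorphic_on arc_domain" unfolding arc_v_def by (intro holomorphic_intros w)
  show "arc_point holomorphic_on arc_domain" unfolding arc_point_def by (intro holomorphic_intros v)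
qed

lemma continuous_on_arc:
  "continuous_on S (\<lambda>t::real. v_at t)" "continuous_on S (\<lambda>t::real. arc_at t)"
  by (auto intro!: continuous_on_compose2[OF holomorphic_on_imp_continuous_on[OF holomorphic_arc(2)]]
      continuous_on_compose2[OF holomorphic_on_imp_continuous_on[OF holomorphic_arc(3)]]
      continuous_intros simp: real_in_arc_domain)

lemma arc_ends: "arc_v 1 = 1 - b" "arc_v (- 1) = 1 + b" "arc_point 1 = 1" "arc_point (- 1) = - 1"
  by (simp_all add: arc_point_def arc_v_def arc_w_def)

lemma airfoil_arc_eq: "airfoil_arc b = (\<lambda>t::real. arc_at t) ` {-1..1}"
proof (intro equalityI subsetI)
  fix z assume "z \<in> airfoil_arc b"
  then obtain v t where v: "v\<^sup>2 = airfoil_V b z" "v \<noteq> 0" "(z - b) / v = of_real t" "t \<in> {-1..1::real}"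
    by (auto simp: airfoil_arc_def)
  have z: "z = b + of_real t * v" using v(2,3) by (simp add: field_simps)
  have "(v + b * of_real t)\<^sup>2 = (arc_w (of_real t))\<^sup>2"
  proof -
    have "(v + b * of_real t)\<^sup>2 = v\<^sup>2 + 2 * b * (z - b) + b\<^sup>2 * (of_real t)\<^sup>2"
      by (simp add: z power2_eq_square algebra_simps)
    also have "\<dots> = 1 - b\<^sup>2 * (1 - (of_real t)\<^sup>2)"
      unfolding v(1) by (simp add: airfoil_V_def power2_eq_square algebra_simps)
    also have "\<dots> = (arc_w (of_real t))\<^sup>2" by (simp add: arc_w_def)
    finally show ?thesis .
  qed
  then consider "v + b * of_real t = arc_w (of_real t)" | "v + b * of_real t = - arc_w (of_real t)"
    by (auto simp: power2_eq_iff)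
  then show "z \<in> (\<lambda>t::real. arc_at t) ` {-1..1}"
  proof cases
    case 1
    then have "v = v_at t" by (simp add: arc_v_def algebra_simps)
    then have "z = arc_at t" by (simp add: z arc_point_def)
    then show ?thesis using v(4) by blast
  next
    case 2
    moreover have "arc_w (of_real (- t)) = arc_w (of_real t)" by (simp add: arc_w_def)
    moreover have "v = - arc_w (of_real t) - b * of_real t" using 2 by (simp only: eq_diff_eq)
    ultimately have "v = - v_at (- t)" unfolding arc_v_def by simp
    then have "z = arc_at (- t)" by (simp add: z arc_point_def)
    moreover have "- t \<in> {-1..1}" using v(4) by simp
    ultimately show ?thesis by blast
  qed
next
  fix z assume "z \<in> (\<lambda>t::real. arc_at t) ` {-1..1}"
  then obtain t :: real where t: "t \<in> {-1..1}" "z = arc_at t" by blast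
  then have "(z - b) / v_at t = of_real t" using arc_v_nz by (simp add: arc_point_def)
  then have "(z - b) / v_at t \<in> of_real ` {-1..1}" using t(1) by (simp only:) (rule imageI)
  then show "z \<in> airfoil_arc b"
    unfolding airfoil_arc_def using V_arc_point arc_v_nz t(2)
    by (intro CollectI exI[of _ "v_at t"]) simp
qed

lemma inj_on_arc_real: "inj_on (\<lambda>t::real. arc_at t) S"
proof (rule inj_onI)
  fix t u :: real assume "arc_at t = arc_at u"
  from inj_onD[OF inj_on_arc_point this real_in_arc_domain real_in_arc_domain] show "t = u" by simp
qed

lemma compact_airfoil_arc: "compact (airfoil_arc b)"
  unfolding airfoil_arc_eq by (intro compact_continuous_image continuous_on_arc) simp

lemma connected_Compl_airfoil_arc: "connected (- airfoil_arc b)"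
proof -
  define g where "g = (\<lambda>x::real. arc_at (2 * x - 1))"
  have "path g" unfolding path_def g_def
    by (rule continuous_on_compose2[OF continuous_on_arc(2)[of UNIV]]) (auto intro!: continuous_intros)
  moreover have "inj_on g {0..1}"
  proof (rule inj_onI)
    fix x y assume "g x = g y"
    then have "2 * x - 1 = 2 * y - 1" unfolding g_def by (intro inj_onD[OF inj_on_arc_real[of UNIV]]) auto
    then show "x = y" by simp
  qed
  ultimately have "arc g" by (simp add: arc_def)
  have "path_image g = airfoil_arc b"
  proof -
    have *: "(\<lambda>x::real. 2 * x - 1) ` {0..1} = {-1..1}"
    proof (intro equalityI subsetI)
      fix x :: real assume "x \<in> {-1..1}"
      then have "x = 2 * ((x + 1) / 2) - 1" "(x + 1) / 2 \<in> {0..1}" by (auto simp: field_simps)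
      then show "x \<in> (\<lambda>x::real. 2 * x - 1) ` {0..1}" by (rule image_eqI)
    qed auto
    then show ?thesis unfolding path_image_def g_def airfoil_arc_eq
      by (simp only: image_image flip: *)
  qed
  then show ?thesis using connected_arc_complement[OF \<open>arc g\<close>] by simp
qed

section \<open>The point where the moduli are one\<close>

text \<open>The parameter of \<open>i\<^sub>b\<close>; the value comes from solving \<open>|v(t)| = |b|\<close>.\<close>
definition corner :: real where "corner = (Re (b\<^sup>2) - 1 / 2) / (norm b)\<^sup>2"

lemma corner_bounds: "- 1 < corner" "corner < 1"
proof -
  have n: "(norm b)\<^sup>2 = (Re b)\<^sup>2 + (Im b)\<^sup>2" by (rule cmod_power2)
  have "(norm b)\<^sup>2 > 0" using b_nz by simp
  moreover have "Re (b\<^sup>2) - 1 / 2 < (norm b)\<^sup>2"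
    using zero_le_power2[of "Im b"] unfolding n Re_power2 by linarith
  moreover have "(1 / 2) * (1 / 2) < (- Re b) * (- Re b)" using Re_b by (intro mult_strict_mono) auto
  then have "- ((norm b)\<^sup>2) < Re (b\<^sup>2) - 1 / 2" unfolding n by (simp add: power2_eq_square)
  ultimately show "- 1 < corner" "corner < 1" unfolding corner_def by (simp_all add: field_simps)
qed

lemma Re_square_eq: "2 * Re (b\<^sup>2) = 2 * corner * (norm b)\<^sup>2 + 1"
  using b_nz by (simp add: corner_def field_simps)

text \<open>The number \<open>- cnj b + b t\<close> is a square root of the right radicand for this \<open>t\<close>, and it is the
  principal one since its real part \<open>Re b (t - 1)\<close> is positive.\<close>
lemma arc_v_corner: "v_at corner = - cnj b"
proof -
  have e: "b\<^sup>2 + (cnj b)\<^sup>2 = of_real (2 * Re (b\<^sup>2))"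
    using complex_add_cnj[of "b\<^sup>2"] by simp
  have n: "b * cnj b = of_real ((norm b)\<^sup>2)" by (rule complex_norm_square[symmetric])
  have "arc_w (of_real corner) = - cnj b + b * of_real corner"
    unfolding arc_w_def
  proof (rule csqrt_unique)
    have "(- cnj b + b * of_real corner)\<^sup>2 = (cnj b)\<^sup>2 - 2 * of_real corner * (b * cnj b) + b\<^sup>2 * (of_real corner)\<^sup>2"
      by (simp add: power2_eq_square algebra_simps)
    also have "\<dots> = (cnj b)\<^sup>2 - of_real (2 * corner * (norm b)\<^sup>2) + b\<^sup>2 * (of_real corner)\<^sup>2"
      unfolding n by simp
    also have "2 * corner * (norm b)\<^sup>2 = 2 * Re (b\<^sup>2) - 1" using Re_square_eq by simp
    also have "(cnj b)\<^sup>2 - of_real (2 * Re (b\<^sup>2) - 1) + b\<^sup>2 * (of_real corner)\<^sup>2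
        = (cnj b)\<^sup>2 - (b\<^sup>2 + (cnj b)\<^sup>2) + 1 + b\<^sup>2 * (of_real corner)\<^sup>2"
      unfolding e of_real_diff by simp
    also have "\<dots> = 1 - b\<^sup>2 * (1 - (of_real corner)\<^sup>2)" by (simp add: algebra_simps)
    finally show "(- cnj b + b * of_real corner)\<^sup>2 = 1 - b\<^sup>2 * (1 - (of_real corner)\<^sup>2)" .
    have "Re b * (1 - corner) < 0" using Re_b corner_bounds by (intro mult_neg_pos) auto
    then show "0 < Re (- cnj b + b * of_real corner) \<or>
       Re (- cnj b + b * of_real corner) = 0 \<and> 0 \<le> Im (- cnj b + b * of_real corner)"
      by (simp add: algebra_simps)
  qed
  then show ?thesis by (simp add: arc_v_def)
qed

text \<open>Put \<open>v = b m\<close> with \<open>|m| = 1\<close>.  As \<open>1 = m cnj m\<close>, the quadratic equation for \<open>v\<close> reads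
  \<open>b\<^sup>2 m (2 Re m + 2 t) = 1\<close>.  So \<open>b\<^sup>2 m\<close> is real of modulus \<open>|b|\<^sup>2\<close>, which means that \<open>v\<close> is plus or minus
  \<open>cnj b\<close>, and \<open>Re arc_w > 0\<close> excludes the plus sign.\<close>
lemma norm_arc_v_eq_imp:
  assumes t: "t \<in> {-1..1}" and n: "norm (v_at t) = norm b"
  shows "t = corner"
proof -
  define m where "m = v_at t / b"
  have nm: "norm m = 1" using n b_nz by (simp add: m_def norm_divide)
  have v: "v_at t = b * m" using b_nz by (simp add: m_def)
  have mc: "m * cnj m = 1" using nm by (simp add: complex_norm_square[symmetric])
  have m0: "m \<noteq> 0" using nm by auto
  have *: "b\<^sup>2 * m\<^sup>2 + 2 * b\<^sup>2 * of_real t * m + b\<^sup>2 = 1"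
    using arc_v_quadratic[of "of_real t"] by (simp add: v power2_eq_square algebra_simps)
  have "b\<^sup>2 * m * (m + 2 * of_real t + cnj m) = 1"
  proof -
    have "b\<^sup>2 * m * (m + 2 * of_real t + cnj m) = b\<^sup>2 * m\<^sup>2 + 2 * b\<^sup>2 * of_real t * m + b\<^sup>2 * (m * cnj m)"
      by (simp add: power2_eq_square algebra_simps)
    also have "\<dots> = 1" unfolding mc using * by simp
    finally show ?thesis .
  qed
  have q: "b\<^sup>2 * m * of_real (2 * Re m + 2 * t) = 1"
  proof -
    have "of_real (2 * Re m + 2 * t) = m + 2 * of_real t + cnj m"
      using complex_add_cnj[of m] by (simp add: algebra_simps)
    then show ?thesis using \<open>b\<^sup>2 * m * (m + 2 * of_real t + cnj m) = 1\<close> by (simp only:)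
  qed
  define k where "k = 2 * Re m + 2 * t"
  have k0: "k \<noteq> 0" using q unfolding k_def[symmetric] by auto
  have bm: "b\<^sup>2 * m = of_real (1 / k)" using q k0 unfolding k_def[symmetric] by (simp add: field_simps)
  have "norm (b\<^sup>2 * m) = (norm b)\<^sup>2" using nm by (simp add: norm_mult norm_power)
  then have "\<bar>1 / k\<bar> = (norm b)\<^sup>2" unfolding bm by (simp only: norm_of_real)
  then consider "1 / k = (norm b)\<^sup>2" | "1 / k = - ((norm b)\<^sup>2)" by linarith
  then have v2: "v_at t = cnj b \<or> v_at t = - cnj b"
  proof cases
    case 1
    have "b * (b * m) = b * cnj b" using bm unfolding 1 complex_norm_square by (simp add: power2_eq_square algebra_simps)
    then show ?thesis using b_nz v by simp
  next
    case 2
    have "b * (b * m) = b * (- cnj b)" using bm unfolding 2 of_real_minus complex_norm_square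
      by (simp add: power2_eq_square algebra_simps)
    then have "b * m = - cnj b" using b_nz by (metis mult_left_cancel)
    then show ?thesis using v by simp
  qed
  have Rew: "Re (arc_w (of_real t)) > 0"
  proof -
    have "1 - b\<^sup>2 * (1 - (of_real t)\<^sup>2) \<notin> \<real>\<^sub>\<le>\<^sub>0" using real_in_arc_domain[of t] by (simp add: arc_domain_def)
    then show ?thesis unfolding arc_w_def by (rule Re_csqrt_pos)
  qed
  have w: "arc_w (of_real t) = v_at t + b * of_real t" by (simp add: arc_v_def)
  have "v_at t \<noteq> cnj b"
  proof
    assume "v_at t = cnj b"
    then have "0 < Re b * (1 + t)" using Rew w by (simp add: algebra_simps)
    moreover have "Re b * (1 + t) \<le> 0" using Re_b t by (intro mult_nonpos_nonneg) auto
    ultimately show False by simp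
  qed
  then have "v_at t = - cnj b" using v2 by simp
  then have "(v_at t)\<^sup>2 + 2 * b * of_real t * v_at t
      = (v_at corner)\<^sup>2 + 2 * b * of_real t * v_at corner" by (simp add: arc_v_corner)
  then have "2 * b * of_real t * v_at corner = 2 * b * of_real corner * v_at corner"
    using arc_v_quadratic[of "of_real t"] arc_v_quadratic[of "of_real corner"] by (metis add_left_cancel)
  then show ?thesis using b_nz arc_v_nz[of "of_real corner"] by auto
qed

text \<open>There is no crossing beyond \<open>corner\<close>, so the value at \<open>t = 1\<close> decides.\<close>
lemma norm_arc_v_gt:
  assumes "corner < t" "t \<le> 1"
  shows "norm b < norm (v_at t)"
proof -
  have "0 < norm (v_at t) - norm b"
  proof (rule sign_constant_on_connected[where S = "{corner<..1}" and a = 1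
        and f = "\<lambda>t. norm (v_at t) - norm b"])
    show "continuous_on {corner<..1} (\<lambda>t::real. norm (v_at t) - norm b)"
      by (intro continuous_intros continuous_on_arc)
    show "norm (v_at x) - norm b \<noteq> 0" if "x \<in> {corner<..1}" for x
      using norm_arc_v_eq_imp[of x] that corner_bounds by auto
    have "(norm b)\<^sup>2 < (norm (1 - b))\<^sup>2" unfolding cmod_power2 using Re_b by (simp add: power2_eq_square algebra_simps)
    then have "norm b < norm (1 - b)" by (rule power2_less_imp_less) simp
    then show "0 < norm (v_at 1) - norm b" by (simp add: arc_ends)
  qed (use assms corner_bounds in auto)
  then show ?thesis by simp
qed

lemma norm_arc_v_lt:
  assumes "t < corner" "- 1 \<le> t"
  shows "norm (v_at t) < norm b"
proof -
  have "0 < norm b - norm (v_at t)"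
  proof (rule sign_constant_on_connected[where S = "{-1..<corner}" and a = "-1"
        and f = "\<lambda>t. norm b - norm (v_at t)"])
    show "continuous_on {-1..<corner} (\<lambda>t::real. norm b - norm (v_at t))"
      by (intro continuous_intros continuous_on_arc)
    show "norm b - norm (v_at x) \<noteq> 0" if "x \<in> {-1..<corner}" for x
      using norm_arc_v_eq_imp[of x] that corner_bounds by auto
    have "(norm (1 + b))\<^sup>2 < (norm b)\<^sup>2" unfolding cmod_power2 using Re_b by (simp add: power2_eq_square algebra_simps)
    then have "norm (1 + b) < norm b" by (rule power2_less_imp_less) simp
    then show "0 < norm b - norm (v_at (- 1))" by (simp add: arc_ends)
  qed (use assms corner_bounds in auto)
  then show ?thesis by simp
qed

lemma dist_airfoil_c: "dist z (airfoil_c b) = norm (airfoil_V b z) / (2 * norm b)"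
proof -
  have "airfoil_V b z = - 2 * b * (z - airfoil_c b)"
    using b_nz by (simp add: airfoil_V_def airfoil_c_def power2_eq_square field_simps)
  then have "norm (airfoil_V b z) = 2 * norm b * norm (z - airfoil_c b)" by (simp add: norm_mult)
  then show ?thesis using b_nz by (simp add: dist_norm)
qed

lemma airfoil_i_eq: "airfoil_i b = arc_at corner"
  unfolding airfoil_i_def
proof (rule the_equality)
  have iff: "dist (arc_at t) (airfoil_c b) = norm b / 2 \<longleftrightarrow> norm (v_at t) = norm b" for t
  proof -
    have "dist (arc_at t) (airfoil_c b) = norm b / 2 \<longleftrightarrow> (norm (v_at t))\<^sup>2 = (norm b)\<^sup>2"
      unfolding dist_airfoil_c V_arc_point norm_power using b_nz by (simp add: field_simps power2_eq_square)
    then show ?thesis by simp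
  qed
  show "arc_at corner \<in> airfoil_arc b \<and>
      dist (arc_at corner) (airfoil_c b) = norm b / 2"
    unfolding iff arc_v_corner using corner_bounds by (auto simp: airfoil_arc_eq)
  show "z = arc_at corner" if z: "z \<in> airfoil_arc b \<and> dist z (airfoil_c b) = norm b / 2" for z
  proof -
    obtain u where u: "u \<in> {-1..1}" "z = arc_at u" using z unfolding airfoil_arc_eq by blast
    then have "norm (v_at u) = norm b" using z iff by simp
    from norm_arc_v_eq_imp[OF u(1) this] show ?thesis using u(2) by simp
  qed
qed

section \<open>The inverse of U\<close>

text \<open>Both sides are continuous square roots of \<open>V\<close> along the arc, and they agree at the end point \<open>1\<close>.\<close>
lemma sqrt_V_on_arc:
  assumes r: "is_sqrt_V b r" and t: "t \<in> {-1..1}"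
  shows "r (arc_at t) = v_at t"
proof -
  obtain \<gamma> :: "real \<Rightarrow> complex" where \<gamma>: "\<gamma> ` {0..} \<inter> airfoil_arc b = {}" "r holomorphic_on - \<gamma> ` {0..}"
    "\<And>z. z \<in> - \<gamma> ` {0..} \<Longrightarrow> (r z)\<^sup>2 = airfoil_V b z" and r1: "r 1 = 1 - b"
    using r unfolding is_sqrt_V_def by blast
  have sub: "airfoil_arc b \<subseteq> - \<gamma> ` {0..}" using \<gamma>(1) by blast
  define f where "f = (\<lambda>t::real. r (arc_at t) / v_at t)"
  have pm: "f x = 1 \<or> f x = - 1" if "x \<in> {-1..1}" for x
  proof -
    have "arc_at x \<in> - \<gamma> ` {0..}" using sub that airfoil_arc_eq by blast
    then have "(r (arc_at x))\<^sup>2 = (v_at x)\<^sup>2" using \<gamma>(3) V_arc_point by simp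
    then have "(f x)\<^sup>2 = 1" using arc_v_nz by (simp add: f_def power_divide)
    then show ?thesis by (simp add: power2_eq_1_iff)
  qed
  have "0 < Re (f t)"
  proof (rule sign_constant_on_connected[where S = "{-1..1}" and a = 1 and f = "\<lambda>t. Re (f t)"])
    have "continuous_on {-1..1} (\<lambda>x::real. r (arc_at x))"
      by (rule continuous_on_compose2[OF continuous_on_subset[OF holomorphic_on_imp_continuous_on[OF \<gamma>(2)] sub]
            continuous_on_arc(2)]) (auto simp: airfoil_arc_eq)
    then show "continuous_on {-1..1} (\<lambda>x. Re (f x))"
      unfolding f_def by (intro continuous_intros continuous_on_arc) (auto simp: arc_v_nz)
    show "Re (f x) \<noteq> 0" if "x \<in> {-1..1}" for x using pm[OF that] by auto
    show "0 < Re (f 1)" using arc_v_nz[of 1] r1 by (simp add: f_def arc_ends)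
  qed (use t in auto)
  then have "f t = 1" using pm[OF t] by auto
  then show ?thesis using arc_v_nz by (simp add: f_def)
qed

lemma airfoil_U_arc_point:
  assumes "is_sqrt_V b r" "t \<in> {-1..1}"
  shows "airfoil_U b r (arc_at t) = of_real t"
  using arc_v_nz by (simp add: airfoil_U_def sqrt_V_on_arc[OF assms]) (simp add: arc_point_def)

lemma airfoil_Uinv_eq:
  assumes r: "is_sqrt_V b r" and t: "t \<in> {-1..1}"
  shows "airfoil_Uinv b r t = arc_at t"
proof -
  have "inj_on (airfoil_U b r) (airfoil_arc b)"
    unfolding airfoil_arc_eq using airfoil_U_arc_point[OF r] by (auto intro!: inj_onI)
  moreover have "arc_at t \<in> airfoil_arc b" using t by (auto simp: airfoil_arc_eq)
  ultimately have "inv_into (airfoil_arc b) (airfoil_U b r) (airfoil_U b r (arc_at t)) = arc_at t"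
    by (rule inv_into_f_f)
  then show ?thesis unfolding airfoil_Uinv_def by (simp only: airfoil_U_arc_point[OF r t])
qed

text \<open>Outside \<open>[-1,1]\<close> the inverse takes one fixed default value; this is what makes it Borel
  measurable on the whole line.\<close>
lemma airfoil_Uinv_outside:
  assumes r: "is_sqrt_V b r" and t: "t \<notin> {-1..1}"
  shows "airfoil_Uinv b r t = (SOME y. False)"
proof -
  have "of_real t \<noteq> airfoil_U b r y" if y: "y \<in> airfoil_arc b" for y
  proof -
    obtain u where "u \<in> {-1..1}" "y = arc_at u" using y unfolding airfoil_arc_eq by blast
    then show ?thesis using airfoil_U_arc_point[OF r, of u] t by auto
  qed
  then have "(\<lambda>y. y \<in> airfoil_arc b \<and> airfoil_U b r y = of_real t) = (\<lambda>y. False)" by fastforce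
  then show ?thesis unfolding airfoil_Uinv_def inv_into_def by (simp only:)
qed

lemma airfoil_subarc_eq:
  assumes r: "is_sqrt_V b r"
  shows "airfoil_subarc b r = (\<lambda>t::real. arc_at t) ` {corner..1}"
proof -
  have c: "Re (airfoil_U b r (airfoil_i b)) = corner"
    unfolding airfoil_i_eq using airfoil_U_arc_point[OF r, of corner] corner_bounds by simp
  show ?thesis unfolding airfoil_subarc_def c
    by (rule image_cong[OF refl], rule airfoil_Uinv_eq[OF r]) (use corner_bounds in auto)
qed

section \<open>The two moduli on and off the arc\<close>

text \<open>With \<open>x\<^sup>2 = pq\<close> the quotients \<open>p/x\<close> and \<open>q/x\<close> are conjugate to each other on the unit circle, and
  \<open>b x\<close> is a square root of \<open>V\<close>; hence \<open>U(z)\<close> is minus the real part of \<open>p/x\<close>.\<close>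
lemma equal_moduli_imp_in_arc:
  assumes pq: "root_pair b z p q" and eq: "norm p = norm q"
  shows "z \<in> airfoil_arc b"
proof -
  have p0: "p \<noteq> 0"
  proof
    assume "p = 0"
    then have "q = 0" using eq by simp
    then have "1 = 1 / b\<^sup>2" using pq \<open>p = 0\<close> by (simp add: root_pair_def)
    then show False using b_sq_ne_1 b_nz by (simp add: field_simps)
  qed
  define x where "x = csqrt (p * q)"
  have x2: "x * x = p * q" by (simp add: x_def flip: power2_eq_square)
  have "norm x * norm x = norm p * norm p" using arg_cong[OF x2, of norm] eq by (simp add: norm_mult)
  then have nx: "norm x = norm p" by (simp flip: power2_eq_square)
  then have x0: "x \<noteq> 0" using p0 by auto
  define u where "u = p / x"
  have nu: "norm u = 1" using nx p0 by (simp add: u_def norm_divide)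
  have u0: "u \<noteq> 0" using nu by auto
  have "u * cnj u = 1" using nu by (simp add: complex_norm_square[symmetric])
  moreover have "u * (q / x) = 1"
  proof -
    have "u * (q / x) = (p * q) / (x * x)" by (simp add: u_def)
    also have "\<dots> = 1" unfolding x2[symmetric] using x0 by simp
    finally show ?thesis .
  qed
  ultimately have qx: "q / x = cnj u" using u0 by (metis mult_left_cancel)
  have z: "z - b = - b * ((p + q) / 2)"
  proof -
    have "p + q = 2 - 2 * z / b" using pq by (simp add: root_pair_def)
    then show ?thesis using b_nz by (simp add: field_simps)
  qed
  have "(z - b) / (b * x) = - ((p / x + q / x) / 2)"
    unfolding z using b_nz x0 by (simp add: field_simps)
  also have "\<dots> = - ((u + cnj u) / 2)" unfolding qx u_def ..
  also have "\<dots> = of_real (- Re u)" unfolding complex_add_cnj by simp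
  finally have e: "(z - b) / (b * x) = of_real (- Re u)" .
  have "- Re u \<in> {-1..1}" using abs_Re_le_cmod[of u] nu by auto
  then have "(z - b) / (b * x) \<in> of_real ` {-1..1}" unfolding e by (rule imageI)
  moreover have "(b * x)\<^sup>2 = airfoil_V b z"
  proof -
    have "(b * x)\<^sup>2 = b\<^sup>2 * (x * x)" by (simp add: power2_eq_square)
    also have "\<dots> = airfoil_V b z" unfolding x2 root_pair_prod[OF b_nz pq] using b_nz by simp
    finally show ?thesis .
  qed
  ultimately show ?thesis
    unfolding airfoil_arc_def using b_nz x0 by (intro CollectI exI[of _ "b * x"]) simp
qed

text \<open>For \<open>t = cos \<alpha>\<close> and \<open>\<sigma> = \<plusminus>1\<close> this is \<open>e\<^sup>\<plusminus>\<^sup>i\<^sup>\<alpha>\<close>.\<close>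
definition unit_root :: "real \<Rightarrow> real \<Rightarrow> complex" where
  "unit_root \<sigma> t = of_real t + of_real \<sigma> * \<i> * of_real (sqrt (1 - t\<^sup>2))"

lemma unit_root:
  assumes "t \<in> {-1..1}" "\<sigma>\<^sup>2 = 1"
  shows "norm (unit_root \<sigma> t) = 1" "of_real t = (unit_root \<sigma> t + 1 / unit_root \<sigma> t) / 2"
    "1 / unit_root \<sigma> t = unit_root (- \<sigma>) t"
proof -
  have "t\<^sup>2 \<le> 1" using assms(1) by (subst abs_square_le_1) auto
  then have s: "(sqrt (1 - t\<^sup>2))\<^sup>2 = 1 - t\<^sup>2" by simp
  have "(norm (unit_root \<sigma> t))\<^sup>2 = t\<^sup>2 + \<sigma>\<^sup>2 * (sqrt (1 - t\<^sup>2))\<^sup>2"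
    unfolding cmod_power2 unit_root_def by (simp add: power_mult_distrib)
  then have "(norm (unit_root \<sigma> t))\<^sup>2 = 1" unfolding s assms(2) by simp
  then show n: "norm (unit_root \<sigma> t) = 1" using norm_ge_zero[of "unit_root \<sigma> t"] by (simp add: power2_eq_1_iff)
  have "unit_root \<sigma> t * cnj (unit_root \<sigma> t) = 1" using n by (simp add: complex_norm_square[symmetric])
  moreover have "cnj (unit_root \<sigma> t) = unit_root (- \<sigma>) t" by (simp add: unit_root_def)
  moreover have "unit_root \<sigma> t \<noteq> 0" using n by auto
  ultimately show inv: "1 / unit_root \<sigma> t = unit_root (- \<sigma>) t" by (simp add: field_simps)
  show "of_real t = (unit_root \<sigma> t + 1 / unit_root \<sigma> t) / 2" unfolding inv by (simp add: unit_root_def)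
qed

lemma root_pair_on_arc:
  assumes "t \<in> {-1..1}"
  shows "root_pair b (arc_at t)
     (- (v_at t / b) * unit_root 1 t) (- (v_at t / b) * unit_root (- 1) t)"
proof -
  have "unit_root 1 t \<noteq> 0" using unit_root(1)[OF assms, of 1] by auto
  from root_pair_arc_point[OF this unit_root(2)[OF assms, of 1]]
  have "root_pair b (arc_at t) (- (v_at t / b) * unit_root 1 t)
     (- (v_at t / b) * (1 / unit_root 1 t))" by simp
  then show ?thesis unfolding unit_root(3)[OF assms, of 1, simplified] .
qed

lemma larger_modulus_on_arc:
  assumes "t \<in> {-1..1}"
  shows "larger_modulus b (arc_at t) = norm (v_at t) / norm b"
proof -
  have n: "norm (unit_root 1 t) = 1" "norm (unit_root (-1) t) = 1"
    using unit_root(1)[OF assms, of 1] unit_root(1)[OF assms, of "-1"] by auto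
  show ?thesis unfolding larger_smaller_modulus(1)[OF b_nz root_pair_on_arc[OF assms]] norm_mult n norm_minus_cancel
    by (simp add: norm_divide)
qed

definition phi_conj :: "(complex \<Rightarrow> complex) \<Rightarrow> complex \<Rightarrow> complex" where
  "phi_conj s z = (b - z + s z) / b"

lemma root_pair_phi:
  assumes s: "is_sqrt_arc b s" and z: "z \<notin> airfoil_arc b"
  shows "root_pair b z (airfoil_phi b s z) (phi_conj s z)"
proof -
  have s2: "(s z)\<^sup>2 = z\<^sup>2 - 1" using s z by (simp add: is_sqrt_arc_def)
  have 1: "airfoil_phi b s z + phi_conj s z = 2 - 2 * z / b"
    using b_nz by (simp add: airfoil_phi_def phi_conj_def field_simps)
  have "(1 - airfoil_phi b s z) * (1 - phi_conj s z) = (z\<^sup>2 - (s z)\<^sup>2) / b\<^sup>2"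
    using b_nz by (simp add: airfoil_phi_def phi_conj_def field_simps power2_eq_square)
  then show ?thesis using 1 unfolding s2 by (simp add: root_pair_def)
qed

lemma continuous_on_phi:
  assumes s: "is_sqrt_arc b s"
  shows "continuous_on (- airfoil_arc b) (airfoil_phi b s)" "continuous_on (- airfoil_arc b) (phi_conj s)"
proof -
  have "continuous_on (- airfoil_arc b) s"
    using s by (auto simp: is_sqrt_arc_def intro: holomorphic_on_imp_continuous_on)
  then show "continuous_on (- airfoil_arc b) (airfoil_phi b s)" "continuous_on (- airfoil_arc b) (phi_conj s)"
    unfolding airfoil_phi_def phi_conj_def using b_nz by (auto intro!: continuous_intros)
qed

text \<open>The difference of the moduli has no zero off the arc, whose complement is connected.  So its sign
  is the one near infinity, where \<open>s(z)\<close> is close to \<open>z\<close>.\<close>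
lemma norm_phi_conj_less:
  assumes s: "is_sqrt_arc b s" and z: "z \<notin> airfoil_arc b"
  shows "norm (phi_conj s z) < norm (airfoil_phi b s z)"
proof -
  have lim: "((\<lambda>z. s z / z) \<longlongrightarrow> 1) at_infinity" using s by (simp add: is_sqrt_arc_def)
  have lim0: "((\<lambda>z::complex. b / z) \<longlongrightarrow> 0) at_infinity"
    by (rule tendsto_divide_0[OF tendsto_const filterlim_ident])
  have "((\<lambda>z. norm (b / z - 1 - s z / z) - norm (b / z - 1 + s z / z)) \<longlongrightarrow>
      norm (0 - 1 - 1 :: complex) - norm (0 - 1 + 1 :: complex)) at_infinity"
    by (intro tendsto_intros lim lim0)
  then have "\<forall>\<^sub>F z in at_infinity. 0 < norm (b / z - 1 - s z / z) - norm (b / z - 1 + s z / z)"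
    by (rule order_tendstoD(1)) simp
  moreover have "\<forall>\<^sub>F z in at_infinity. z \<notin> airfoil_arc b"
  proof -
    obtain B where "\<And>z. z \<in> airfoil_arc b \<Longrightarrow> norm z \<le> B"
      using compact_imp_bounded[OF compact_airfoil_arc] unfolding bounded_iff by blast
    then have "z \<notin> airfoil_arc b" if "B + 1 \<le> norm z" for z using that by force
    then show ?thesis unfolding eventually_at_infinity by blast
  qed
  moreover have "\<forall>\<^sub>F z::complex in at_infinity. z \<noteq> 0" by (rule eventually_not_equal_at_infinity)
  ultimately have "\<forall>\<^sub>F a in at_infinity. a \<notin> airfoil_arc b \<and> norm (phi_conj s a) < norm (airfoil_phi b s a)"
  proof eventually_elim
    case (elim a)
    have "b - a - s a = a * (b / a - 1 - s a / a)" "b - a + s a = a * (b / a - 1 + s a / a)"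
      using elim(3) by (simp_all add: algebra_simps)
    then have "norm (b - a + s a) < norm (b - a - s a)" using elim(1,3) by (simp add: norm_mult)
    then show ?case
      using elim(2) b_nz by (simp add: phi_conj_def airfoil_phi_def norm_divide divide_strict_right_mono)
  qed
  then obtain a where aA: "a \<notin> airfoil_arc b" and far: "norm (phi_conj s a) < norm (airfoil_phi b s a)"
    using eventually_happens[of _ "at_infinity :: complex filter"] trivial_limit_at_infinity by blast
  have "0 < norm (airfoil_phi b s z) - norm (phi_conj s z)"
  proof (rule sign_constant_on_connected[where S = "- airfoil_arc b" and a = a
        and f = "\<lambda>z. norm (airfoil_phi b s z) - norm (phi_conj s z)"])
    show "continuous_on (- airfoil_arc b) (\<lambda>z. norm (airfoil_phi b s z) - norm (phi_conj s z))"
      by (intro continuous_intros continuous_on_phi[OF s])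
    show "norm (airfoil_phi b s x) - norm (phi_conj s x) \<noteq> 0" if "x \<in> - airfoil_arc b" for x
      using equal_moduli_imp_in_arc[OF root_pair_phi[OF s, of x]] that by auto
  qed (use connected_Compl_airfoil_arc aA far z in auto)
  then show ?thesis by simp
qed

lemma larger_modulus_off_arc:
  assumes s: "is_sqrt_arc b s" and z: "z \<notin> airfoil_arc b"
  shows "larger_modulus b z = norm (airfoil_phi b s z)" "smaller_modulus b z < larger_modulus b z"
  using larger_smaller_modulus[OF b_nz root_pair_phi[OF s z]] norm_phi_conj_less[OF s z] by auto

lemma phi_eqI:
  assumes s: "is_sqrt_arc b s" and pq: "root_pair b z p q" and less: "norm q < norm p"
  shows "z \<notin> airfoil_arc b" "airfoil_phi b s z = p" "phi_conj s z = q"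
proof -
  show z: "z \<notin> airfoil_arc b"
  proof
    assume "z \<in> airfoil_arc b"
    then obtain t where t: "t \<in> {-1..1}" "z = arc_at t" unfolding airfoil_arc_eq by blast
    have n: "norm (unit_root 1 t) = 1" "norm (unit_root (-1) t) = 1"
      using unit_root(1)[OF t(1), of 1] unit_root(1)[OF t(1), of "-1"] by auto
    show False using root_pair_unique[OF pq root_pair_on_arc[OF t(1), folded t(2)]] less n
      by (auto simp: norm_mult norm_divide)
  qed
  have "airfoil_phi b s z = p \<and> phi_conj s z = q"
    using root_pair_unique[OF pq root_pair_phi[OF s z]] norm_phi_conj_less[OF s z] less by auto
  then show "airfoil_phi b s z = p" "phi_conj s z = q" by auto
qed

lemma critical_set_subset:
  assumes r: "is_sqrt_V b r" and s: "is_sqrt_arc b s"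
  shows "{z. larger_modulus b z = 1} \<union> {z. larger_modulus b z > 1 \<and> smaller_modulus b z = larger_modulus b z}
    \<subseteq> airfoil_subarc b r \<union> airfoil_loop b r s"
proof
  fix z assume z: "z \<in> {z. larger_modulus b z = 1} \<union> {z. larger_modulus b z > 1 \<and> smaller_modulus b z = larger_modulus b z}"
  show "z \<in> airfoil_subarc b r \<union> airfoil_loop b r s"
  proof (cases "z \<in> airfoil_arc b")
    case True
    then obtain t where t: "t \<in> {-1..1}" "z = arc_at t" unfolding airfoil_arc_eq by blast
    have "1 \<le> norm (v_at t) / norm b"
      using z larger_modulus_on_arc[OF t(1)] unfolding t(2) by auto
    then have "norm b \<le> norm (v_at t)" using b_nz by (simp add: field_simps)
    then have "corner \<le> t" using norm_arc_v_lt[of t] t(1) by force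
    then show ?thesis unfolding airfoil_subarc_eq[OF r] using t by auto
  next
    case False
    then show ?thesis using z larger_modulus_off_arc[OF s False] by (auto simp: airfoil_loop_def)
  qed
qed

section \<open>The one-sided limits at the arc\<close>

lemma deriv_Uinv:
  assumes r: "is_sqrt_V b r" and t: "t \<in> {-1..1}"
  shows "vector_derivative (airfoil_Uinv b r) (at t within {-1..1}) = deriv arc_point (of_real t)"
proof (rule vector_derivative_within_closed_interval)
  have "(arc_point has_field_derivative deriv arc_point (of_real t)) (at (of_real t))"
    using holomorphic_derivI[OF holomorphic_arc(3) open_arc_domain real_in_arc_domain] .
  moreover have "((\<lambda>t::real. of_real t :: complex) has_vector_derivative 1) (at t)"
    by (auto intro!: derivative_eq_intros)
  ultimately have "(arc_point \<circ> (\<lambda>t::real. of_real t) has_vector_derivative 1 * deriv arc_point (of_real t)) (at t)"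
    by (intro field_vector_diff_chain_at)
  then have "((\<lambda>t::real. arc_at t) has_vector_derivative deriv arc_point (of_real t)) (at t within {-1..1})"
    by (simp add: o_def has_vector_derivative_at_within)
  then show "(airfoil_Uinv b r has_vector_derivative deriv arc_point (of_real t)) (at t within {-1..1})"
    using airfoil_Uinv_eq[OF r] t by (auto intro: has_vector_derivative_transform)
qed (use t in auto)

text \<open>The function \<open>U\<close> as a holomorphic function on a neighbourhood of the arc, whatever the
  cut of the square root of \<open>V\<close>.\<close>
definition arc_coordinate :: "complex \<Rightarrow> complex" where
  "arc_coordinate = inv_into arc_domain arc_point"

lemma arc_coordinate:
  "arc_coordinate holomorphic_on arc_point ` arc_domain" "open (arc_point ` arc_domain)"
  "t \<in> arc_domain \<Longrightarrow> arc_coordinate (arc_point t) = t"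
  "t \<in> arc_domain \<Longrightarrow> deriv arc_point t * deriv arc_coordinate (arc_point t) = 1"
proof -
  obtain g where g: "g holomorphic_on arc_point ` arc_domain"
    "\<And>t. t \<in> arc_domain \<Longrightarrow> deriv arc_point t * deriv g (arc_point t) = 1"
    "\<And>t. t \<in> arc_domain \<Longrightarrow> g (arc_point t) = t"
    using holomorphic_has_inverse[OF holomorphic_arc(3) open_arc_domain inj_on_arc_point] by metis
  show op: "open (arc_point ` arc_domain)"
    by (rule open_mapping_thm3[OF holomorphic_arc(3) open_arc_domain inj_on_arc_point])
  show inv: "arc_coordinate (arc_point t) = t" if "t \<in> arc_domain" for t
    unfolding arc_coordinate_def by (rule inv_into_f_f[OF inj_on_arc_point that])
  have eq: "g z = arc_coordinate z" if "z \<in> arc_point ` arc_domain" for z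
    using that g(3) inv by auto
  show hol: "arc_coordinate holomorphic_on arc_point ` arc_domain"
    by (rule holomorphic_transform[OF g(1) eq])
  show "deriv arc_point t * deriv arc_coordinate (arc_point t) = 1" if "t \<in> arc_domain"
    using complex_derivative_transform_within_open[OF g(1) hol op imageI[OF that] eq] g(2)[OF that] by simp
qed

abbreviation collar_point :: "real \<Rightarrow> real \<Rightarrow> real \<Rightarrow> complex" where
  "collar_point \<sigma> t e \<equiv> arc_at t + of_real e * (of_real \<sigma> * \<i>) * deriv arc_point (of_real t)"

text \<open>Since \<open>U' g' = 1\<close> along the arc, a step from \<open>g(t)\<close> in the direction \<open>\<sigma> \<i> g'(t)\<close> moves \<open>U\<close> in the
  direction \<open>\<sigma> \<i>\<close>.  By continuity \<open>Re (U'(z) g'(t)) > 0\<close> near \<open>(g(t\<^sub>0), t\<^sub>0)\<close>, so \<open>\<sigma> Im U\<close>, which is zero on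
  the arc, increases along these segments.  The numbers in the proof ensure that a point of the collar
  close to \<open>g(t\<^sub>0)\<close> belongs to a segment that starts close to \<open>g(t\<^sub>0)\<close>.\<close>
lemma collar_one_sided:
  assumes t0: "t0 \<in> {-1..1}" and \<sigma>: "\<sigma>\<^sup>2 = 1"
  obtains \<delta> where "\<delta> > 0"
    "\<And>t e. t \<in> {-1..1} \<Longrightarrow> 0 < e \<Longrightarrow> e < \<delta> \<Longrightarrow> dist (collar_point \<sigma> t e) (arc_at t0) < \<delta> \<Longrightarrow>
       collar_point \<sigma> t e \<in> arc_point ` arc_domain \<and> 0 < \<sigma> * Im (arc_coordinate (collar_point \<sigma> t e))"
proof -
  define U where "U = arc_coordinate"
  note U = arc_coordinate[folded U_def]
  define \<Omega> where "\<Omega> = arc_point ` arc_domain"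
  define G where "G = (\<lambda>t::real. arc_at t)"
  define G' where "G' = (\<lambda>t::real. deriv arc_point (of_real t))"
  define x where "x = G t0"
  have dom: "G t \<in> \<Omega>" for t using real_in_arc_domain by (auto simp: G_def \<Omega>_def)
  have UG: "U (G t) = of_real t" for t using U(3) real_in_arc_domain by (simp add: G_def)
  have \<sigma>1: "\<bar>\<sigma>\<bar> = 1" using \<sigma> by (auto simp: power2_eq_1_iff)
  have contG': "continuous_on {-1..1} G'"
    unfolding G'_def
    by (rule continuous_on_compose2[OF holomorphic_on_imp_continuous_on[OF holomorphic_deriv[OF holomorphic_arc(3) open_arc_domain]]])
      (auto intro!: continuous_intros simp: real_in_arc_domain)
  obtain B where B: "B > 0" "\<And>t. t \<in> {-1..1} \<Longrightarrow> norm (G' t) \<le> B"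
    using compact_imp_bounded[OF compact_continuous_image[OF contG' compact_Icc]]
    unfolding bounded_pos by auto
  have contU: "continuous_on \<Omega> U" "continuous_on \<Omega> (deriv U)"
    using U(1,2) holomorphic_deriv[OF U(1,2)] by (auto simp: \<Omega>_def intro: holomorphic_on_imp_continuous_on)
  have cont2: "continuous_on ({-1..1} \<times> \<Omega>) (\<lambda>(t, z). Re (deriv U z * G' t))"
    unfolding case_prod_unfold
    by (intro continuous_intros continuous_on_compose2[OF contU(2)] continuous_on_compose2[OF contG']) auto
  have val: "Re (deriv U x * G' t0) = 1"
    using U(4)[OF real_in_arc_domain[of t0]] by (simp add: x_def G_def G'_def mult.commute)
  obtain \<eta>0 where \<eta>0: "\<eta>0 > 0" "\<And>t z. t \<in> {-1..1} \<Longrightarrow> z \<in> \<Omega> \<Longrightarrow> dist (t, z) (t0, x) < \<eta>0 \<Longrightarrow> 0 < Re (deriv U z * G' t)"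
  proof -
    have "(t0, x) \<in> {-1..1} \<times> \<Omega>" using t0 dom by (simp add: x_def)
    then obtain d where d: "d > 0" "\<forall>y\<in>{-1..1} \<times> \<Omega>. dist y (t0, x) < d \<longrightarrow>
        dist (case y of (t, z) \<Rightarrow> Re (deriv U z * G' t)) (case (t0, x) of (t, z) \<Rightarrow> Re (deriv U z * G' t)) < 1"
      using cont2 unfolding continuous_on_iff by (metis zero_less_one)
    show ?thesis
    proof (rule that[OF d(1)])
      fix t z assume "t \<in> {-1..1}" "z \<in> \<Omega>" "dist (t, z) (t0, x) < d"
      then have "dist (Re (deriv U z * G' t)) 1 < 1" using d(2) val by fastforce
      then show "0 < Re (deriv U z * G' t)" by (simp add: dist_real_def abs_if split: if_splits)
    qed
  qed
  obtain \<eta>1 where \<eta>1: "\<eta>1 > 0" "ball x \<eta>1 \<subseteq> \<Omega>"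
    using U(2) dom[of t0] unfolding \<Omega>_def[symmetric] x_def open_contains_ball by blast
  define \<eta> where "\<eta> = min (\<eta>0 / 2) \<eta>1"
  have \<eta>: "\<eta> > 0" "\<eta> \<le> \<eta>0 / 2" "\<eta> \<le> \<eta>1" using \<eta>0 \<eta>1 by (auto simp: \<eta>_def)
  have "continuous_on {-1..1} G" unfolding G_def by (rule continuous_on_arc)
  then obtain \<kappa> where \<kappa>: "\<kappa> > 0" "\<And>t. t \<in> {-1..1} \<Longrightarrow> dist t t0 < \<kappa> \<Longrightarrow> dist (G t) x < \<eta> / 2"
    using t0 \<eta>(1) unfolding continuous_on_iff x_def by (metis half_gt_zero)
  define \<kappa>' where "\<kappa>' = min \<kappa> \<eta>"
  have \<kappa>': "\<kappa>' > 0" "\<kappa>' \<le> \<kappa>" "\<kappa>' \<le> \<eta>" using \<kappa> \<eta> by (auto simp: \<kappa>'_def)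
  obtain m where m: "m > 0" "\<And>z. z \<in> \<Omega> \<Longrightarrow> dist z x < m \<Longrightarrow> dist (U z) (U x) < \<kappa>'"
    using contU(1) dom[of t0] \<kappa>'(1) unfolding continuous_on_iff x_def by metis
  define \<delta> where "\<delta> = min (m / 2) (min (\<eta> / 2) (min m \<eta> / (2 * B)))"
  have \<delta>: "\<delta> > 0" "\<delta> \<le> m / 2" "\<delta> \<le> \<eta> / 2" "\<delta> \<le> min m \<eta> / (2 * B)" using m(1) \<eta>(1) B(1) by (auto simp: \<delta>_def)
  have \<delta>B: "\<delta> * B \<le> m / 2" "\<delta> * B \<le> \<eta> / 2"
  proof -
    have "\<delta> * B \<le> min m \<eta> / (2 * B) * B" using \<delta>(4) B(1) by (intro mult_right_mono) auto
    also have "\<dots> = min m \<eta> / 2" using B(1) by simp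
    finally show "\<delta> * B \<le> m / 2" "\<delta> * B \<le> \<eta> / 2" by auto
  qed
  show ?thesis
  proof (rule that[OF \<delta>(1)])
    fix t e :: real
    assume t: "t \<in> {-1..1}" and e: "0 < e" "e < \<delta>"
      and d: "dist (collar_point \<sigma> t e) (arc_at t0) < \<delta>"
    define D where "D = of_real \<sigma> * \<i> * G' t"
    have nD: "norm D \<le> B" using B(2)[OF t] \<sigma>1 by (simp add: D_def norm_mult)
    have step: "norm (of_real y * D) \<le> \<delta> * B" if "0 \<le> y" "y \<le> e" for y
      using that e nD \<delta>(1) by (auto simp: norm_mult intro!: mult_mono)
    have d': "dist (G t + of_real e * D) x < \<delta>" using d by (simp add: G_def D_def G'_def x_def mult.assoc)
    have "dist (G t) x \<le> dist (G t + of_real e * D) x + norm (of_real e * D)"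
      by (metis dist_commute dist_norm add_diff_cancel_left' dist_triangle3 add.commute)
    also have "\<dots> < m" using d' step[of e] e \<delta>(2) \<delta>B(1) by simp
    finally have "dist (U (G t)) (U x) < \<kappa>'" using m(2)[OF dom] by simp
    then have tt: "dist t t0 < \<kappa>'" unfolding x_def UG dist_of_real .
    have Gx: "dist (G t) x < \<eta> / 2" using \<kappa>(2)[OF t] tt \<kappa>'(2) by simp
    have near: "dist (G t + of_real y * D) x < \<eta>" if "0 \<le> y" "y \<le> e" for y
    proof -
      have "dist (G t + of_real y * D) x \<le> dist (G t) x + norm (of_real y * D)"
        unfolding dist_norm using norm_triangle_ineq[of "G t - x" "of_real y * D"] by (simp add: algebra_simps)
      then show ?thesis using Gx step[OF that] \<delta>B(2) by simp
    qed
    have in\<Omega>: "G t + of_real y * D \<in> \<Omega>" if "0 \<le> y" "y \<le> e" for y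
      using near[OF that] \<eta>(3) \<eta>1(2) by (auto simp: dist_commute subset_iff)
    have pos: "0 < Re (deriv U (G t + of_real y * D) * G' t)" if "0 \<le> y" "y \<le> e" for y
    proof (rule \<eta>0(2)[OF t in\<Omega>[OF that]])
      have "dist (t, G t + of_real y * D) (t0, x) \<le> dist t t0 + dist (G t + of_real y * D) x"
        by (simp add: dist_Pair_Pair sqrt_sum_squares_le_sum)
      then show "dist (t, G t + of_real y * D) (t0, x) < \<eta>0" using near[OF that] tt \<kappa>'(3) \<eta>(2) by simp
    qed
    define \<psi> where "\<psi> = (\<lambda>y. \<sigma> * Im (U (G t + of_real y * D)))"
    have "\<psi> 0 < \<psi> e"
    proof (rule DERIV_pos_imp_increasing[OF e(1)])
      fix y assume y: "0 \<le> y" "y \<le> e"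
      have dU: "(U has_field_derivative deriv U (G t + of_real y * D)) (at (G t + of_real y * D))"
        using holomorphic_derivI[OF U(1,2)] in\<Omega>[OF y] by (simp add: \<Omega>_def)
      have "((\<lambda>y. G t + of_real y * D) has_vector_derivative D) (at y)"
        by (auto intro!: derivative_eq_intros has_vector_derivative_of_real)
      from field_vector_diff_chain_at[OF this dU]
      have "((\<lambda>y. U (G t + of_real y * D)) has_vector_derivative D * deriv U (G t + of_real y * D)) (at y)"
        by (simp add: o_def)
      from bounded_linear.has_vector_derivative[OF bounded_linear_Im this]
      have "((\<lambda>y. Im (U (G t + of_real y * D))) has_real_derivative Im (D * deriv U (G t + of_real y * D))) (at y)"
        by (simp add: has_real_derivative_iff_has_vector_derivative)
      from DERIV_cmult[OF this, of \<sigma>]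
      have "(\<psi> has_real_derivative \<sigma> * Im (D * deriv U (G t + of_real y * D))) (at y)" unfolding \<psi>_def .
      moreover have "\<sigma> * Im (D * deriv U (G t + of_real y * D)) = \<sigma>\<^sup>2 * Re (deriv U (G t + of_real y * D) * G' t)"
        by (simp add: D_def power2_eq_square algebra_simps)
      ultimately show "\<exists>l. (\<psi> has_real_derivative l) (at y) \<and> 0 < l" using pos[OF y] \<sigma> by auto
    qed
    moreover have "\<psi> 0 = 0" by (simp add: \<psi>_def UG)
    ultimately have "0 < \<psi> e" by simp
    then have "0 < \<sigma> * Im (U (G t + of_real e * D))" by (simp only: \<psi>_def)
    then show "collar_point \<sigma> t e \<in> arc_point ` arc_domain \<and>
       0 < \<sigma> * Im (arc_coordinate (collar_point \<sigma> t e))"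
      using in\<Omega>[of e] e(1) by (simp add: U_def G_def G'_def D_def \<Omega>_def mult.assoc)
  qed
qed

text \<open>The half-plane condition says that \<open>Y\<close> is at least as close to \<open>w\<close> as to \<open>-w\<close>, so \<open>|Y - w|\<^sup>2 \<le> |Y\<^sup>2 - w\<^sup>2|\<close>.\<close>
lemma tendsto_of_square:
  fixes Y :: "complex \<Rightarrow> complex"
  assumes lim: "((\<lambda>z. (Y z)\<^sup>2) \<longlongrightarrow> w\<^sup>2) F" and side: "\<forall>\<^sub>F z in F. 0 \<le> Re (Y z * cnj w)"
  shows "(Y \<longlongrightarrow> w) F"
proof -
  have "((\<lambda>z. sqrt (norm ((Y z)\<^sup>2 - w\<^sup>2))) \<longlongrightarrow> sqrt (norm (w\<^sup>2 - w\<^sup>2))) F"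
    by (intro tendsto_intros lim)
  then have l0: "((\<lambda>z. sqrt (norm ((Y z)\<^sup>2 - w\<^sup>2))) \<longlongrightarrow> 0) F" by simp
  have "\<forall>\<^sub>F z in F. norm (Y z - w) \<le> sqrt (norm ((Y z)\<^sup>2 - w\<^sup>2))"
    using side
  proof eventually_elim
    case (elim z)
    have "(norm (Y z - w))\<^sup>2 \<le> (norm (Y z + w))\<^sup>2"
      unfolding cmod_power2 using elim by (simp add: power2_eq_square algebra_simps)
    then have "norm (Y z - w) \<le> norm (Y z + w)" by (rule power2_le_imp_le) simp
    then have "norm (Y z - w) * norm (Y z - w) \<le> norm (Y z - w) * norm (Y z + w)"
      by (rule mult_left_mono) simp
    also have "\<dots> = norm ((Y z)\<^sup>2 - w\<^sup>2)"
      unfolding norm_mult[symmetric] by (simp add: power2_eq_square algebra_simps)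
    finally show ?case by (intro real_le_rsqrt) (simp add: power2_eq_square)
  qed
  from Lim_null_comparison[OF this l0] show ?thesis by (simp add: LIM_zero_iff)
qed

text \<open>Put \<open>X = - b \<phi>\<^sub>b / v(U)\<close>.  Then \<open>U = (X + 1/X)/2\<close> with \<open>|X| > 1\<close>, hence \<open>Im X\<close> has the sign of
  \<open>Im U\<close>, and \<open>Y = X - U\<close> is the square root of \<open>U\<^sup>2 - 1\<close> on that same side of the real axis.  This
  pins down the limit of \<open>Y\<close>, also at the end points of the arc, where it is zero.\<close>
lemma collar_limit:
  assumes r: "is_sqrt_V b r" and s: "is_sqrt_arc b s" and t0: "t0 \<in> {-1..1}" and \<sigma>: "\<sigma>\<^sup>2 = 1"
  shows "\<exists>\<delta>>0. (airfoil_phi b s \<longlongrightarrow> - (v_at t0 / b) * unit_root \<sigma> t0)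
     (at (arc_at t0) within side_collar (airfoil_Uinv b r) (of_real \<sigma> * \<i>) \<delta>)"
proof -
  define U where "U = arc_coordinate"
  note U = arc_coordinate[folded U_def]
  obtain \<delta> where \<delta>: "\<delta> > 0"
    "\<And>t e. t \<in> {-1..1} \<Longrightarrow> 0 < e \<Longrightarrow> e < \<delta> \<Longrightarrow> dist (collar_point \<sigma> t e) (arc_at t0) < \<delta> \<Longrightarrow>
       collar_point \<sigma> t e \<in> arc_point ` arc_domain \<and> 0 < \<sigma> * Im (U (collar_point \<sigma> t e))"
    using collar_one_sided[OF t0 \<sigma>] unfolding U_def by blast
  define x where "x = arc_at t0"
  define C where "C = side_collar (airfoil_Uinv b r) (of_real \<sigma> * \<i>) \<delta>"
  define Y where "Y = (\<lambda>z. - (b / arc_v (U z)) * airfoil_phi b s z - U z)"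
  have Ux: "U x = of_real t0" unfolding x_def by (rule U(3)[OF real_in_arc_domain])
  have key: "\<forall>\<^sub>F z in at x within C. (Y z)\<^sup>2 = (U z)\<^sup>2 - 1 \<and> 0 < \<sigma> * Im (Y z)"
    unfolding eventually_at
  proof (rule exI[of _ \<delta>], rule conjI[OF \<delta>(1)], intro ballI impI)
    fix z assume z: "z \<in> C" "z \<noteq> x \<and> dist z x < \<delta>"
    then obtain t e where te: "t \<in> {-1..1}" "0 < e" "e < \<delta>"
      "z = airfoil_Uinv b r t + of_real e * (of_real \<sigma> * \<i>) * vector_derivative (airfoil_Uinv b r) (at t within {-1..1})"
      unfolding C_def side_collar_def by blast
    have ze: "z = collar_point \<sigma> t e"
      using te(4) by (simp only: airfoil_Uinv_eq[OF r te(1)] deriv_Uinv[OF r te(1)])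
    have "z \<in> arc_point ` arc_domain \<and> 0 < \<sigma> * Im (U z)"
      unfolding ze by (rule \<delta>(2)[OF te(1,2,3)]) (use z(2) in \<open>simp add: ze[symmetric] x_def\<close>)
    then obtain u where u: "u \<in> arc_domain" "z = arc_point u" and Uim: "0 < \<sigma> * Im (U z)" by blast
    have Uz: "U z = u" using U(3)[OF u(1)] u(2) by simp
    have zA: "z \<notin> airfoil_arc b"
    proof
      assume "z \<in> airfoil_arc b"
      then obtain t' where "z = arc_point (of_real t')" unfolding airfoil_arc_eq by blast
      then have "U z = of_real t'" using U(3)[OF real_in_arc_domain] by simp
      then show False using Uim by simp
    qed
    define p q where "p = airfoil_phi b s z" and "q = phi_conj s z"
    have pq: "root_pair b z p q" unfolding p_def q_def by (rule root_pair_phi[OF s zA])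
    have less: "norm q < norm p" unfolding p_def q_def by (rule norm_phi_conj_less[OF s zA])
    define k where "k = - (b / arc_v u)"
    have k0: "k \<noteq> 0" using b_nz arc_v_nz by (simp add: k_def)
    define X Q where "X = k * p" and "Q = k * q"
    have "X * Q = k\<^sup>2 * (p * q)" by (simp add: X_def Q_def power2_eq_square)
    also have "\<dots> = 1"
      using root_pair_prod[OF b_nz pq] b_nz arc_v_nz[of u] by (simp add: u(2) V_arc_point k_def power_divide)
    finally have XQ: "X * Q = 1" .
    have "X + Q = k * (p + q)" by (simp add: X_def Q_def algebra_simps)
    also have "p + q = 2 - 2 * z / b" using pq by (simp add: root_pair_def)
    also have "k * (2 - 2 * z / b) = 2 * u"
      using b_nz arc_v_nz[of u] by (simp add: k_def u(2) arc_point_def field_simps)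
    finally have XQ2: "X + Q = 2 * u" .
    have "norm Q < norm X" using less k0 by (simp add: X_def Q_def norm_mult)
    moreover have "norm X * norm Q = 1" using arg_cong[OF XQ, of norm] by (simp add: norm_mult)
    ultimately have "1 < norm X * norm X" by (metis mult_strict_left_mono norm_not_less_zero zero_less_norm_iff norm_zero mult_zero_left zero_neq_one)
    then have nX: "1 < (norm X)\<^sup>2" by (simp add: power2_eq_square)
    have "Q = 1 / X" using XQ by (metis eq_divide_eq mult.commute mult_zero_left zero_neq_one)
    then have ImQ: "Im Q = - Im X / (norm X)\<^sup>2" by (simp add: Im_divide cmod_power2)
    have "2 * Im u = Im X * (1 - 1 / (norm X)\<^sup>2)"
      using arg_cong[OF XQ2, of Im] ImQ by (simp add: algebra_simps)
    then have "2 * (\<sigma> * Im u) = (\<sigma> * Im X) * (1 - 1 / (norm X)\<^sup>2)"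
      by (metis mult.assoc mult.left_commute)
    moreover have "0 < 1 - 1 / (norm X)\<^sup>2" using nX by (simp only: diff_gt_0_iff_gt) (subst divide_less_eq_1_pos, linarith, assumption)
    ultimately have pX: "0 < \<sigma> * Im X" using Uim unfolding Uz by (metis mult_pos_pos zero_less_mult_pos2 zero_less_numeral)
    have YX: "Y z = X - u" by (simp add: Y_def X_def k_def p_def Uz)
    have YX2: "2 * Y z = X - Q" unfolding YX using XQ2 by (simp add: algebra_simps)
    have "4 * (Y z)\<^sup>2 = (X + Q)\<^sup>2 - 4 * (X * Q)"
      using arg_cong[OF YX2, of "\<lambda>x. x\<^sup>2"] by (simp add: power2_eq_square algebra_simps)
    also have "\<dots> = 4 * ((U z)\<^sup>2 - 1)" unfolding XQ XQ2 Uz by (simp add: power_mult_distrib)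
    finally have "(Y z)\<^sup>2 = (U z)\<^sup>2 - 1" by (metis mult_left_cancel zero_neq_numeral)
    moreover have "0 < \<sigma> * Im (Y z)"
    proof -
      have "2 * Im (Y z) = Im X + Im X / (norm X)\<^sup>2" using arg_cong[OF YX2, of Im] ImQ by simp
      then have "2 * (\<sigma> * Im (Y z)) = \<sigma> * Im X + (\<sigma> * Im X) / (norm X)\<^sup>2" by (simp add: algebra_simps)
      moreover have "0 < (\<sigma> * Im X) / (norm X)\<^sup>2" using pX nX by (intro divide_pos_pos) auto
      ultimately show ?thesis using pX by linarith
    qed
    ultimately show "(Y z)\<^sup>2 = (U z)\<^sup>2 - 1 \<and> 0 < \<sigma> * Im (Y z)" ..
  qed
  have xin: "x \<in> arc_point ` arc_domain" using real_in_arc_domain by (auto simp: x_def)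
  have limU: "(U \<longlongrightarrow> of_real t0) (at x within C)"
    using holomorphic_on_imp_continuous_on[OF U(1)] U(2) xin Ux
    by (metis continuous_on_eq_continuous_at continuous_at_imp_continuous_at_within continuous_within)
  define w where "w = unit_root \<sigma> t0 - of_real t0"
  have "t0\<^sup>2 \<le> 1" using t0 by (subst abs_square_le_1) auto
  then have ss: "(sqrt (1 - t0\<^sup>2))\<^sup>2 = 1 - t0\<^sup>2" "0 \<le> sqrt (1 - t0\<^sup>2)" by auto
  have w: "w = of_real \<sigma> * \<i> * of_real (sqrt (1 - t0\<^sup>2))" by (simp add: w_def unit_root_def)
  have "w\<^sup>2 = - of_real (\<sigma>\<^sup>2 * (sqrt (1 - t0\<^sup>2))\<^sup>2)" unfolding w power_mult_distrib by simp
  then have w2: "w\<^sup>2 = (of_real t0)\<^sup>2 - 1" unfolding ss \<sigma> by simp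
  have "(Y \<longlongrightarrow> w) (at x within C)"
  proof (rule tendsto_of_square)
    have "((\<lambda>z. (U z)\<^sup>2 - 1) \<longlongrightarrow> (of_real t0)\<^sup>2 - 1) (at x within C)"
      by (intro tendsto_intros limU)
    then show "((\<lambda>z. (Y z)\<^sup>2) \<longlongrightarrow> w\<^sup>2) (at x within C)"
      unfolding w2 by (rule Lim_transform_eventually) (use key in \<open>auto elim: eventually_mono\<close>)
    show "\<forall>\<^sub>F z in at x within C. 0 \<le> Re (Y z * cnj w)"
      using key
    proof eventually_elim
      case (elim z)
      have "Re (Y z * cnj w) = \<sigma> * Im (Y z) * sqrt (1 - t0\<^sup>2)" by (simp add: w)
      then show ?case using elim ss(2) by simp
    qed
  qed
  moreover have "isCont arc_v (of_real t0)"
    using holomorphic_on_imp_continuous_on[OF holomorphic_arc(2)] open_arc_domain real_in_arc_domain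
    by (simp add: continuous_on_eq_continuous_at)
  then have "((\<lambda>z. arc_v (U z)) \<longlongrightarrow> v_at t0) (at x within C)"
    using limU by (rule isCont_tendsto_compose)
  ultimately have "((\<lambda>z. - (arc_v (U z) / b) * (U z + Y z)) \<longlongrightarrow> - (v_at t0 / b) * (of_real t0 + w)) (at x within C)"
    by (intro tendsto_intros limU b_nz)
  moreover have "- (arc_v (U z) / b) * (U z + Y z) = airfoil_phi b s z" for z
    using b_nz arc_v_nz by (simp add: Y_def field_simps)
  ultimately have "(airfoil_phi b s \<longlongrightarrow> - (v_at t0 / b) * unit_root \<sigma> t0) (at x within C)"
    by (simp add: w_def)
  then show ?thesis using \<delta>(1) unfolding x_def C_def by blast
qed

text \<open>This makes one-sided limits unique.\<close>
lemma collar_accumulates: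
  assumes r: "is_sqrt_V b r" and t0: "t0 \<in> {-1..1}" and \<sigma>: "\<sigma>\<^sup>2 = 1" and \<delta>: "\<delta> > 0"
  shows "at (arc_at t0) within side_collar (airfoil_Uinv b r) (of_real \<sigma> * \<i>) \<delta> \<noteq> bot"
proof -
  from arc_coordinate(4)[OF real_in_arc_domain[of t0]] have d0: "deriv arc_point (of_real t0) \<noteq> 0" by auto
  have \<sigma>0: "\<sigma> \<noteq> 0" using \<sigma> by auto
  define D where "D = of_real \<sigma> * \<i> * deriv arc_point (of_real t0)"
  have D0: "D \<noteq> 0" using d0 \<sigma>0 by (simp add: D_def)
  have "arc_at t0 islimpt side_collar (airfoil_Uinv b r) (of_real \<sigma> * \<i>) \<delta>"
    unfolding islimpt_approachable
  proof (intro allI impI)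
    fix e :: real assume e: "e > 0"
    define \<epsilon> where "\<epsilon> = min (\<delta> / 2) (e / (2 * norm D))"
    have \<epsilon>: "0 < \<epsilon>" "\<epsilon> < \<delta>" "\<epsilon> \<le> e / (2 * norm D)" using e \<delta> D0 by (auto simp: \<epsilon>_def)
    have "\<epsilon> * norm D \<le> e / (2 * norm D) * norm D" using \<epsilon>(3) by (rule mult_right_mono) simp
    then have small: "\<epsilon> * norm D < e" using e D0 by simp
    define y where "y = arc_at t0 + of_real \<epsilon> * D"
    have "y = airfoil_Uinv b r t0 + of_real \<epsilon> * (of_real \<sigma> * \<i>) * vector_derivative (airfoil_Uinv b r) (at t0 within {-1..1})"
      by (simp only: y_def D_def airfoil_Uinv_eq[OF r t0] deriv_Uinv[OF r t0] mult.assoc)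
    then have "y \<in> side_collar (airfoil_Uinv b r) (of_real \<sigma> * \<i>) \<delta>"
      unfolding side_collar_def using t0 \<epsilon>(1,2) by blast
    moreover have "y \<noteq> arc_at t0" using D0 \<epsilon>(1) by (simp add: y_def)
    moreover have "dist y (arc_at t0) < e"
      using small \<epsilon>(1) by (simp add: y_def dist_norm norm_mult)
    ultimately show "\<exists>x'\<in>side_collar (airfoil_Uinv b r) (of_real \<sigma> * \<i>) \<delta>.
        x' \<noteq> arc_at t0 \<and> dist x' (arc_at t0) < e" by blast
  qed
  then show ?thesis by (simp add: trivial_limit_within)
qed

lemma side_limit_eq:
  assumes r: "is_sqrt_V b r" and s: "is_sqrt_arc b s" and t0: "t0 \<in> {-1..1}" and \<sigma>: "\<sigma>\<^sup>2 = 1"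
  shows "(THE l. \<exists>\<delta>>0. (airfoil_phi b s \<longlongrightarrow> l)
       (at (arc_at t0) within side_collar (airfoil_Uinv b r) (of_real \<sigma> * \<i>) \<delta>))
     = - (v_at t0 / b) * unit_root \<sigma> t0" (is "_ = ?L")
proof (rule the_equality)
  let ?C = "side_collar (airfoil_Uinv b r) (of_real \<sigma> * \<i>)"
  let ?x = "arc_at t0"
  show ex: "\<exists>\<delta>>0. (airfoil_phi b s \<longlongrightarrow> ?L) (at ?x within ?C \<delta>)"
    by (rule collar_limit[OF r s t0 \<sigma>])
  fix l assume "\<exists>\<delta>>0. (airfoil_phi b s \<longlongrightarrow> l) (at ?x within ?C \<delta>)"
  then obtain \<delta>1 where \<delta>1: "\<delta>1 > 0" "(airfoil_phi b s \<longlongrightarrow> l) (at ?x within ?C \<delta>1)" by blast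
  obtain \<delta>2 where \<delta>2: "\<delta>2 > 0" "(airfoil_phi b s \<longlongrightarrow> ?L) (at ?x within ?C \<delta>2)" using ex by blast
  have sub: "?C (min \<delta>1 \<delta>2) \<subseteq> ?C \<delta>1" "?C (min \<delta>1 \<delta>2) \<subseteq> ?C \<delta>2"
    unfolding side_collar_def by fastforce+
  show "l = ?L"
  proof (rule tendsto_unique[OF collar_accumulates[OF r t0 \<sigma>, of "min \<delta>1 \<delta>2"]])
    show "(airfoil_phi b s \<longlongrightarrow> l) (at ?x within ?C (min \<delta>1 \<delta>2))"
      by (rule tendsto_within_subset[OF \<delta>1(2) sub(1)])
    show "(airfoil_phi b s \<longlongrightarrow> ?L) (at ?x within ?C (min \<delta>1 \<delta>2))"
      by (rule tendsto_within_subset[OF \<delta>2(2) sub(2)])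
  qed (use \<delta>1(1) \<delta>2(1) in simp)
qed

lemma phi_plus_minus:
  assumes r: "is_sqrt_V b r" and s: "is_sqrt_arc b s" and t: "t \<in> {-1..1}"
  shows "phi_plus b r s (arc_at t) = - (v_at t / b) * unit_root 1 t"
    and "phi_minus b r s (arc_at t) = - (v_at t / b) * unit_root (- 1) t"
  using side_limit_eq[OF r s t, of 1] side_limit_eq[OF r s t, of "-1"]
  by (simp_all add: phi_plus_def left_limit_def phi_minus_def right_limit_def)

text \<open>At a point of the arc both boundary values have modulus \<open>|v/b|\<close>, which is one only at \<open>i\<^sub>b\<close>.\<close>
lemma airfoil_loop_eq:
  assumes r: "is_sqrt_V b r" and s: "is_sqrt_arc b s"
  shows "airfoil_loop b r s = insert (airfoil_i b) {z. z \<notin> airfoil_arc b \<and> norm (airfoil_phi b s z) = 1}"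
proof -
  have n: "norm (phi_plus b r s (arc_at t)) = norm (v_at t) / norm b"
    "norm (phi_minus b r s (arc_at t)) = norm (v_at t) / norm b"
    if "t \<in> {-1..1}" for t
    using unit_root(1)[OF that, of 1] unit_root(1)[OF that, of "-1"] phi_plus_minus[OF r s that]
    by (simp_all add: norm_mult norm_divide)
  have "{x \<in> airfoil_arc b. norm (phi_plus b r s x) = 1 \<and> norm (phi_minus b r s x) = 1} = {airfoil_i b}"
  proof (intro equalityI subsetI)
    fix x assume x: "x \<in> {x \<in> airfoil_arc b. norm (phi_plus b r s x) = 1 \<and> norm (phi_minus b r s x) = 1}"
    then obtain t where t: "t \<in> {-1..1}" "x = arc_at t" unfolding airfoil_arc_eq by blast
    have "norm (v_at t) = norm b" using n(1)[OF t(1)] x t(2) b_nz by (simp add: field_simps)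
    then show "x \<in> {airfoil_i b}" using norm_arc_v_eq_imp[OF t(1)] t(2) airfoil_i_eq by simp
  next
    fix x assume "x \<in> {airfoil_i b}"
    then have x: "x = arc_at corner" using airfoil_i_eq by simp
    have c: "corner \<in> {-1..1}" using corner_bounds by simp
    show "x \<in> {x \<in> airfoil_arc b. norm (phi_plus b r s x) = 1 \<and> norm (phi_minus b r s x) = 1}"
      using n[OF c] b_nz c unfolding x arc_v_corner airfoil_arc_eq by auto
  qed
  then show ?thesis unfolding airfoil_loop_def by auto
qed

section \<open>The loop\<close>

text \<open>The inverse of \<open>\<phi>\<^sub>b\<close> in closed form: \<open>p = 1 - \<xi>/b\<close> gives \<open>\<xi> = b(1 - p)\<close>, and \<open>z = J(\<xi>)\<close>.  The
  \<open>partner\<close> of \<open>p\<close> is the other root for the same \<open>z\<close>.\<close>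
definition partner :: "complex \<Rightarrow> complex" where "partner p = 1 - 1 / (b\<^sup>2 * (1 - p))"
definition loop_point :: "complex \<Rightarrow> complex" where
  "loop_point p = joukowski (b * (1 - p))"

lemma root_pair_loop_point: "p \<noteq> 1 \<Longrightarrow> root_pair b (loop_point p) p (partner p)"
  using b_nz by (simp add: root_pair_def loop_point_def joukowski_def partner_def field_simps power2_eq_square)

lemma root_pair_determines:
  assumes "root_pair b z p q"
  shows "p \<noteq> 1" "q = partner p" "z = loop_point p"
proof -
  have m: "(1 - p) * (1 - q) = 1 / b\<^sup>2" and a: "p + q = 2 - 2 * z / b"
    using assms by (auto simp: root_pair_def)
  show p: "p \<noteq> 1" using m b_nz by auto
  have "1 - q = 1 / (b\<^sup>2 * (1 - p))"
  proof -
    have "1 - q = (1 - p) * (1 - q) / (1 - p)" using p by simp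
    then show ?thesis unfolding m by simp
  qed
  then show q: "q = partner p" by (simp add: partner_def algebra_simps)
  have a': "p + q = 2 - 2 * loop_point p / b"
    unfolding q using root_pair_loop_point[OF p] by (simp add: root_pair_def)
  have "b * (2 - (p + q)) / 2 = z" unfolding a using b_nz by simp
  moreover have "b * (2 - (p + q)) / 2 = loop_point p" unfolding a' using b_nz by simp
  ultimately show "z = loop_point p" by (rule trans[OF sym])
qed

text \<open>With \<open>u = b\<^sup>2(1 - p)\<close> the partner is \<open>(u - 1)/u\<close>, and \<open>|u - 1| < |u|\<close> is a half-plane.\<close>
lemma norm_partner:
  assumes "p \<noteq> 1"
  shows "norm (partner p) < 1 \<longleftrightarrow> 1 / 2 < Re (b\<^sup>2 * (1 - p))"
    and "norm (partner p) = 1 \<longleftrightarrow> 1 / 2 = Re (b\<^sup>2 * (1 - p))"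
proof -
  define u where "u = b\<^sup>2 * (1 - p)"
  have u0: "u \<noteq> 0" using assms b_nz by (simp add: u_def)
  have "partner p = (u - 1) / u" using u0 by (simp add: partner_def diff_divide_distrib flip: u_def)
  then have np: "norm (partner p) = norm (u - 1) / norm u" by (simp add: norm_divide)
  have sq: "(norm (u - 1))\<^sup>2 = (norm u)\<^sup>2 + (1 - 2 * Re u)"
    unfolding cmod_power2 by (simp add: power2_eq_square algebra_simps)
  have "norm (u - 1) < norm u \<longleftrightarrow> (norm (u - 1))\<^sup>2 < (norm u)\<^sup>2"
    using power2_less_imp_less[of "norm (u - 1)" "norm u"] power_strict_mono[of "norm (u - 1)" "norm u" 2] by auto
  then show "norm (partner p) < 1 \<longleftrightarrow> 1 / 2 < Re (b\<^sup>2 * (1 - p))"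
    unfolding np sq u_def[symmetric] using u0 by (simp add: divide_less_eq_1 mult.commute)
  have "norm (u - 1) = norm u \<longleftrightarrow> (norm (u - 1))\<^sup>2 = (norm u)\<^sup>2" by simp
  then show "norm (partner p) = 1 \<longleftrightarrow> 1 / 2 = Re (b\<^sup>2 * (1 - p))"
    unfolding np sq u_def[symmetric] using u0 by auto
qed

text \<open>The unit circle is parametrized so that \<open>c\<^sub>+\<close> and \<open>c\<^sub>-\<close> belong to the parameters \<open>corner_angle\<close> and
  \<open>2\<pi> - corner_angle\<close>.\<close>
definition corner_angle :: real where "corner_angle = arccos corner"
definition arc_cis :: "real \<Rightarrow> complex" where "arc_cis \<beta> = cnj b / b * cis \<beta>"

abbreviation loop_arc :: "complex set" where
  "loop_arc \<equiv> arc_cis ` {corner_angle<..<2 * pi - corner_angle}"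

lemma corner_angle: "0 < corner_angle" "corner_angle < pi" "cos corner_angle = corner"
  unfolding corner_angle_def using arccos_lt_bounded[of corner] corner_bounds by auto

lemma norm_arc_cis: "norm (arc_cis \<beta>) = 1"
  using b_nz by (simp add: arc_cis_def norm_mult norm_divide)

lemma b_sq_arc_cis: "b\<^sup>2 * arc_cis \<beta> = of_real ((norm b)\<^sup>2) * cis \<beta>"
proof -
  have "b\<^sup>2 * arc_cis \<beta> = (b * cnj b) * cis \<beta>" using b_nz by (simp add: arc_cis_def power2_eq_square)
  then show ?thesis by (simp only: complex_norm_square)
qed

lemma arc_cis_side: "Re (b\<^sup>2 * (1 - arc_cis \<beta>)) = 1 / 2 + (norm b)\<^sup>2 * (corner - cos \<beta>)"
proof -
  have "Re (b\<^sup>2 * (1 - arc_cis \<beta>)) = Re (b\<^sup>2) - Re (b\<^sup>2 * arc_cis \<beta>)" by (simp add: algebra_simps)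
  also have "\<dots> = Re (b\<^sup>2) - (norm b)\<^sup>2 * cos \<beta>" unfolding b_sq_arc_cis by simp
  also have "\<dots> = 1 / 2 + (norm b)\<^sup>2 * (corner - cos \<beta>)" using Re_square_eq by (simp add: algebra_simps)
  finally show ?thesis .
qed

lemma arc_cis_ne_1: "cos \<beta> \<le> corner \<Longrightarrow> arc_cis \<beta> \<noteq> 1"
proof
  assume c: "cos \<beta> \<le> corner" and 1: "arc_cis \<beta> = 1"
  have "0 \<le> (norm b)\<^sup>2 * (corner - cos \<beta>)" using c by simp
  then show False using arc_cis_side[of \<beta>] 1 by simp
qed

lemma norm_partner_arc_cis:
  assumes "cos \<beta> \<le> corner"
  shows "norm (partner (arc_cis \<beta>)) < 1 \<longleftrightarrow> cos \<beta> < corner"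
    and "norm (partner (arc_cis \<beta>)) = 1 \<longleftrightarrow> cos \<beta> = corner"
  unfolding norm_partner[OF arc_cis_ne_1[OF assms]] arc_cis_side
  using b_nz by (auto simp: zero_less_mult_iff)

lemma cos_less_corner_iff:
  assumes "0 \<le> \<beta>" "\<beta> \<le> 2 * pi"
  shows "cos \<beta> < corner \<longleftrightarrow> corner_angle < \<beta> \<and> \<beta> < 2 * pi - corner_angle"
proof -
  have m: "cos x < corner \<longleftrightarrow> corner_angle < x" if "0 \<le> x" "x \<le> pi" for x
    unfolding corner_angle(3)[symmetric] using that corner_angle(1,2) by (intro cos_mono_less_eq) auto
  show ?thesis
  proof (cases "\<beta> \<le> pi")
    case True
    then show ?thesis using m[of \<beta>] assms corner_angle(2) by auto
  next
    case False
    have "cos \<beta> = cos (2 * pi - \<beta>)" by simp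
    then show ?thesis using m[of "2 * pi - \<beta>"] assms False corner_angle(2) by auto
  qed
qed

lemma cos_eq_corner_iff:
  assumes "corner_angle \<le> \<beta>" "\<beta> \<le> 2 * pi - corner_angle"
  shows "cos \<beta> \<le> corner" "cos \<beta> = corner \<longleftrightarrow> \<beta> = corner_angle \<or> \<beta> = 2 * pi - corner_angle"
proof -
  have "cos (2 * pi - corner_angle) = corner" using corner_angle(3) by simp
  then have ends: "cos \<beta> = corner" if "\<beta> = corner_angle \<or> \<beta> = 2 * pi - corner_angle"
    using that corner_angle(3) by auto
  have inner: "cos \<beta> < corner" if "\<not> (\<beta> = corner_angle \<or> \<beta> = 2 * pi - corner_angle)"
    using cos_less_corner_iff[of \<beta>] assms corner_angle that by auto
  show "cos \<beta> \<le> corner" "cos \<beta> = corner \<longleftrightarrow> \<beta> = corner_angle \<or> \<beta> = 2 * pi - corner_angle"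
    using ends inner by fastforce+
qed

lemma unit_root_cis:
  assumes "0 \<le> \<alpha>" "\<alpha> \<le> pi"
  shows "unit_root 1 (cos \<alpha>) = cis \<alpha>" "unit_root (- 1) (cos \<alpha>) = cis (- \<alpha>)"
proof -
  have "sqrt (1 - (cos \<alpha>)\<^sup>2) = sin \<alpha>"
    using sin_ge_zero[OF assms] by (simp add: sin_squared_eq[symmetric])
  then show "unit_root 1 (cos \<alpha>) = cis \<alpha>" "unit_root (- 1) (cos \<alpha>) = cis (- \<alpha>)"
    by (simp_all add: unit_root_def complex_eq_iff)
qed

lemma phi_at_corner:
  assumes r: "is_sqrt_V b r" and s: "is_sqrt_arc b s"
  shows "phi_plus b r s (airfoil_i b) = arc_cis corner_angle"
    and "phi_minus b r s (airfoil_i b) = arc_cis (2 * pi - corner_angle)"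
proof -
  have c: "corner \<in> {-1..1}" using corner_bounds by simp
  have u: "unit_root 1 corner = cis corner_angle" "unit_root (-1) corner = cis (- corner_angle)"
    using unit_root_cis[of corner_angle] corner_angle by auto
  have "cis (- corner_angle) = cis (2 * pi - corner_angle)" by (simp add: complex_eq_iff)
  then show "phi_plus b r s (airfoil_i b) = arc_cis corner_angle"
    "phi_minus b r s (airfoil_i b) = arc_cis (2 * pi - corner_angle)"
    using phi_plus_minus[OF r s c] u by (simp_all add: airfoil_i_eq arc_v_corner arc_cis_def)
qed

lemma root_pair_corner:
  "root_pair b (airfoil_i b) (arc_cis corner_angle) (arc_cis (2 * pi - corner_angle))"
proof -
  have c: "corner \<in> {-1..1}" using corner_bounds by simp
  have u: "unit_root 1 corner = cis corner_angle" "unit_root (-1) corner = cis (- corner_angle)"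
    using unit_root_cis[of corner_angle] corner_angle by auto
  have "cis (- corner_angle) = cis (2 * pi - corner_angle)" by (simp add: complex_eq_iff)
  then show ?thesis using root_pair_on_arc[OF c] u by (simp add: airfoil_i_eq arc_v_corner arc_cis_def)
qed

lemma circle_arc_eq:
  "circle_arc (arc_cis corner_angle) (arc_cis (2 * pi - corner_angle)) =
     loop_arc"
proof -
  have quot: "arc_cis (2 * pi - corner_angle) / arc_cis corner_angle = cis (2 * pi - 2 * corner_angle)"
  proof -
    have "arc_cis (2 * pi - corner_angle) / arc_cis corner_angle = cis (2 * pi - corner_angle) / cis corner_angle"
      using b_nz by (simp add: arc_cis_def)
    then show ?thesis by (simp add: cis_divide)
  qed
  have arg: "Arg2pi (cis (2 * pi - 2 * corner_angle)) = 2 * pi - 2 * corner_angle"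
    by (rule Arg2pi_unique[of 1]) (use corner_angle in \<open>auto simp: cis_conv_exp\<close>)
  have mult: "arc_cis corner_angle * cis t = arc_cis (corner_angle + t)" for t
    by (simp add: arc_cis_def cis_mult mult.assoc)
  have "circle_arc (arc_cis corner_angle) (arc_cis (2 * pi - corner_angle)) =
      {arc_cis (corner_angle + t) | t. 0 < t \<and> t < 2 * pi - 2 * corner_angle}"
    unfolding circle_arc_def quot arg mult ..
  also have "\<dots> = loop_arc"
  proof (intro equalityI subsetI)
    fix x assume "x \<in> loop_arc"
    then obtain \<beta> where "x = arc_cis (corner_angle + (\<beta> - corner_angle))" "corner_angle < \<beta>" "\<beta> < 2 * pi - corner_angle"
      by auto
    then show "x \<in> {arc_cis (corner_angle + t) | t. 0 < t \<and> t < 2 * pi - 2 * corner_angle}"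
      by (intro CollectI exI[of _ "\<beta> - corner_angle"]) auto
  qed auto
  finally show ?thesis .
qed

lemma phi_loop_point:
  assumes s: "is_sqrt_arc b s" and \<beta>: "cos \<beta> < corner"
  shows "loop_point (arc_cis \<beta>) \<notin> airfoil_arc b" "airfoil_phi b s (loop_point (arc_cis \<beta>)) = arc_cis \<beta>"
proof -
  have le: "cos \<beta> \<le> corner" using \<beta> by simp
  have "norm (partner (arc_cis \<beta>)) < norm (arc_cis \<beta>)"
    unfolding norm_arc_cis using norm_partner_arc_cis(1)[OF le] \<beta> by simp
  from phi_eqI[OF s root_pair_loop_point[OF arc_cis_ne_1[OF le]] this]
  show "loop_point (arc_cis \<beta>) \<notin> airfoil_arc b" "airfoil_phi b s (loop_point (arc_cis \<beta>)) = arc_cis \<beta>"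
    by auto
qed

lemma unit_circle_arc_cis:
  assumes "norm p = 1"
  obtains \<beta> where "0 \<le> \<beta>" "\<beta> < 2 * pi" "p = arc_cis \<beta>"
proof -
  define u where "u = p * (b / cnj b)"
  have nu: "norm u = 1" using assms b_nz by (simp add: u_def norm_mult norm_divide)
  have "u = cis (Arg2pi u)" using Arg2pi_eq[of u] nu by (simp add: cis_conv_exp)
  moreover have "p = cnj b / b * u" using b_nz by (simp add: u_def)
  ultimately have "p = arc_cis (Arg2pi u)" by (simp add: arc_cis_def)
  then show ?thesis using that Arg2pi_ge_0 Arg2pi_lt_2pi by blast
qed

lemma loop_without_corner:
  assumes r: "is_sqrt_V b r" and s: "is_sqrt_arc b s"
  shows "airfoil_loop b r s - {airfoil_i b} = loop_point ` loop_arc"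
proof -
  have "airfoil_i b \<in> airfoil_arc b" unfolding airfoil_i_eq airfoil_arc_eq using corner_bounds by auto
  then have "airfoil_loop b r s - {airfoil_i b} = {z. z \<notin> airfoil_arc b \<and> norm (airfoil_phi b s z) = 1}"
    unfolding airfoil_loop_eq[OF r s] by blast
  also have "\<dots> = loop_point ` loop_arc"
  proof (intro equalityI subsetI)
    fix z assume z: "z \<in> {z. z \<notin> airfoil_arc b \<and> norm (airfoil_phi b s z) = 1}"
    define p where "p = airfoil_phi b s z"
    have zA: "z \<notin> airfoil_arc b" and np: "norm p = 1" using z by (auto simp: p_def)
    note pq = root_pair_phi[OF s zA, folded p_def]
    have less: "norm (partner p) < 1"
      using norm_phi_conj_less[OF s zA] root_pair_determines(2)[OF pq] np by (simp add: p_def)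
    obtain \<beta> where \<beta>: "0 \<le> \<beta>" "\<beta> < 2 * pi" "p = arc_cis \<beta>" using unit_circle_arc_cis[OF np] .
    have "0 < (norm b)\<^sup>2 * (corner - cos \<beta>)"
      using less norm_partner(1)[OF root_pair_determines(1)[OF pq]] arc_cis_side[of \<beta>] \<beta>(3) by simp
    then have "cos \<beta> < corner" by (simp add: zero_less_mult_iff)
    then have "\<beta> \<in> {corner_angle<..<2 * pi - corner_angle}" using cos_less_corner_iff[of \<beta>] \<beta> by simp
    then show "z \<in> loop_point ` loop_arc"
      using root_pair_determines(3)[OF pq] \<beta>(3) by blast
  next
    fix z assume "z \<in> loop_point ` loop_arc"
    then obtain \<beta> where \<beta>: "corner_angle < \<beta>" "\<beta> < 2 * pi - corner_angle" "z = loop_point (arc_cis \<beta>)" by auto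
    have "cos \<beta> < corner" using cos_less_corner_iff[of \<beta>] \<beta> corner_angle by simp
    from phi_loop_point[OF s this] show "z \<in> {z. z \<notin> airfoil_arc b \<and> norm (airfoil_phi b s z) = 1}"
      using \<beta>(3) norm_arc_cis by simp
  qed
  finally show ?thesis .
qed

lemma phi_inv_on_arc:
  assumes r: "is_sqrt_V b r" and s: "is_sqrt_arc b s" and p: "p \<in> loop_arc"
  shows "phi_inv b r s p = loop_point p"
proof -
  have phi: "airfoil_phi b s (loop_point p) = p" if p: "p \<in> loop_arc" for p
  proof -
    obtain \<beta> where \<beta>: "corner_angle < \<beta>" "\<beta> < 2 * pi - corner_angle" "p = arc_cis \<beta>" using p by auto
    have "cos \<beta> < corner" using cos_less_corner_iff[of \<beta>] \<beta> corner_angle by simp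
    from phi_loop_point(2)[OF s this] show ?thesis using \<beta>(3) by simp
  qed
  have "inj_on (airfoil_phi b s) (loop_point ` loop_arc)"
  proof (rule inj_onI)
    fix x y assume "x \<in> loop_point ` loop_arc"
      "y \<in> loop_point ` loop_arc" "airfoil_phi b s x = airfoil_phi b s y"
    then show "x = y" using phi by (elim imageE) (metis imageI)
  qed
  then show ?thesis unfolding phi_inv_def loop_without_corner[OF r s]
    by (rule inv_into_f_eq) (use p phi in auto)
qed

text \<open>Two parameters with the same image have the same root pair.  Either the roots agree, or one is the
  partner of the other; then both partners are unimodular, which happens only at the end points.\<close>
lemma simple_path_loop:
  "simple_path (\<lambda>\<tau>. loop_point (arc_cis (corner_angle + \<tau> * (2 * pi - 2 * corner_angle))))"
proof -
  define B where "B = (\<lambda>\<tau>. corner_angle + \<tau> * (2 * pi - 2 * corner_angle))"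
  have k: "0 < 2 * pi - 2 * corner_angle" using corner_angle by simp
  have Bb: "corner_angle \<le> B \<tau>" "B \<tau> \<le> 2 * pi - corner_angle" if "\<tau> \<in> {0..1}" for \<tau>
  proof -
    show "corner_angle \<le> B \<tau>" using that k by (simp add: B_def)
    have "\<tau> * (2 * pi - 2 * corner_angle) \<le> 1 * (2 * pi - 2 * corner_angle)"
      using that k by (intro mult_right_mono) auto
    then show "B \<tau> \<le> 2 * pi - corner_angle" by (simp add: B_def)
  qed
  have le: "cos (B \<tau>) \<le> corner" if "\<tau> \<in> {0..1}" for \<tau>
    using cos_eq_corner_iff(1)[OF Bb[OF that]] .
  have inj: "x = y" if "x \<in> {0..1}" "y \<in> {0..1}" "arc_cis (B x) = arc_cis (B y)" for x y
  proof -
    have c: "cis (B x) = cis (B y)" using that(3) b_nz by (simp add: arc_cis_def)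
    have "Arg2pi (cis (B x)) = B x" if "x \<in> {0..1}" for x
      by (rule Arg2pi_unique[of 1]) (use Bb[OF that] corner_angle in \<open>auto simp: cis_conv_exp\<close>)
    then have "B x = B y" using that(1,2) c by metis
    then show ?thesis using k by (simp add: B_def)
  qed
  have ends: "\<tau> = 0 \<or> \<tau> = 1" if "\<tau> \<in> {0..1}" "norm (partner (arc_cis (B \<tau>))) = 1" for \<tau>
  proof -
    have "cos (B \<tau>) = corner" using norm_partner_arc_cis(2)[OF le[OF that(1)]] that(2) by simp
    then have "B \<tau> = corner_angle \<or> B \<tau> = 2 * pi - corner_angle"
      using cos_eq_corner_iff(2)[OF Bb[OF that(1)]] by simp
    then show ?thesis
    proof
      assume "B \<tau> = corner_angle" then show ?thesis using k by (simp add: B_def)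
    next
      assume "B \<tau> = 2 * pi - corner_angle"
      then have "\<tau> * (2 * pi - 2 * corner_angle) = 1 * (2 * pi - 2 * corner_angle)" unfolding B_def by argo
      then have "\<tau> = 1" using k by (metis less_irrefl mult_right_cancel)
      then show ?thesis ..
    qed
  qed
  have B_fold: "corner_angle + \<tau> * (2 * pi - 2 * corner_angle) = B \<tau>" for \<tau> by (simp add: B_def)
  show ?thesis unfolding simple_path_def loop_free_def B_fold
  proof (intro conjI ballI impI)
    have "continuous_on {0..1} (\<lambda>\<tau>. loop_point (arc_cis (B \<tau>)))"
      unfolding loop_point_def joukowski_def arc_cis_def B_def cis_conv_exp
      using b_nz arc_cis_ne_1[OF le]
      by (intro continuous_intros) (auto simp: arc_cis_def B_def cis_conv_exp)
    then show "path (\<lambda>\<tau>. loop_point (arc_cis (B \<tau>)))" by (simp add: path_def)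
    fix x y :: real assume xy: "x \<in> {0..1}" "y \<in> {0..1}" "loop_point (arc_cis (B x)) = loop_point (arc_cis (B y))"
    have px: "root_pair b (loop_point (arc_cis (B x))) (arc_cis (B x)) (partner (arc_cis (B x)))"
      and py: "root_pair b (loop_point (arc_cis (B x))) (arc_cis (B y)) (partner (arc_cis (B y)))"
      using root_pair_loop_point[OF arc_cis_ne_1[OF le[OF xy(1)]]] root_pair_loop_point[OF arc_cis_ne_1[OF le[OF xy(2)]]]
      unfolding xy(3) by auto
    from root_pair_unique[OF px py] show "x = y \<or> x = 0 \<and> y = 1 \<or> x = 1 \<and> y = 0"
    proof
      assume "arc_cis (B y) = arc_cis (B x) \<and> partner (arc_cis (B y)) = partner (arc_cis (B x))"
      then show ?thesis using inj[OF xy(1,2)] by simp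
    next
      assume a: "arc_cis (B y) = partner (arc_cis (B x)) \<and> partner (arc_cis (B y)) = arc_cis (B x)"
      then have "norm (partner (arc_cis (B x))) = 1" "norm (partner (arc_cis (B y))) = 1"
        using norm_arc_cis by metis+
      then show ?thesis using ends xy(1,2) by blast
    qed
  qed
qed

text \<open>The two tangent vectors \<open>u\<close>, \<open>v\<close> at \<open>i\<^sub>b\<close> satisfy \<open>v cnj(u) = K b\<^sup>2 c\<^sub>-\<close> with \<open>K > 0\<close>, because
  \<open>(1 - c\<^sub>+)(1 - c\<^sub>-) = 1/b\<^sup>2\<close>; and \<open>b\<^sup>2 c\<^sub>-\<close> is a positive multiple of \<open>e\<^sup>-\<^sup>i\<^sup>\<alpha>\<close> with \<open>0 < \<alpha> < \<pi>\<close>.\<close>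
lemma loop_with_corner_airfoil:
  assumes r: "is_sqrt_V b r" and s: "is_sqrt_arc b s"
  shows "loop_with_corner (airfoil_loop b r s) (airfoil_i b)"
proof -
  define k where "k = 2 * pi - 2 * corner_angle"
  define g where "g = (\<lambda>\<tau>. loop_point (arc_cis (corner_angle + \<tau> * k)))"
  define c1 c2 where "c1 = arc_cis corner_angle" and "c2 = arc_cis (2 * pi - corner_angle)"
  have k: "0 < k" using corner_angle by (simp add: k_def)
  note pair = root_pair_corner[folded c1_def c2_def]
  note pair' = root_pair_commute[OF pair]
  note c1 = root_pair_determines[OF pair] and c2 = root_pair_determines[OF pair']
  have g0: "g 0 = airfoil_i b" by (simp add: g_def c1(3) c1_def)
  have g1: "g 1 = airfoil_i b" by (simp add: g_def c2(3) c2_def k_def)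
  have img: "path_image g = airfoil_loop b r s"
  proof -
    have "airfoil_i b \<in> airfoil_loop b r s" unfolding airfoil_loop_eq[OF r s] by (rule insertI1)
    then have "airfoil_loop b r s = insert (airfoil_i b) (airfoil_loop b r s - {airfoil_i b})"
      by (rule insert_Diff[symmetric])
    then have L: "airfoil_loop b r s = insert (airfoil_i b) (loop_point ` loop_arc)"
      unfolding loop_without_corner[OF r s] .
    show ?thesis
    proof (intro equalityI subsetI)
      fix z assume "z \<in> path_image g"
      then obtain \<tau> where \<tau>: "0 \<le> \<tau>" "\<tau> \<le> 1" "z = g \<tau>" by (auto simp: path_image_def)
      show "z \<in> airfoil_loop b r s"
      proof (cases "\<tau> = 0 \<or> \<tau> = 1")
        case True then show ?thesis using g0 g1 \<tau>(3) L by auto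
      next
        case False
        then have "0 < \<tau> * k" "\<tau> * k < 1 * k" using \<tau> k by (auto intro!: mult_strict_right_mono)
        then have "corner_angle + \<tau> * k \<in> {corner_angle<..<2 * pi - corner_angle}" by (simp add: k_def)
        then show ?thesis unfolding L \<tau>(3) g_def by blast
      qed
    next
      fix z assume "z \<in> airfoil_loop b r s"
      then consider "z = airfoil_i b" | \<beta> where "corner_angle < \<beta>" "\<beta> < 2 * pi - corner_angle" "z = loop_point (arc_cis \<beta>)"
        unfolding L by auto
      then show "z \<in> path_image g"
      proof cases
        case 1 then show ?thesis using imageI[of 0 "{0..1}" g] g0 by (simp add: path_image_def)
      next
        case 2
        define \<tau> where "\<tau> = (\<beta> - corner_angle) / k"
        have "0 \<le> \<tau>" using 2 k by (simp add: \<tau>_def)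
        moreover have "\<tau> \<le> 1" using 2 k by (simp add: \<tau>_def) (simp add: k_def)
        moreover have "z = g \<tau>" using 2 k by (simp add: g_def \<tau>_def)
        ultimately show ?thesis by (auto simp: path_image_def)
      qed
    qed
  qed
  have der: "(g has_vector_derivative (of_real k * (\<i> * p)) * (b / 2 * ((p - partner p) / (1 - p)))) (at \<tau> within {0..1})"
    if p: "p = arc_cis (corner_angle + \<tau> * k)" "p \<noteq> 1" for p \<tau>
  proof -
    have d1: "((\<lambda>\<tau>. arc_cis (corner_angle + \<tau> * k)) has_vector_derivative of_real k * (\<i> * p)) (at \<tau>)"
      unfolding arc_cis_def p(1) cis_conv_exp using b_nz
      by (auto intro!: derivative_eq_intros has_vector_derivative_real_field simp: algebra_simps)
    have "1 - p \<noteq> 0" using p(2) by simp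
    then have "(loop_point has_field_derivative (- b + b / (b * (1 - p))\<^sup>2) / 2) (at p)"
      unfolding loop_point_def joukowski_def using b_nz
      by (auto intro!: derivative_eq_intros simp: power2_eq_square)
    moreover have "(- b + b / (b * (1 - p))\<^sup>2) / 2 = b / 2 * ((p - partner p) / (1 - p))"
      using p(2) b_nz by (simp add: partner_def divide_simps) (simp add: algebra_simps power2_eq_square)
    ultimately have d2: "(loop_point has_field_derivative b / 2 * ((p - partner p) / (1 - p))) (at (arc_cis (corner_angle + \<tau> * k)))"
      unfolding p(1)[symmetric] by (rule DERIV_cong)
    from has_vector_derivative_at_within[OF field_vector_diff_chain_at[OF d1 d2]]
    show ?thesis by (simp add: g_def o_def)
  qed
  define u where "u = (of_real k * (\<i> * c1)) * (b / 2 * ((c1 - c2) / (1 - c1)))"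
  define v where "v = (of_real k * (\<i> * c2)) * (b / 2 * ((c2 - c1) / (1 - c2)))"
  have du: "(g has_vector_derivative u) (at 0 within {0..1})"
    using der[of c1 0] c1(1,2) by (simp add: u_def c1_def)
  have dv: "(g has_vector_derivative v) (at 1 within {0..1})"
    using der[of c2 1] c2(1,2) by (simp add: v_def c2_def k_def)
  have cc: "c1 * cnj c1 = 1" using norm_arc_cis by (simp add: c1_def complex_norm_square[symmetric])
  define W where "W = of_real k * \<i> * (b / 2) * (c1 - c2)"
  define K where "K = (norm W)\<^sup>2"
  have "c1 \<noteq> c2"
  proof
    assume "c1 = c2"
    then have "cis corner_angle = cis (2 * pi - corner_angle)" using b_nz by (simp add: c1_def c2_def arc_cis_def)
    then have "sin corner_angle = - sin corner_angle" by (simp add: complex_eq_iff)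
    then show False using sin_gt_zero[OF corner_angle(1,2)] by simp
  qed
  then have K: "K > 0" using k b_nz by (simp add: K_def W_def)
  have frac: "cnj (c1 / (1 - c1)) = - 1 / (1 - c1)"
  proof -
    have c0: "c1 \<noteq> 0" using cc by auto
    have "cnj c1 = 1 / c1" using cc c0 by (simp add: field_simps)
    then have "cnj (c1 / (1 - c1)) = (1 / c1) / (1 - 1 / c1)" by simp
    also have "\<dots> = - 1 / (1 - c1)" using c0 c1(1) by (simp add: field_simps)
    finally show ?thesis .
  qed
  have uW: "u = W * (c1 / (1 - c1))" by (simp add: u_def W_def)
  have vW: "v = - W * (c2 / (1 - c2))"
    by (simp add: v_def W_def flip: minus_divide_left) (simp add: algebra_simps diff_divide_distrib)
  have "v * cnj u = - (W * cnj W) * (c2 / (1 - c2)) * cnj (c1 / (1 - c1))"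
  proof -
    have "(- W * x) * (cnj W * y) = - (W * cnj W) * x * y" for x y by (simp add: algebra_simps)
    then show ?thesis unfolding uW vW complex_cnj_mult[of W] .
  qed
  also have "\<dots> = - of_real K * (c2 / (1 - c2)) * cnj (c1 / (1 - c1))"
    by (simp only: K_def complex_norm_square)
  also have "\<dots> = of_real K * (c2 * (1 / ((1 - c1) * (1 - c2))))" unfolding frac by simp
  also have "(1 - c1) * (1 - c2) = 1 / b\<^sup>2" using pair by (simp add: root_pair_def)
  also have "c2 * (1 / (1 / b\<^sup>2)) = b\<^sup>2 * c2" by simp
  also have "\<dots> = of_real ((norm b)\<^sup>2) * cis (2 * pi - corner_angle)" unfolding c2_def by (rule b_sq_arc_cis)
  finally have "Im (v * cnj u) = - (K * (norm b)\<^sup>2 * sin corner_angle)" by simp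
  then have "Im (v * cnj u) \<noteq> 0" using K b_nz sin_gt_zero[OF corner_angle(1,2)] by simp
  moreover have "simple_path g" using simple_path_loop by (simp add: g_def k_def)
  ultimately show ?thesis unfolding loop_with_corner_def using img g0 g1 du dv
    by (intro exI[of _ g] exI[of _ u] exI[of _ v]) (auto simp: pathstart_def pathfinish_def)
qed

lemma phi_inv_outside:
  assumes r: "is_sqrt_V b r" and s: "is_sqrt_arc b s" and p: "p \<notin> loop_arc"
  shows "phi_inv b r s p = (SOME y. False)"
proof -
  have "airfoil_phi b s y \<noteq> p" if y: "y \<in> loop_point ` loop_arc" for y
  proof -
    obtain \<beta> where \<beta>: "corner_angle < \<beta>" "\<beta> < 2 * pi - corner_angle" "y = loop_point (arc_cis \<beta>)" using y by auto
    have "cos \<beta> < corner" using cos_less_corner_iff[of \<beta>] \<beta> corner_angle by simp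
    from phi_loop_point(2)[OF s this] show ?thesis using \<beta> p by auto
  qed
  then have "(\<lambda>y. y \<in> loop_point ` loop_arc \<and> airfoil_phi b s y = p) = (\<lambda>y. False)"
    by fastforce
  then show ?thesis unfolding phi_inv_def loop_without_corner[OF r s] inv_into_def by (simp only:)
qed

end

section \<open>Lower bounds for the number of zeros\<close>

lemma perturbed_fixed_point:
  fixes E :: "complex \<Rightarrow> complex"
  assumes n: "n \<ge> 1" and r: "r > 0"
    and cont: "continuous_on (cball (c / of_nat n) (r / real n)) E"
    and small: "\<And>y. y \<in> cball (c / of_nat n) (r / real n) \<Longrightarrow> norm (E y) \<le> r"
  obtains y where "y \<in> cball (c / of_nat n) (r / real n)" "of_nat n * y = c + E y"
proof -
  have n0: "of_nat n \<noteq> (0::complex)" "real n > 0" using n by auto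
  have "continuous_on (cball (c / of_nat n) (r / real n)) (\<lambda>y. (c + E y) / of_nat n)"
    by (intro continuous_intros cont) (use n0 in auto)
  moreover have "(\<lambda>y. (c + E y) / of_nat n) \<in> cball (c / of_nat n) (r / real n) \<rightarrow> cball (c / of_nat n) (r / real n)"
  proof
    fix y assume "y \<in> cball (c / of_nat n) (r / real n)"
    from small[OF this] have "norm (E y / of_nat n) \<le> r / real n"
      using n0 by (simp add: norm_divide divide_right_mono)
    then show "(c + E y) / of_nat n \<in> cball (c / of_nat n) (r / real n)"
      by (simp add: dist_norm add_divide_distrib)
  qed
  moreover have "r / real n > 0" using r n0 by simp
  ultimately obtain y where y: "y \<in> cball (c / of_nat n) (r / real n)" "(c + E y) / of_nat n = y"
    using brouwer_ball[of "r / real n" "c / of_nat n" "\<lambda>y. (c + E y) / of_nat n"] by blast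
  have "of_nat n * y = c + E y" using arg_cong[OF y(2), of "\<lambda>x. of_nat n * x"] n0(1) by simp
  with y(1) show ?thesis using that by blast
qed

text \<open>The index of the point of the lattice \<open>c0 + \<int> d\<close> that is nearest to \<open>n x\<close>.\<close>
definition cell :: "real \<Rightarrow> real \<Rightarrow> nat \<Rightarrow> real \<Rightarrow> int" where
  "cell c0 d n x = \<lfloor>(real n * x - c0) / d + 1 / 2\<rfloor>"

lemma cell_bounds:
  assumes "d > 0"
  shows "\<bar>real n * x - (c0 + of_int (cell c0 d n x) * d)\<bar> \<le> d / 2"
proof -
  define q where "q = (real n * x - c0) / d"
  have x: "real n * x = c0 + q * d" using assms by (simp add: q_def)
  have "of_int (cell c0 d n x) \<le> q + 1 / 2" "q + 1 / 2 < of_int (cell c0 d n x) + 1"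
    unfolding cell_def q_def[symmetric] by linarith+
  then have "\<bar>q - of_int (cell c0 d n x)\<bar> \<le> 1 / 2" by linarith
  then have "\<bar>q - of_int (cell c0 d n x)\<bar> * d \<le> 1 / 2 * d" using assms by (intro mult_right_mono) auto
  then have "\<bar>(q - of_int (cell c0 d n x)) * d\<bar> \<le> d / 2" using assms by (simp add: abs_mult)
  then show ?thesis unfolding x by (simp add: algebra_simps)
qed

lemma cell_eqI:
  assumes "d > 0" and "\<bar>real n * x - (c0 + of_int k * d)\<bar> < d / 2"
  shows "cell c0 d n x = k"
proof -
  define q where "q = (real n * x - c0) / d"
  have x: "real n * x = c0 + q * d" using assms(1) by (simp add: q_def)
  have "\<bar>(q - of_int k) * d\<bar> < d / 2" using assms(2) unfolding x by (simp add: algebra_simps)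
  then have "\<bar>q - of_int k\<bar> * d < 1 / 2 * d" using assms(1) by (simp add: abs_mult)
  then have "\<bar>q - of_int k\<bar> < 1 / 2" using assms(1) by (metis mult_less_cancel_right_pos)
  then show ?thesis unfolding cell_def q_def[symmetric] by linarith
qed

lemma emeasure_cell:
  assumes "d > 0" "n \<ge> 1"
  shows "{x. cell c0 d n x = k} \<in> sets lborel" "emeasure lborel {x. cell c0 d n x = k} = ennreal (d / real n)"
proof -
  have n0: "real n > 0" using assms(2) by simp
  define l where "l = (c0 + (of_int k - 1 / 2) * d) / real n"
  have "cell c0 d n x = k \<longleftrightarrow> x \<in> {l..<l + d / real n}" for x
  proof -
    have x: "x = l + ((real n * x - c0) / d + 1 / 2 - of_int k) * (d / real n)"
      using assms n0 by (simp add: l_def field_simps)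
    define q where "q = (real n * x - c0) / d + 1 / 2 - of_int k"
    have xq: "x = l + q * (d / real n)" using x by (simp only: q_def)
    have dn: "d / real n > 0" using assms n0 by simp
    have "cell c0 d n x = k \<longleftrightarrow> 0 \<le> q \<and> q < 1" unfolding cell_def q_def floor_eq_iff by linarith
    also have "\<dots> \<longleftrightarrow> l \<le> l + q * (d / real n) \<and> l + q * (d / real n) < l + d / real n"
      using dn by (auto simp: zero_le_mult_iff mult_less_cancel_right1 simp del: times_divide_eq_right)
    finally show ?thesis using xq by simp
  qed
  then have eq: "{x. cell c0 d n x = k} = {l..<l + d / real n}" by blast
  show "{x. cell c0 d n x = k} \<in> sets lborel" unfolding eq by simp
  show "emeasure lborel {x. cell c0 d n x = k} = ennreal (d / real n)"
    unfolding eq using assms n0 by simp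
qed

text \<open>Fatou's lemma for the functions \<open>F\<^sub>n(x) = \<Sum> f(z)/d\<close>, summed over those \<open>z \<in> Z\<^sub>n\<close> that lie in the same
  cell as \<open>x\<close>.  A cell has length \<open>d/n\<close>, so the integral of \<open>F\<^sub>n\<close> is exactly \<open>(1/n) \<Sum> f(z)\<close>, while
  \<open>liminf F\<^sub>n(x) \<ge> f(\<gamma>(x))/d\<close> as soon as the cell of \<open>x\<close> eventually contains elements of \<open>Z\<^sub>n\<close> that tend
  to \<open>\<gamma>(x)\<close>.\<close>
lemma counting_liminf:
  fixes Z :: "nat \<Rightarrow> complex set" and \<gamma> :: "real \<Rightarrow> complex" and pos :: "complex \<Rightarrow> real" and f :: "complex \<Rightarrow> real"
  assumes d: "d > 0" and fin: "\<And>n. finite (Z n)"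
    and approx: "\<And>x e. x \<in> I \<Longrightarrow> e > 0 \<Longrightarrow>
       \<forall>\<^sub>F n in sequentially. \<exists>z\<in>Z n. dist z (\<gamma> x) < e \<and> cell c0 d n (pos z) = cell c0 d n x"
    and f: "continuous_on UNIV f" "\<And>z. 0 \<le> f z"
  shows "(\<integral>\<^sup>+x. ennreal (f (\<gamma> x) / d) * indicator I x \<partial>lborel) \<le> liminf (\<lambda>n. ennreal ((\<Sum>z\<in>Z n. f z) / real n))"
proof -
  define F where "F = (\<lambda>n x. \<Sum>z\<in>Z n. ennreal (f z / d) * indicator {x. cell c0 d n x = cell c0 d n (pos z)} x)"
  have "(\<integral>\<^sup>+x. ennreal (f (\<gamma> x) / d) * indicator I x \<partial>lborel) \<le> (\<integral>\<^sup>+x. liminf (\<lambda>n. F (Suc n) x) \<partial>lborel)"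
  proof (rule nn_integral_mono)
    fix x
    show "ennreal (f (\<gamma> x) / d) * indicator I x \<le> liminf (\<lambda>n. F (Suc n) x)"
    proof (cases "x \<in> I")
      case False then show ?thesis by simp
    next
      case True
      have "ennreal (f (\<gamma> x) / d) \<le> liminf (\<lambda>n. F (Suc n) x)"
        unfolding le_Liminf_iff
      proof (intro allI impI)
        fix y assume y: "y < ennreal (f (\<gamma> x) / d)"
        have "isCont (\<lambda>z. f z / d) (\<gamma> x)" using f(1) d
          by (intro continuous_intros) (auto simp: continuous_on_eq_continuous_at)
        then have "((\<lambda>z. ennreal (f z / d)) \<longlongrightarrow> ennreal (f (\<gamma> x) / d)) (at (\<gamma> x))"
          by (intro tendsto_ennrealI) (simp add: isCont_def)
        then have "\<forall>\<^sub>F z in at (\<gamma> x). y < ennreal (f z / d)" by (rule order_tendstoD(1)) (rule y)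
        then obtain e where e: "e > 0" "\<And>z. z \<noteq> \<gamma> x \<Longrightarrow> dist z (\<gamma> x) < e \<Longrightarrow> y < ennreal (f z / d)"
          unfolding eventually_at by blast
        have "\<forall>\<^sub>F n in sequentially. \<exists>z\<in>Z (Suc n). dist z (\<gamma> x) < e \<and> cell c0 d (Suc n) (pos z) = cell c0 d (Suc n) x"
          using approx[OF True e(1)] iffD2[OF eventually_sequentially_Suc[of "\<lambda>n. \<exists>z\<in>Z n. dist z (\<gamma> x) < e \<and> cell c0 d n (pos z) = cell c0 d n x"]]
          by blast
        then show "\<forall>\<^sub>F n in sequentially. y < F (Suc n) x"
        proof eventually_elim
          case (elim n)
          then obtain z where z: "z \<in> Z (Suc n)" "dist z (\<gamma> x) < e" "cell c0 d (Suc n) (pos z) = cell c0 d (Suc n) x" by blast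
          have "y < ennreal (f z / d)" using e(2)[of z] z(2) y by (cases "z = \<gamma> x") auto
          also have "\<dots> = ennreal (f z / d) * indicator {x. cell c0 d (Suc n) x = cell c0 d (Suc n) (pos z)} x"
            using z(3) by simp
          also have "\<dots> \<le> F (Suc n) x" unfolding F_def using z(1) fin
            by (intro member_le_sum) auto
          finally show ?case .
        qed
      qed
      then show ?thesis using True by simp
    qed
  qed
  also have "\<dots> \<le> liminf (\<lambda>n. \<integral>\<^sup>+x. F (Suc n) x \<partial>lborel)"
  proof (rule nn_integral_liminf)
    fix n show "F (Suc n) \<in> borel_measurable lborel"
      unfolding F_def using emeasure_cell(1)[OF d, of "Suc n"]
      by (intro borel_measurable_sum borel_measurable_times_ennreal borel_measurable_const borel_measurable_indicator) auto
  qed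
  also have "(\<lambda>n. \<integral>\<^sup>+x. F (Suc n) x \<partial>lborel) = (\<lambda>n. ennreal ((\<Sum>z\<in>Z (Suc n). f z) / real (Suc n)))"
  proof
    fix n
    have "(\<integral>\<^sup>+x. F (Suc n) x \<partial>lborel) = (\<Sum>z\<in>Z (Suc n). ennreal (f z / d) * ennreal (d / real (Suc n)))"
      unfolding F_def using emeasure_cell[OF d, of "Suc n"]
      by (subst nn_integral_sum)
        (auto intro!: borel_measurable_times_ennreal borel_measurable_const borel_measurable_indicator sum.cong
          simp: nn_integral_cmult_indicator simp del: of_nat_Suc)
    also have "\<dots> = (\<Sum>z\<in>Z (Suc n). ennreal (f z / real (Suc n)))"
    proof (rule sum.cong[OF refl])
      fix z
      have "ennreal (f z / d) * ennreal (d / real (Suc n)) = ennreal (f z / d * (d / real (Suc n)))"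
        using d f(2)[of z] by (intro ennreal_mult[symmetric]) auto
      then show "ennreal (f z / d) * ennreal (d / real (Suc n)) = ennreal (f z / real (Suc n))" using d by simp
    qed
    also have "\<dots> = ennreal ((\<Sum>z\<in>Z (Suc n). f z) / real (Suc n))"
      using f(2) by (subst sum_ennreal) (auto simp: sum_divide_distrib simp del: of_nat_Suc)
    finally show "(\<integral>\<^sup>+x. F (Suc n) x \<partial>lborel) = ennreal ((\<Sum>z\<in>Z (Suc n). f z) / real (Suc n))" .
  qed
  also have "liminf (\<lambda>n. ennreal ((\<Sum>z\<in>Z (Suc n). f z) / real (Suc n))) = liminf (\<lambda>n. ennreal ((\<Sum>z\<in>Z n. f z) / real n))"
    using liminf_shift[of "\<lambda>n. ennreal ((\<Sum>z\<in>Z n. f z) / real n)"] by simp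
  finally show ?thesis .
qed

text \<open>The zeros are given as images \<open>\<Phi>(y)\<close> of the solutions of \<open>n y = c0 + k d + E(y)\<close>.  As \<open>E\<close> is small,
  Brouwer's theorem gives a solution next to each lattice point \<open>(c0 + k d)/n\<close>, and the real part of
  the solution lies in the cell \<open>k\<close>.  Injectivity of \<open>\<Phi>\<close> makes the cell a function of the zero.\<close>
lemma zeros_along_curve:
  fixes \<Phi> :: "complex \<Rightarrow> complex" and E :: "nat \<Rightarrow> int \<Rightarrow> complex \<Rightarrow> complex" and f :: "complex \<Rightarrow> real"
  assumes d: "d > 0" and fin: "\<And>n. finite (Z n)" and inj: "inj_on \<Phi> S"
    and cont: "\<And>x. x \<in> I \<Longrightarrow> isCont \<Phi> (of_real x)"
    and loc: "\<And>x. x \<in> I \<Longrightarrow> \<exists>\<delta>>0. cball (of_real x) \<delta> \<subseteq> S \<and>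
        (\<forall>r>0. \<forall>\<^sub>F n in sequentially. \<forall>k. continuous_on (cball (of_real x) \<delta>) (E n k) \<and>
           (\<forall>y\<in>cball (of_real x) \<delta>. norm (E n k y) \<le> r \<and>
             (of_nat n * y = of_real (c0 + of_int k * d) + E n k y \<longrightarrow> \<Phi> y \<in> Z n)))"
    and f: "continuous_on UNIV f" "\<And>z. 0 \<le> f z"
  shows "(\<integral>\<^sup>+x. ennreal (f (\<Phi> (of_real x)) / d) * indicator I x \<partial>lborel)
     \<le> liminf (\<lambda>n. ennreal ((\<Sum>z\<in>Z n. f z) / real n))"
proof (rule counting_liminf[where pos = "\<lambda>z. Re (inv_into S \<Phi> z)" and ?c0.0 = c0, OF d fin _ f])
  fix x e :: real assume x: "x \<in> I" and e: "e > 0"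
  obtain \<delta> where \<delta>: "\<delta> > 0" "cball (of_real x) \<delta> \<subseteq> S" and ev: "\<And>r. r > 0 \<Longrightarrow> \<forall>\<^sub>F n in sequentially.
        \<forall>k. continuous_on (cball (of_real x) \<delta>) (E n k) \<and>
           (\<forall>y\<in>cball (of_real x) \<delta>. norm (E n k y) \<le> r \<and>
             (of_nat n * y = of_real (c0 + of_int k * d) + E n k y \<longrightarrow> \<Phi> y \<in> Z n))"
    using loc[OF x] by auto
  obtain \<eta>0 where \<eta>0: "\<eta>0 > 0" "\<And>y. dist y (of_real x) < \<eta>0 \<Longrightarrow> dist (\<Phi> y) (\<Phi> (of_real x)) < e"
    using cont[OF x] e unfolding continuous_at_eps_delta by blast
  define \<eta> where "\<eta> = min \<eta>0 \<delta>"
  have \<eta>: "\<eta> > 0" "\<eta> \<le> \<eta>0" "\<eta> \<le> \<delta>" using \<eta>0 \<delta> by (auto simp: \<eta>_def)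
  have d4: "d / 4 > 0" using d by simp
  have large: "\<forall>\<^sub>F n in sequentially. d / \<eta> < real n"
    using filterlim_real_sequentially by (simp add: filterlim_at_top_dense)
  show "\<forall>\<^sub>F n in sequentially. \<exists>z\<in>Z n. dist z (\<Phi> (of_real x)) < e \<and>
      cell c0 d n (Re (inv_into S \<Phi> z)) = cell c0 d n x"
    using large ev[OF d4] eventually_ge_at_top[of 1]
  proof eventually_elim
    case (elim n)
    define k where "k = cell c0 d n x"
    define c where "c = c0 + of_int k * d"
    have n0: "real n > 0" using elim by simp
    have dn: "d / real n < \<eta>" using elim(1) n0 \<eta>(1) by (simp add: field_simps)
    have near: "dist y (of_real x) < \<eta>" if "y \<in> cball (of_real c / of_nat n) ((d / 4) / real n)" for y :: complex
    proof -
      have "\<bar>real n * x - c\<bar> \<le> d / 2" unfolding c_def k_def by (rule cell_bounds[OF d])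
      then have "\<bar>real n * x - c\<bar> / real n \<le> (d / 2) / real n" using n0 by (intro divide_right_mono) auto
      moreover have "\<bar>c / real n - x\<bar> = \<bar>real n * x - c\<bar> / real n"
      proof -
        have "c / real n - x = (c - real n * x) / real n" using n0 by (simp add: diff_divide_distrib)
        then show ?thesis using n0 by (simp add: abs_divide abs_minus_commute)
      qed
      ultimately have "\<bar>c / real n - x\<bar> \<le> (d / 2) / real n" by simp
      moreover have "dist (of_real c / of_nat n :: complex) (of_real x) = \<bar>c / real n - x\<bar>"
      proof -
        have "of_real c / of_nat n - of_real x = (of_real (c / real n - x) :: complex)" by simp
        then show ?thesis unfolding dist_norm by (simp only: norm_of_real)
      qed
      moreover have "dist y (of_real x) \<le> dist (of_real c / of_nat n) y + dist (of_real c / of_nat n :: complex) (of_real x)"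
        by (rule dist_triangle3)
      ultimately have "dist y (of_real x) \<le> d / 4 / real n + d / 2 / real n" using that by simp
      also have "\<dots> = 3 / 4 * (d / real n)" by simp
      also have "\<dots> < \<eta>" using dn divide_pos_pos[OF d n0] by linarith
      finally show ?thesis .
    qed
    have sub: "cball (of_real c / of_nat n :: complex) ((d / 4) / real n) \<subseteq> cball (of_real x) \<delta>"
    proof
      fix y :: complex assume "y \<in> cball (of_real c / of_nat n) ((d / 4) / real n)"
      from near[OF this] show "y \<in> cball (of_real x) \<delta>" using \<eta>(3) by (simp add: dist_commute)
    qed
    have Ek: "continuous_on (cball (of_real x) \<delta>) (E n k)"
      "\<And>y. y \<in> cball (of_real x) \<delta> \<Longrightarrow> norm (E n k y) \<le> d / 4"
      "\<And>y. y \<in> cball (of_real x) \<delta> \<Longrightarrow> of_nat n * y = of_real c + E n k y \<Longrightarrow> \<Phi> y \<in> Z n"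
      using elim(2) unfolding c_def by blast+
    obtain y where y: "y \<in> cball (of_real c / of_nat n) ((d / 4) / real n)" "of_nat n * y = of_real c + E n k y"
    proof (rule perturbed_fixed_point[of n "d / 4" "of_real c" "E n k"])
      show "norm (E n k y) \<le> d / 4" if "y \<in> cball (of_real c / of_nat n) (d / 4 / real n)" for y
        using Ek(2) sub that by blast
    qed (use elim d continuous_on_subset[OF Ek(1) sub] in auto)
    have yb: "y \<in> cball (of_real x) \<delta>" using y(1) sub by blast
    then have "y \<in> S" using \<delta>(2) by blast
    then have inv: "inv_into S \<Phi> (\<Phi> y) = y" by (rule inv_into_f_f[OF inj])
    have "real n * Re y - c = Re (E n k y)" using arg_cong[OF y(2), of Re] by simp
    moreover have "\<bar>Re (E n k y)\<bar> \<le> d / 4" using abs_Re_le_cmod Ek(2)[OF yb] order_trans by blast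
    ultimately have "\<bar>real n * Re y - (c0 + of_int k * d)\<bar> < d / 2" using d unfolding c_def by linarith
    then have "cell c0 d n (Re y) = k" by (rule cell_eqI[OF d])
    moreover have "dist (\<Phi> y) (\<Phi> (of_real x)) < e" using near[OF y(1)] \<eta>(2) \<eta>0(2) by simp
    ultimately show ?case using Ek(3)[OF yb y(2)] inv k_def by (intro bexI[of _ "\<Phi> y"]) auto
  qed
qed

section \<open>Weak convergence from lower bounds\<close>

text \<open>For \<open>|f| \<le> B\<close> the lower bounds are applied to \<open>B + f\<close> and to \<open>B - f\<close>; the bounds on the masses
  turn the second into an upper bound for the integrals of \<open>f\<close>.\<close>
lemma weak_star_limit_of_lower_bounds:
  fixes M :: "nat \<Rightarrow> complex measure" and N :: "complex measure"
  assumes sets: "\<And>n. sets (M n) = sets borel" "sets N = sets borel"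
    and mass: "\<forall>\<^sub>F n in sequentially. emeasure (M n) UNIV \<le> 1" and massN: "emeasure N UNIV \<ge> 1"
    and lower: "\<And>f :: complex \<Rightarrow> real. continuous_on UNIV f \<Longrightarrow> (\<And>z. 0 \<le> f z) \<Longrightarrow> bounded (range f) \<Longrightarrow>
       (\<integral>\<^sup>+z. ennreal (f z) \<partial>N) \<le> liminf (\<lambda>n. \<integral>\<^sup>+z. ennreal (f z) \<partial>M n)"
  shows "weak_star_limit M N"
proof -
  have space: "space (M n) = UNIV" "space N = UNIV" for n
    using sets_eq_imp_space_eq[OF sets(1)[of n]] sets_eq_imp_space_eq[OF sets(2)] by simp_all
  have N1: "emeasure N UNIV = 1"
  proof -
    have "(\<integral>\<^sup>+z. ennreal 1 \<partial>N) \<le> liminf (\<lambda>n. \<integral>\<^sup>+z. ennreal 1 \<partial>M n)"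
    proof (rule lower)
      show "bounded (range (\<lambda>z::complex. 1 :: real))" by (rule bounded_subset[of "{1}"]) auto
    qed auto
    also have "\<dots> \<le> liminf (\<lambda>n. 1)"
      using mass by (intro Liminf_mono) (auto simp: space elim: eventually_mono)
    finally have "emeasure N UNIV \<le> 1" by (simp add: space Liminf_const)
    then show ?thesis using massN by simp
  qed
  have finN: "finite_measure N" using N1 by (intro finite_measureI) (simp add: space)
  have meas: "f \<in> borel_measurable (M n)" "f \<in> borel_measurable N"
    if "continuous_on UNIV f" for f :: "complex \<Rightarrow> real" and n
    using borel_measurable_continuous_onI[OF that] sets by (simp_all cong: measurable_cong_sets)
  have one: "\<forall>\<^sub>F n in sequentially. integral\<^sup>L N f - e < integral\<^sup>L (M n) f"
    if f: "continuous_on UNIV f" "\<And>z. 0 \<le> f z" "\<And>z. f z \<le> B" and e: "e > 0" for f :: "complex \<Rightarrow> real" and e B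
  proof -
    have intN: "integrable N f"
      by (rule finite_measure.integrable_const_bound[OF finN, of _ B]) (use f meas in auto)
    have bdd: "bounded (range f)" using f(2,3) by (auto simp: bounded_iff intro!: exI[of _ B] abs_leI order_trans[OF _ f(2)])
    have nnN: "(\<integral>\<^sup>+z. ennreal (f z) \<partial>N) = ennreal (integral\<^sup>L N f)"
      by (rule nn_integral_eq_integral[OF intN]) (use f in auto)
    show ?thesis
    proof (cases "integral\<^sup>L N f - e < 0")
      case True
      have "0 \<le> integral\<^sup>L (M n) f" for n using f(2) by simp
      from less_le_trans[OF True this] show ?thesis by (intro always_eventually allI)
    next
      case False
      then have "ennreal (integral\<^sup>L N f - e) < ennreal (integral\<^sup>L N f)" using e by (intro ennreal_lessI) auto
      also have "\<dots> \<le> liminf (\<lambda>n. \<integral>\<^sup>+z. ennreal (f z) \<partial>M n)" using lower[OF f(1,2) bdd] nnN by simp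
      finally have "\<forall>\<^sub>F n in sequentially. ennreal (integral\<^sup>L N f - e) < (\<integral>\<^sup>+z. ennreal (f z) \<partial>M n)"
        by (rule less_LiminfD)
      then show ?thesis using mass
      proof eventually_elim
        case (elim n)
        have "finite_measure (M n)" using elim(2) by (intro finite_measureI) (auto simp: space top_unique)
        then have "integrable (M n) f"
          by (rule finite_measure.integrable_const_bound[of _ _ B]) (use f meas in auto)
        then have "(\<integral>\<^sup>+z. ennreal (f z) \<partial>M n) = ennreal (integral\<^sup>L (M n) f)"
          by (rule nn_integral_eq_integral) (use f in auto)
        with elim(1) show ?case using False by (simp add: ennreal_less_iff)
      qed
    qed
  qed
  show ?thesis unfolding weak_star_limit_def
  proof (intro allI impI)
    fix f :: "complex \<Rightarrow> real" assume f: "continuous_on UNIV f \<and> bounded (range f)"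
    then obtain B where B: "\<And>z. \<bar>f z\<bar> \<le> B" "B > 0" unfolding bounded_pos by auto
    have fb: "- B \<le> f z" "f z \<le> B" for z using B(1)[of z] by auto
    show "(\<lambda>n. integral\<^sup>L (M n) f) \<longlonglongrightarrow> integral\<^sup>L N f"
      unfolding tendsto_iff
    proof (intro allI impI)
      fix e :: real assume e: "e > 0"
      have cp: "continuous_on UNIV (\<lambda>z. B + f z)" "continuous_on UNIV (\<lambda>z. B - f z)"
        using f by (auto intro!: continuous_intros)
      have "\<forall>\<^sub>F n in sequentially. integral\<^sup>L N (\<lambda>z. B + f z) - e < integral\<^sup>L (M n) (\<lambda>z. B + f z)"
        using one[OF cp(1) _ _ e, of "2 * B"] fb by (smt (verit))
      moreover have "\<forall>\<^sub>F n in sequentially. integral\<^sup>L N (\<lambda>z. B - f z) - e < integral\<^sup>L (M n) (\<lambda>z. B - f z)"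
        using one[OF cp(2) _ _ e, of "2 * B"] fb by (smt (verit))
      moreover note mass
      ultimately show "\<forall>\<^sub>F n in sequentially. dist (integral\<^sup>L (M n) f) (integral\<^sup>L N f) < e"
      proof eventually_elim
        case (elim n)
        have fin: "finite_measure (M n)" using elim(3) by (intro finite_measureI) (auto simp: space top_unique)
        have i: "integrable (M n) f" "integrable N f"
          using finite_measure.integrable_const_bound[OF fin, of f B]
            finite_measure.integrable_const_bound[OF finN, of f B] meas f B(1) by auto
        have c: "integrable (M n) (\<lambda>_. B)" "integrable N (\<lambda>_. B)"
          using finite_measure.integrable_const[OF fin] finite_measure.integrable_const[OF finN] by auto
        have mN: "measure N UNIV = 1" using N1 by (simp add: measure_def)
        have mM: "measure (M n) UNIV \<le> 1"
          using elim(3) by (simp add: measure_def) (metis enn2real_leI ennreal_1 zero_le_one)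
        have "integral\<^sup>L N (\<lambda>z. B + f z) = B + integral\<^sup>L N f" "integral\<^sup>L N (\<lambda>z. B - f z) = B - integral\<^sup>L N f"
          using i c mN by (simp_all add: space)
        moreover have "integral\<^sup>L (M n) (\<lambda>z. B + f z) = measure (M n) UNIV * B + integral\<^sup>L (M n) f"
          "integral\<^sup>L (M n) (\<lambda>z. B - f z) = measure (M n) UNIV * B - integral\<^sup>L (M n) f"
          using i c by (simp_all add: space)
        moreover have "measure (M n) UNIV * B \<le> 1 * B" using mM B(2) by (intro mult_right_mono) auto
        ultimately show ?case using elim(1,2) by (simp add: dist_real_def)
      qed
    qed
  qed
qed

context airfoil
begin
section \<open>The zeros near the arc and near the loop\<close>

definition zero_set :: "nat \<Rightarrow> complex set" where
  "zero_set n = {z. \<forall>p q. root_pair b z p q \<longrightarrow> p ^ n + q ^ n = 1}"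

lemma zero_setI:
  assumes "root_pair b z p q" "p ^ n + q ^ n = 1"
  shows "z \<in> zero_set n"
  unfolding zero_set_def
proof (intro CollectI allI impI)
  fix p' q' assume "root_pair b z p' q'"
  from root_pair_unique[OF assms(1) this] show "p' ^ n + q' ^ n = 1" using assms(2) by (auto simp: add.commute)
qed

text \<open>The zeros of the two kinds are told apart by \<open>|pq| = |V(z)/b\<^sup>2|\<close>: near inner points of the subarc both roots
  have modulus greater than one; near the loop, away from \<open>i\<^sub>b\<close>, one root is close to the unit circle and
  the other is inside.\<close>
definition arc_zeros :: "nat \<Rightarrow> complex set" where
  "arc_zeros n = {z \<in> zero_set n. (norm b)\<^sup>2 < norm (airfoil_V b z)}"

definition loop_zeros :: "nat \<Rightarrow> complex set" where
  "loop_zeros n = {z \<in> zero_set n. norm (airfoil_V b z) < (norm b)\<^sup>2}"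

lemma eventually_small_perturbation:
  fixes g :: "complex \<Rightarrow> complex"
  assumes cont: "isCont g 0" and g0: "g 0 = 0" and \<rho>: "0 \<le> \<rho>" "\<rho> < 1" and r: "r > 0"
  shows "\<forall>\<^sub>F n in sequentially. \<forall>w. norm w \<le> \<rho> ^ n \<longrightarrow> norm (g w) \<le> r"
proof -
  obtain e where e: "e > 0" "\<And>w. dist w 0 < e \<Longrightarrow> dist (g w) (g 0) < r"
    using cont r unfolding continuous_at_eps_delta by blast
  have "\<forall>\<^sub>F n in sequentially. \<rho> ^ n < e"
    using \<rho> e(1) by (intro order_tendstoD(2)[OF LIMSEQ_power_zero]) auto
  then show ?thesis
  proof eventually_elim
    case (elim n)
    show ?case
    proof (intro allI impI)
      fix w :: complex assume "norm w \<le> \<rho> ^ n"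
      then have "dist w 0 < e" using elim by simp
      from e(2)[OF this] show "norm (g w) \<le> r" using g0 by simp
    qed
  qed
qed

lemma inj_on_arc_cos: "inj_on (\<lambda>y. arc_point (cos y)) {y. - pi < Re y \<and> Re y < 0 \<and> cos y \<in> arc_domain}"
proof (rule inj_onI)
  fix x y assume x: "x \<in> {y. - pi < Re y \<and> Re y < 0 \<and> cos y \<in> arc_domain}"
    and y: "y \<in> {y. - pi < Re y \<and> Re y < 0 \<and> cos y \<in> arc_domain}" and eq: "arc_point (cos x) = arc_point (cos y)"
  have "cos x = cos y" using inj_onD[OF inj_on_arc_point eq] x y by simp
  then obtain n where n: "n \<in> \<int>" "x = y + of_real (2 * n * pi) \<or> x = - y + of_real (2 * n * pi)"
    unfolding complex_cos_eq by blast
  obtain m :: int where m: "n = of_int m" using n(1) by (rule Ints_cases)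
  from n(2) show "x = y"
  proof
    assume a: "x = y + of_real (2 * n * pi)"
    then have "Re x - Re y = 2 * of_int m * pi" by (simp add: m)
    then have "\<bar>2 * of_int m * pi\<bar> < pi" using x y by auto
    then have "\<bar>2 * of_int m\<bar> * pi < 1 * pi" by (simp add: abs_mult)
    then have "\<bar>2 * real_of_int m\<bar> < 1" by (metis mult_less_cancel_right_pos pi_gt_zero)
    then have "m = 0" by linarith
    then show ?thesis using a m by simp
  next
    assume a: "x = - y + of_real (2 * n * pi)"
    then have s: "Re x + Re y = 2 * of_int m * pi" by (simp add: m)
    have "- pi < Re x" "Re x < 0" "- pi < Re y" "Re y < 0" using x y by auto
    then have "2 * of_int m * pi < 0" "- 2 * pi < 2 * of_int m * pi" using s by linarith+
    then have "of_int (2 * m) * pi < 0 * pi" "(- 2) * pi < of_int (2 * m) * pi" by simp_all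
    then have "of_int (2 * m) < (0 :: real)" "- 2 < real_of_int (2 * m)"
      by (metis mult_less_cancel_right_pos pi_gt_zero)+
    then have "real_of_int m < real_of_int 0" "real_of_int (- 1) < real_of_int m" by simp_all
    then have "m < 0" "- 1 < m" by (simp_all only: of_int_less_iff)
    then show ?thesis by simp
  qed
qed

lemma open_obtains_cball:
  fixes x :: complex
  assumes "open S" "x \<in> S"
  obtains \<delta> where "\<delta> > 0" "cball x \<delta> \<subseteq> S"
  using assms open_contains_cball by blast

lemma cos_half_shift:
  fixes E :: complex and k :: int
  shows "cos (of_real (pi / 2 + of_int k * pi) + E) = - (if even k then 1 else - 1) * sin E"
proof -
  have c: "cos (pi / 2 + of_int k * pi) = 0" by (simp add: cos_add mult.commute)
  have s: "sin (pi / 2 + of_int k * pi) = (if even k then 1 else - 1)" by (simp add: sin_add mult.commute)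
  have "cos (of_real (pi / 2 + of_int k * pi) + E) =
     of_real (cos (pi / 2 + of_int k * pi)) * cos E - of_real (sin (pi / 2 + of_int k * pi)) * sin E"
    by (simp only: cos_add cos_of_real sin_of_real)
  then show ?thesis unfolding c s by simp
qed

text \<open>At \<open>z = arc_point (cos y)\<close> the equation \<open>p\<^sup>n + q\<^sup>n = 1\<close> is \<open>cos (n y) = \<epsilon>\<^sub>n(y)\<close> with
  \<open>\<epsilon>\<^sub>n = (-b/v)\<^sup>n / 2\<close>, which is solved by \<open>n y = \<pi>/2 + k \<pi> + Arcsin (\<minusplus> \<epsilon>\<^sub>n(y))\<close>.  The angles are taken negative
  because the cosine is increasing there, as the substitution in the arcsine integral requires.\<close>
lemma arc_zeros_liminf:
  fixes f :: "complex \<Rightarrow> real"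
  assumes fin: "\<And>n. finite (zero_set n)" and f: "continuous_on UNIV f" "\<And>z. 0 \<le> f z"
  shows "(\<integral>\<^sup>+x. ennreal (f (arc_at (cos x)) / pi) * indicator {- corner_angle<..<0} x \<partial>lborel)
    \<le> liminf (\<lambda>n. ennreal ((\<Sum>z\<in>arc_zeros n. f z) / real n))"
proof -
  define S where "S = {y. - pi < Re y \<and> Re y < 0 \<and> cos y \<in> arc_domain}"
  define \<epsilon> where "\<epsilon> = (\<lambda>n y. (1 / 2) * (- b / arc_v (cos y)) ^ n)"
  define E where "E = (\<lambda>n (k::int) y. Arcsin (- (if even k then 1 else - 1) * \<epsilon> n y))"
  have oS: "open S"
  proof -
    have "open {y :: complex. - pi < Re y}" "open {y :: complex. Re y < 0}"
      by (auto intro!: open_Collect_less continuous_intros)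
    moreover have "open (cos -` arc_domain :: complex set)"
      by (intro open_vimage open_arc_domain continuous_intros)
    moreover have "S = {y. - pi < Re y} \<inter> {y. Re y < 0} \<inter> cos -` arc_domain" by (auto simp: S_def)
    ultimately show ?thesis by (auto intro!: open_Int)
  qed
  have contv: "continuous_on S (\<lambda>y. arc_v (cos y))"
    by (rule continuous_on_compose2[OF holomorphic_on_imp_continuous_on[OF holomorphic_arc(2)]])
      (auto simp: S_def intro!: continuous_intros)
  have contp: "continuous_on S (\<lambda>y. arc_point (cos y))"
    by (rule continuous_on_compose2[OF holomorphic_on_imp_continuous_on[OF holomorphic_arc(3)]])
      (auto simp: S_def intro!: continuous_intros)
  have xS: "of_real x \<in> S" if "x \<in> {- corner_angle<..<0}" for x
    using that corner_angle real_in_arc_domain[of "cos x"] by (auto simp: S_def cos_of_real)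
  have "(\<integral>\<^sup>+x. ennreal (f (arc_point (cos (of_real x))) / pi) * indicator {- corner_angle<..<0} x \<partial>lborel)
    \<le> liminf (\<lambda>n. ennreal ((\<Sum>z\<in>arc_zeros n. f z) / real n))"
  proof (rule zeros_along_curve[where \<Phi> = "\<lambda>y. arc_point (cos y)" and S = S and E = E and ?c0.0 = "pi / 2", OF _ _ _ _ _ f])
    show "finite (arc_zeros n)" for n using fin[of n] by (simp add: arc_zeros_def)
    show "inj_on (\<lambda>y. arc_point (cos y)) S" unfolding S_def by (rule inj_on_arc_cos)
    fix x :: real assume x: "x \<in> {- corner_angle<..<0}"
    show "isCont (\<lambda>y. arc_point (cos y)) (of_real x)"
      using contp oS xS[OF x] by (simp add: continuous_on_eq_continuous_at)
    have "cos (- x) > cos corner_angle"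
      using x corner_angle by (intro cos_monotone_0_pi) auto
    then have "norm b < norm (v_at (cos x))"
      using norm_arc_v_gt[of "cos x"] corner_angle(3) by simp
    then have lt: "norm (- b / arc_v (cos (of_real x))) < 1"
      using arc_v_nz[of "of_real (cos x)"] by (simp add: norm_divide cos_of_real)
    obtain \<rho> where \<rho>: "norm (- b / arc_v (cos (of_real x))) < \<rho>" "\<rho> < 1" using dense[OF lt] by blast
    have \<rho>0: "0 \<le> \<rho>" by (rule order_trans[OF norm_ge_zero less_imp_le[OF \<rho>(1)]])
    define O' where "O' = S \<inter> (\<lambda>y. norm (- b / arc_v (cos y))) -` {..<\<rho>}"
    have "open O'" unfolding O'_def
      by (intro continuous_open_preimage oS continuous_intros contv) (auto simp: arc_v_nz)
    moreover have "of_real x \<in> O'" using xS[OF x] \<rho>(1) by (simp add: O'_def)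
    ultimately obtain \<delta> where \<delta>: "\<delta> > 0" "cball (of_real x) \<delta> \<subseteq> O'" using open_obtains_cball by blast
    have eps: "norm (\<epsilon> n y) \<le> \<rho> ^ n / 2" if "y \<in> cball (of_real x) \<delta>" for n y
    proof -
      have "norm (- b / arc_v (cos y)) \<le> \<rho>" using that \<delta>(2) by (auto simp: O'_def)
      then have "norm (- b / arc_v (cos y)) ^ n \<le> \<rho> ^ n" by (intro power_mono) auto
      then show ?thesis by (simp add: \<epsilon>_def norm_mult norm_power)
    qed
    have ev: "\<forall>\<^sub>F n in sequentially. \<forall>k. continuous_on (cball (of_real x) \<delta>) (E n k) \<and>
           (\<forall>y\<in>cball (of_real x) \<delta>. norm (E n k y) \<le> r \<and>
             (of_nat n * y = of_real (pi / 2 + of_int k * pi) + E n k y \<longrightarrow> arc_point (cos y) \<in> arc_zeros n))"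
      if r: "r > 0" for r
    proof -
      have "isCont Arcsin 0" by (rule isCont_Arcsin) simp
      from eventually_small_perturbation[OF this Arcsin_0 \<rho>0 \<rho>(2) r]
      show ?thesis
      proof eventually_elim
        case (elim n)
        show ?case
        proof (intro allI conjI ballI impI)
          fix k :: int
          have half: "norm (- (if even k then 1 else - 1) * \<epsilon> n y) \<le> \<rho> ^ n / 2" if "y \<in> cball (of_real x) \<delta>" for y
            using eps[OF that, of n] by (simp add: norm_mult)
          have \<rho>n: "0 \<le> \<rho> ^ n" "\<rho> ^ n \<le> 1" using \<rho> \<rho>0 by (auto intro: power_le_one)
          show "continuous_on (cball (of_real x) \<delta>) (E n k)"
            unfolding E_def
          proof (rule continuous_on_compose2[of "ball 0 1" Arcsin])
            show "continuous_on (ball 0 1) Arcsin"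
            proof (intro continuous_at_imp_continuous_on ballI isCont_Arcsin)
              fix z :: complex assume "z \<in> ball 0 1" then show "\<bar>Re z\<bar> < 1"
                using abs_Re_le_cmod[of z] by simp
            qed
            show "continuous_on (cball (of_real x) \<delta>) (\<lambda>y. - (if even k then 1 else - 1) * \<epsilon> n y)"
              unfolding \<epsilon>_def using \<delta>(2)
              by (intro continuous_intros continuous_on_subset[OF contv]) (auto simp: O'_def arc_v_nz)
            show "(\<lambda>y. - (if even k then 1 else - 1) * \<epsilon> n y) ` cball (of_real x) \<delta> \<subseteq> ball 0 1"
            proof
              fix w assume "w \<in> (\<lambda>y. - (if even k then 1 else - 1) * \<epsilon> n y) ` cball (of_real x) \<delta>"
              then obtain y where "y \<in> cball (of_real x) \<delta>" "w = - (if even k then 1 else - 1) * \<epsilon> n y" by blast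
              then have "norm w \<le> \<rho> ^ n / 2" using half by simp
              then show "w \<in> ball 0 1" using \<rho>n by simp
            qed
          qed
          fix y :: complex assume y: "y \<in> cball (of_real x) \<delta>"
          show "norm (E n k y) \<le> r" unfolding E_def
            by (rule elim[rule_format], rule order_trans[OF half[OF y]]) (use \<rho>n in simp)
          assume eq: "of_nat n * y = of_real (pi / 2 + of_int k * pi) + E n k y"
          have "cos (of_nat n * y) = - (if even k then 1 else - 1) * (- (if even k then 1 else - 1) * \<epsilon> n y)"
            unfolding eq cos_half_shift E_def sin_Arcsin ..
          then have cosn: "cos (of_nat n * y) = \<epsilon> n y" by (simp split: if_splits)
          define X where "X = exp (\<i> * y)"
          have X0: "X \<noteq> 0" by (simp add: X_def)
          have Xi: "1 / X = exp (- (\<i> * y))" by (simp add: X_def exp_minus inverse_eq_divide)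
          have cosy: "cos y = (X + 1 / X) / 2" unfolding Xi unfolding X_def by (rule cos_exp_eq)
          have Xn: "X ^ n + (1 / X) ^ n = 2 * cos (of_nat n * y)"
            unfolding Xi unfolding X_def cos_exp_eq exp_of_nat_mult[symmetric] by (simp add: algebra_simps)
          define v where "v = arc_v (cos y)"
          have v0: "v \<noteq> 0" by (simp add: v_def arc_v_nz)
          note pair = root_pair_arc_point[OF X0 cosy, folded v_def]
          have "(- (v / b) * X) ^ n + (- (v / b) / X) ^ n = (- (v / b)) ^ n * (X ^ n + (1 / X) ^ n)"
            by (simp add: power_mult_distrib[symmetric] distrib_left)
          also have "\<dots> = (- (v / b)) ^ n * (- b / v) ^ n" unfolding Xn cosn by (simp add: \<epsilon>_def v_def)
          also have "\<dots> = 1" using v0 b_nz by (simp add: power_mult_distrib[symmetric])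
          finally have "arc_point (cos y) \<in> zero_set n" by (rule zero_setI[OF pair])
          moreover have "(norm b)\<^sup>2 < norm (airfoil_V b (arc_point (cos y)))"
          proof -
            have "norm (- b / v) < 1" using y \<delta>(2) \<rho>(2) by (force simp: O'_def v_def)
            then have "norm b < norm v" using v0 by (simp add: norm_divide)
            then show ?thesis unfolding V_arc_point norm_power v_def[symmetric] by (intro power_strict_mono) auto
          qed
          ultimately show "arc_point (cos y) \<in> arc_zeros n" by (simp add: arc_zeros_def)
        qed
      qed
    qed
    show "\<exists>\<delta>>0. cball (of_real x) \<delta> \<subseteq> S \<and>
        (\<forall>r>0. \<forall>\<^sub>F n in sequentially. \<forall>k. continuous_on (cball (of_real x) \<delta>) (E n k) \<and>
           (\<forall>y\<in>cball (of_real x) \<delta>. norm (E n k y) \<le> r \<and>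
             (of_nat n * y = of_real (pi / 2 + of_int k * pi) + E n k y \<longrightarrow> arc_point (cos y) \<in> arc_zeros n)))"
      using \<delta> ev by (intro exI[of _ \<delta>]) (auto simp: O'_def)
  qed simp
  then show ?thesis by (simp add: cos_of_real)
qed

abbreviation loop_parameters :: "real set" where
  "loop_parameters \<equiv> {x. 0 < x \<and> x < 2 * pi \<and> 1 / 2 < Re (b\<^sup>2 * (1 - cis x))}"

text \<open>At \<open>z = loop_point (e\<^sup>i\<^sup>y)\<close> the equation \<open>p\<^sup>n + q\<^sup>n = 1\<close> is \<open>e\<^sup>i\<^sup>n\<^sup>y = 1 - q\<^sup>n\<close>, which is solved by
  \<open>n y = 2 \<pi> k - \<i> Ln (1 - q\<^sup>n)\<close>.\<close>
lemma loop_zeros_liminf: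
  fixes f :: "complex \<Rightarrow> real"
  assumes fin: "\<And>n. finite (zero_set n)" and f: "continuous_on UNIV f" "\<And>z. 0 \<le> f z"
  shows "(\<integral>\<^sup>+x. ennreal (f (loop_point (cis x)) / (2 * pi)) *
        indicator loop_parameters x \<partial>lborel)
    \<le> liminf (\<lambda>n. ennreal ((\<Sum>z\<in>loop_zeros n. f z) / real n))"
proof -
  define T where "T = {y. 0 < Re y \<and> Re y < 2 * pi \<and> exp (\<i> * y) \<noteq> 1}"
  define S where "S = {y \<in> T. norm (partner (exp (\<i> * y))) < norm (exp (\<i> * y))}"
  define E where "E = (\<lambda>n (k::int) y. - \<i> * Ln (1 - (partner (exp (\<i> * y))) ^ n))"
  define I where "I = loop_parameters"
  have oT: "open T"
  proof -
    have "open {y :: complex. 0 < Re y}" "open {y :: complex. Re y < 2 * pi}" "open {y. exp (\<i> * y) \<noteq> 1}"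
      by (auto intro!: open_Collect_less open_Collect_neq continuous_intros)
    moreover have "T = {y. 0 < Re y} \<inter> {y. Re y < 2 * pi} \<inter> {y. exp (\<i> * y) \<noteq> 1}" by (auto simp: T_def)
    ultimately show ?thesis by (auto intro!: open_Int)
  qed
  have contq: "continuous_on T (\<lambda>y. partner (exp (\<i> * y)))"
    unfolding partner_def using b_nz by (intro continuous_intros) (auto simp: T_def)
  have contp: "continuous_on T (\<lambda>y. loop_point (exp (\<i> * y)))"
    unfolding loop_point_def joukowski_def using b_nz by (intro continuous_intros) (auto simp: T_def)
  have inI: "of_real x \<in> T \<and> norm (partner (exp (\<i> * of_real x))) < 1 \<and> norm (exp (\<i> * of_real x)) = 1"
    if "x \<in> I" for x
  proof -
    have e: "exp (\<i> * of_real x) = cis x" by (simp add: cis_conv_exp)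
    have side: "1 / 2 < Re (b\<^sup>2 * (1 - cis x))" using that by (simp only: I_def mem_Collect_eq)
    have "cis x \<noteq> 1"
    proof
      assume "cis x = 1"
      from side[unfolded this] show False by simp
    qed
    moreover from norm_partner(1)[OF this] have "norm (partner (cis x)) < 1" using side by simp
    ultimately show ?thesis using that unfolding e by (simp add: T_def I_def e)
  qed
  have "(\<integral>\<^sup>+x. ennreal (f (loop_point (exp (\<i> * of_real x))) / (2 * pi)) * indicator I x \<partial>lborel)
    \<le> liminf (\<lambda>n. ennreal ((\<Sum>z\<in>loop_zeros n. f z) / real n))"
  proof (rule zeros_along_curve[where \<Phi> = "\<lambda>y. loop_point (exp (\<i> * y))" and S = S and E = E and ?c0.0 = 0, OF _ _ _ _ _ f])
    show "finite (loop_zeros n)" for n using fin[of n] by (simp add: loop_zeros_def)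
    show "inj_on (\<lambda>y. loop_point (exp (\<i> * y))) S"
    proof (rule inj_onI)
      fix x y assume x: "x \<in> S" and y: "y \<in> S" and eq: "loop_point (exp (\<i> * x)) = loop_point (exp (\<i> * y))"
      have px: "root_pair b (loop_point (exp (\<i> * x))) (exp (\<i> * x)) (partner (exp (\<i> * x)))"
        by (rule root_pair_loop_point) (use x in \<open>simp add: S_def T_def\<close>)
      have py: "root_pair b (loop_point (exp (\<i> * x))) (exp (\<i> * y)) (partner (exp (\<i> * y)))"
        unfolding eq by (rule root_pair_loop_point) (use y in \<open>simp add: S_def T_def\<close>)
      have lx: "norm (partner (exp (\<i> * x))) < norm (exp (\<i> * x))"
        and ly: "norm (partner (exp (\<i> * y))) < norm (exp (\<i> * y))" using x y by (auto simp: S_def)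
      have "exp (\<i> * y) = exp (\<i> * x)"
      proof (rule ccontr)
        assume "exp (\<i> * y) \<noteq> exp (\<i> * x)"
        then have "exp (\<i> * y) = partner (exp (\<i> * x))" "partner (exp (\<i> * y)) = exp (\<i> * x)"
          using root_pair_unique[OF px py] by blast+
        then show False using lx ly by simp
      qed
      note expeq = this
      have imdiff: "\<bar>Im (\<i> * y) - Im (\<i> * x)\<bar> < 2 * pi"
      proof -
        have "0 < Re x" "Re x < 2 * pi" "0 < Re y" "Re y < 2 * pi" using x y by (simp_all add: S_def T_def)
        then show ?thesis by simp
      qed
      have "\<i> * y = \<i> * x" by (rule exp_complex_eqI[OF imdiff expeq])
      then show "x = y" by simp
    qed
    fix x :: real assume x: "x \<in> I"
    note xT = inI[OF x]
    show "isCont (\<lambda>y. loop_point (exp (\<i> * y))) (of_real x)"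
      using contp oT xT by (simp add: continuous_on_eq_continuous_at)
    obtain \<rho> where \<rho>: "norm (partner (exp (\<i> * of_real x))) < \<rho>" "\<rho> < 1" using dense[OF conjunct1[OF conjunct2[OF xT]]] by blast
    have \<rho>0: "0 \<le> \<rho>" by (rule order_trans[OF norm_ge_zero less_imp_le[OF \<rho>(1)]])
    define O' where "O' = (T \<inter> (\<lambda>y. norm (partner (exp (\<i> * y)))) -` {..<\<rho>}) \<inter>
       (T \<inter> (\<lambda>y. norm (exp (\<i> * y)) - norm (partner (exp (\<i> * y)))) -` {0<..}) \<inter>
       (T \<inter> (\<lambda>y. norm (exp (\<i> * y)) * norm (partner (exp (\<i> * y)))) -` {..<1})"
    have c: "continuous_on T (\<lambda>y. norm (partner (exp (\<i> * y))))"
      "continuous_on T (\<lambda>y. norm (exp (\<i> * y)) - norm (partner (exp (\<i> * y))))"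
      "continuous_on T (\<lambda>y. norm (exp (\<i> * y)) * norm (partner (exp (\<i> * y))))"
      by (intro continuous_intros contq)+
    have "open O'" unfolding O'_def
      by (rule open_Int[OF open_Int[OF continuous_open_preimage[OF c(1) oT open_lessThan]
              continuous_open_preimage[OF c(2) oT open_greaterThan]] continuous_open_preimage[OF c(3) oT open_lessThan]])
    moreover have "of_real x \<in> O'" using xT \<rho>(1) by (simp add: O'_def)
    ultimately obtain \<delta> where \<delta>: "\<delta> > 0" "cball (of_real x) \<delta> \<subseteq> O'" using open_obtains_cball by blast
    have qn: "norm (partner (exp (\<i> * y)) ^ n) \<le> \<rho> ^ n" if "y \<in> cball (of_real x) \<delta>" for n y
    proof -
      have "norm (partner (exp (\<i> * y))) \<le> \<rho>" using that \<delta>(2) by (auto simp: O'_def)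
      then show ?thesis unfolding norm_power by (intro power_mono) auto
    qed
    have ev: "\<forall>\<^sub>F n in sequentially. \<forall>k. continuous_on (cball (of_real x) \<delta>) (E n k) \<and>
           (\<forall>y\<in>cball (of_real x) \<delta>. norm (E n k y) \<le> r \<and>
             (of_nat n * y = of_real (0 + of_int k * (2 * pi)) + E n k y \<longrightarrow> loop_point (exp (\<i> * y)) \<in> loop_zeros n))"
      if r: "r > 0" for r
    proof -
      have "isCont (\<lambda>w. - \<i> * Ln (1 - w)) 0" by (intro continuous_intros isCont_Ln') auto
      from eventually_small_perturbation[OF this _ \<rho>0 \<rho>(2) r]
      have "\<forall>\<^sub>F n in sequentially. \<forall>w. norm w \<le> \<rho> ^ n \<longrightarrow> norm (- \<i> * Ln (1 - w)) \<le> r" by simp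
      with eventually_ge_at_top[of 1] show ?thesis
      proof eventually_elim
        case (elim n)
        have \<rho>n: "\<rho> ^ n < 1" using \<rho> \<rho>0 elim(1) by (intro power_less_one_iff[THEN iffD2]) auto
        have small: "norm (partner (exp (\<i> * y)) ^ n) < 1" if "y \<in> cball (of_real x) \<delta>" for y
          using qn[OF that, of n] \<rho>n by simp
        have pos: "1 - w \<notin> \<real>\<^sub>\<le>\<^sub>0" if "norm w < 1" for w :: complex
        proof
          assume "1 - w \<in> \<real>\<^sub>\<le>\<^sub>0"
          then have "Re (1 - w) \<le> 0" by (simp add: complex_nonpos_Reals_iff)
          then show False using that abs_Re_le_cmod[of w] by simp
        qed
        show ?case
        proof (intro allI conjI ballI impI)
          fix k :: int
          show "continuous_on (cball (of_real x) \<delta>) (E n k)"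
            unfolding E_def using \<delta>(2) small pos
            by (intro continuous_intros continuous_on_Ln' continuous_on_subset[OF contq]) (auto simp: O'_def)
          fix y :: complex assume y: "y \<in> cball (of_real x) \<delta>"
          show "norm (E n k y) \<le> r" unfolding E_def by (rule elim(2)[rule_format, OF qn[OF y]])
          assume eq: "of_nat n * y = of_real (0 + of_int k * (2 * pi)) + E n k y"
          define p where "p = exp (\<i> * y)"
          have yO: "y \<in> O'" using y \<delta>(2) by blast
          have p1: "p \<noteq> 1" using yO by (simp add: O'_def T_def p_def)
          have "partner p ^ n \<noteq> 1" using small[OF y] by (auto simp: p_def)
          then have w0: "1 - partner p ^ n \<noteq> 0" by simp
          have "p ^ n = exp (\<i> * (of_nat n * y))" by (simp add: p_def exp_of_nat_mult[symmetric] mult.left_commute)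
          also have "\<dots> = exp (of_int (2 * k) * pi * \<i>) * exp (Ln (1 - partner p ^ n))"
          proof -
            have "\<i> * (of_real (0 + of_int k * (2 * pi)) + E n k y) = of_int (2 * k) * pi * \<i> + Ln (1 - partner p ^ n)"
              by (simp add: E_def p_def algebra_simps)
            then show ?thesis unfolding eq by (simp only: exp_add)
          qed
          also have "exp (of_int (2 * k) * pi * \<i>) = (1::complex)"
            using exp_eq[of "of_int (2 * k) * pi * \<i>" 0] by auto
          finally have "p ^ n + partner p ^ n = 1" using exp_Ln[OF w0] by simp
          from zero_setI[OF root_pair_loop_point[OF p1] this]
          have "loop_point p \<in> zero_set n" .
          moreover have "norm (airfoil_V b (loop_point p)) < (norm b)\<^sup>2"
          proof -
            have "norm p * norm (partner p) < 1" using yO by (simp add: O'_def p_def)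
            then have "norm (p * partner p) < 1" by (simp add: norm_mult)
            then have "norm (airfoil_V b (loop_point p)) / (norm b)\<^sup>2 < 1"
              unfolding root_pair_prod[OF b_nz root_pair_loop_point[OF p1]] by (simp add: norm_divide norm_power)
            then show ?thesis using b_nz by (simp add: divide_less_eq_1)
          qed
          ultimately show "loop_point (exp (\<i> * y)) \<in> loop_zeros n" by (simp add: loop_zeros_def p_def)
        qed
      qed
    qed
    show "\<exists>\<delta>>0. cball (of_real x) \<delta> \<subseteq> S \<and>
        (\<forall>r>0. \<forall>\<^sub>F n in sequentially. \<forall>k. continuous_on (cball (of_real x) \<delta>) (E n k) \<and>
           (\<forall>y\<in>cball (of_real x) \<delta>. norm (E n k y) \<le> r \<and>
             (of_nat n * y = of_real (0 + of_int k * (2 * pi)) + E n k y \<longrightarrow> loop_point (exp (\<i> * y)) \<in> loop_zeros n)))"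
    proof (intro exI[of _ \<delta>] conjI \<delta>(1))
      show "cball (of_real x) \<delta> \<subseteq> S" using \<delta>(2) by (auto simp: O'_def S_def)
    qed (use ev in blast)
  qed simp
  then show ?thesis by (simp add: I_def cis_conv_exp)
qed

end

section \<open>Integrals with respect to the measures\<close>

lemma add_measure:
  assumes sets: "sets N = sets M"
  shows "sets (add_measure M N) = sets M" "space (add_measure M N) = space M"
    and "A \<in> sets M \<Longrightarrow> emeasure (add_measure M N) A = emeasure M A + emeasure N A"
proof -
  show s: "sets (add_measure M N) = sets M" "space (add_measure M N) = space M"
    by (simp_all add: add_measure_def sets.sigma_sets_eq sets.space_closed sets_measure_of space_measure_of)
  show "emeasure (add_measure M N) A = emeasure M A + emeasure N A" if A: "A \<in> sets M"
  proof (rule emeasure_measure_of[OF add_measure_def[of M N]])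
    show "countably_additive (sets (add_measure M N)) (\<lambda>A. emeasure M A + emeasure N A)"
      unfolding countably_additive_def s(1)
    proof (intro allI impI)
      fix B :: "nat \<Rightarrow> _" assume B: "range B \<subseteq> sets M" "disjoint_family B" "\<Union> (range B) \<in> sets M"
      have "(\<Sum>i. emeasure M (B i) + emeasure N (B i)) = (\<Sum>i. emeasure M (B i)) + (\<Sum>i. emeasure N (B i))"
        by (rule suminf_add[symmetric]) (auto intro: summableI)
      also have "\<dots> = emeasure M (\<Union> (range B)) + emeasure N (\<Union> (range B))"
        using suminf_emeasure[of B M] suminf_emeasure[of B N] B sets by simp
      finally show "(\<Sum>i. emeasure M (B i) + emeasure N (B i)) = emeasure M (\<Union> (range B)) + emeasure N (\<Union> (range B))" .
    qed
  qed (use A s in \<open>auto simp: positive_def sets.space_closed dest: sets.sets_into_space\<close>)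
qed

lemma nn_integral_add_measure:
  fixes M N :: "'a measure"
  assumes sets: "sets N = sets M" and f: "f \<in> borel_measurable M"
  shows "integral\<^sup>N (add_measure M N) f = integral\<^sup>N M f + integral\<^sup>N N f"
  using f
proof (induction rule: borel_measurable_induct)
  have m: "(borel_measurable (add_measure M N) :: ('a \<Rightarrow> ennreal) set) = borel_measurable M"
    "(borel_measurable N :: ('a \<Rightarrow> ennreal) set) = borel_measurable M"
    using add_measure(1)[OF sets] sets by (auto intro: measurable_cong_sets)
  have sp: "space N = space M" using sets by (rule sets_eq_imp_space_eq)
  {
    case (cong f g)
    have e: "integral\<^sup>N (add_measure M N) f = integral\<^sup>N (add_measure M N) g"
      "integral\<^sup>N M f = integral\<^sup>N M g" "integral\<^sup>N N f = integral\<^sup>N N g"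
      by (rule nn_integral_cong, simp add: cong(3) add_measure(2)[OF sets] sp)+
    show ?case unfolding e by (rule cong(4))
  next
    case (set A)
    then show ?case using add_measure[OF sets] sets by (simp add: nn_integral_indicator)
  next
    case (mult u c)
    then show ?case using m by (simp add: nn_integral_cmult distrib_left)
  next
    case (add u v)
    then show ?case using m by (simp add: nn_integral_add algebra_simps)
  next
    case (seq U)
    have inc: "incseq U" using seq by blast
    have e: "integral\<^sup>N K (SUP i. U i) = (SUP i. integral\<^sup>N K (U i))" if "(borel_measurable K :: ('a \<Rightarrow> ennreal) set) = borel_measurable M" for K
    proof -
      have "integral\<^sup>N K (\<lambda>x. SUP i. U i x) = (SUP i. integral\<^sup>N K (U i))"
        using seq(1) that by (intro nn_integral_monotone_convergence_SUP inc) auto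
      moreover have "(SUP i. U i) = (\<lambda>x. SUP i. U i x)" by (rule ext) (simp add: image_image)
      ultimately show ?thesis by simp
    qed
    have mono: "incseq (\<lambda>i. integral\<^sup>N K (U i))" for K
      using inc by (auto simp: incseq_def le_fun_def intro!: nn_integral_mono)
    have "integral\<^sup>N (add_measure M N) (SUP i. U i) = (SUP i. integral\<^sup>N M (U i) + integral\<^sup>N N (U i))"
      using e[OF m(1)] seq by simp
    also have "\<dots> = (SUP i. integral\<^sup>N M (U i)) + (SUP i. integral\<^sup>N N (U i))"
      by (rule ennreal_SUP_add[OF mono mono])
    also have "\<dots> = integral\<^sup>N M (SUP i. U i) + integral\<^sup>N N (SUP i. U i)"
      using e[OF refl] e[OF m(2)] by simp
    finally show ?case .
  }
qed

lemma sets_restrict_measure [simp]: "sets (restrict_measure M A) = sets M"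
  by (simp add: restrict_measure_def)

lemma nn_integral_restrict_measure:
  assumes "A \<in> sets M" "f \<in> borel_measurable M"
  shows "integral\<^sup>N (restrict_measure M A) f = (\<integral>\<^sup>+x. indicator A x * f x \<partial>M)"
  unfolding restrict_measure_def using assms by (intro nn_integral_density) auto

lemma liminf_add_le_ennreal:
  fixes f g :: "nat \<Rightarrow> ennreal"
  shows "liminf f + liminf g \<le> liminf (\<lambda>n. f n + g n)"
proof -
  have mono: "incseq (\<lambda>n. INF m\<in>{n..}. h m)" for h :: "nat \<Rightarrow> ennreal"
    by (auto simp: incseq_def intro!: INF_superset_mono)
  have "liminf f + liminf g = (SUP n. (INF m\<in>{n..}. f m) + (INF m\<in>{n..}. g m))"
    unfolding liminf_SUP_INF by (rule ennreal_SUP_add[OF mono mono, symmetric])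
  also have "\<dots> \<le> (SUP n. INF m\<in>{n..}. f m + g m)"
    by (intro SUP_mono' INF_greatest add_mono INF_lower) auto
  also have "\<dots> = liminf (\<lambda>n. f n + g n)" unfolding liminf_SUP_INF ..
  finally show ?thesis .
qed

lemma nn_integral_zero_measure:
  assumes fin: "finite {z. poly p z = 0}" and f: "f \<in> borel_measurable borel"
  shows "integral\<^sup>N (zero_measure n p) f = (\<Sum>z | poly p z = 0. ennreal (real (order z p) / real n) * f z)"
proof -
  have "(\<lambda>z. z) \<in> measurable (point_measure {z. poly p z = 0} (\<lambda>z. ennreal (real (order z p) / real n))) borel"
    by (auto simp: measurable_def point_measure_def space_count_space)
  then show ?thesis unfolding zero_measure_def
    using f fin by (subst nn_integral_distr) (auto simp: nn_integral_point_measure_finite)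
qed

context airfoil
begin

lemma loop_arc_eq:
  "loop_arc = {p. norm p = 1 \<and> 1 / 2 < Re (b\<^sup>2 * (1 - p))}"
proof (intro equalityI subsetI)
  fix p assume "p \<in> loop_arc"
  then obtain \<beta> where \<beta>: "corner_angle < \<beta>" "\<beta> < 2 * pi - corner_angle" "p = arc_cis \<beta>" by auto
  have "cos \<beta> < corner" using cos_less_corner_iff[of \<beta>] \<beta> corner_angle by simp
  then have "0 < (norm b)\<^sup>2 * (corner - cos \<beta>)" using b_nz by simp
  then show "p \<in> {p. norm p = 1 \<and> 1 / 2 < Re (b\<^sup>2 * (1 - p))}"
    unfolding mem_Collect_eq \<beta>(3) arc_cis_side norm_arc_cis by linarith
next
  fix p assume "p \<in> {p. norm p = 1 \<and> 1 / 2 < Re (b\<^sup>2 * (1 - p))}"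
  then have p: "norm p = 1" "1 / 2 < Re (b\<^sup>2 * (1 - p))" by (simp_all only: mem_Collect_eq)
  obtain \<beta> where \<beta>: "0 \<le> \<beta>" "\<beta> < 2 * pi" "p = arc_cis \<beta>" using unit_circle_arc_cis[OF p(1)] .
  have "0 < (norm b)\<^sup>2 * (corner - cos \<beta>)" using p(2) arc_cis_side[of \<beta>] unfolding \<beta>(3) by linarith
  then have "cos \<beta> < corner" by (simp add: zero_less_mult_iff)
  then show "p \<in> loop_arc"
    using cos_less_corner_iff[of \<beta>] \<beta> by auto
qed

lemma loop_arc_measurable: "loop_arc \<in> sets borel"
proof -
  have "closed {p :: complex. norm p = 1}" "open {p. 1 / 2 < Re (b\<^sup>2 * (1 - p))}"
    by (auto intro!: closed_Collect_eq open_Collect_less continuous_intros)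
  moreover have "{p. norm p = 1 \<and> 1 / 2 < Re (b\<^sup>2 * (1 - p))} = {p. norm p = 1} \<inter> {p. 1 / 2 < Re (b\<^sup>2 * (1 - p))}"
    by blast
  ultimately show ?thesis unfolding loop_arc_eq by (auto intro: sets.Int borel_closed borel_open)
qed

lemma measurable_Uinv:
  assumes r: "is_sqrt_V b r"
  shows "airfoil_Uinv b r \<in> borel_measurable borel"
proof -
  have "airfoil_Uinv b r = (\<lambda>t. if t \<in> {-1..1} then arc_at t else (SOME y. False))"
    using airfoil_Uinv_eq[OF r] airfoil_Uinv_outside[OF r] by (auto simp: fun_eq_iff)
  moreover have "(\<lambda>t::real. arc_at t) \<in> borel_measurable borel"
    by (intro borel_measurable_continuous_onI continuous_on_arc)
  ultimately show ?thesis by (auto intro!: measurable_If_set)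
qed

lemma measurable_phi_inv:
  assumes r: "is_sqrt_V b r" and s: "is_sqrt_arc b s"
  shows "phi_inv b r s \<in> borel_measurable borel"
proof -
  have "phi_inv b r s = (\<lambda>p. if p \<in> loop_arc then loop_point p else (SOME y. False))"
    using phi_inv_on_arc[OF r s] phi_inv_outside[OF r s] by (auto simp: fun_eq_iff)
  moreover have "loop_point \<in> borel_measurable borel"
    unfolding loop_point_def joukowski_def by measurable
  ultimately show ?thesis using loop_arc_measurable by (auto intro!: measurable_If_set)
qed

text \<open>The substitution \<open>t = cos x\<close> turns the arcsine density into the constant \<open>1/\<pi>\<close>.\<close>
lemma nn_integral_arc_part:
  assumes r: "is_sqrt_V b r" and f: "continuous_on UNIV f" "\<And>z. 0 \<le> f z"
  shows "(\<integral>\<^sup>+z. ennreal (f z) \<partial>restrict_measure (distr arcsine_measure borel (airfoil_Uinv b r)) (airfoil_subarc b r))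
     = (\<integral>\<^sup>+x. ennreal (f (arc_at (cos x)) / pi) * indicator {- corner_angle<..<0} x \<partial>lborel)"
proof -
  note [measurable] = measurable_Uinv[OF r]
  have fm[measurable]: "(\<lambda>z. ennreal (f z)) \<in> borel_measurable borel"
    using borel_measurable_continuous_onI[OF f(1)] by measurable
  have "compact (airfoil_subarc b r)"
    unfolding airfoil_subarc_eq[OF r] by (intro compact_continuous_image continuous_on_arc) simp
  then have sub[measurable]: "airfoil_subarc b r \<in> sets borel" by (intro borel_closed compact_imp_closed)
  have am: "measurable arcsine_measure borel = (measurable borel borel :: (real \<Rightarrow> complex) set)"
    by (rule measurable_cong_sets) (simp_all add: arcsine_measure_def)
  have dens[measurable]: "(\<lambda>x. ennreal (indicator {-1..1} x / (pi * sqrt (1 - x\<^sup>2)))) \<in> borel_measurable borel"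
    by measurable
  define h where "h = (\<lambda>t. ennreal (1 / (pi * sqrt (1 - t\<^sup>2))) * ennreal (f (airfoil_Uinv b r t)))"
  have hm: "h \<in> borel_measurable borel" unfolding h_def by measurable
  have "(\<integral>\<^sup>+z. ennreal (f z) \<partial>restrict_measure (distr arcsine_measure borel (airfoil_Uinv b r)) (airfoil_subarc b r))
      = (\<integral>\<^sup>+z. indicator (airfoil_subarc b r) z * ennreal (f z) \<partial>distr arcsine_measure borel (airfoil_Uinv b r))"
    by (rule nn_integral_restrict_measure) auto
  also have "\<dots> = (\<integral>\<^sup>+t. indicator (airfoil_subarc b r) (airfoil_Uinv b r t) * ennreal (f (airfoil_Uinv b r t)) \<partial>arcsine_measure)"
    by (rule nn_integral_distr) (auto simp: am)
  also have "\<dots> = (\<integral>\<^sup>+t. ennreal (indicator {-1..1} t / (pi * sqrt (1 - t\<^sup>2))) *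
      (indicator (airfoil_subarc b r) (airfoil_Uinv b r t) * ennreal (f (airfoil_Uinv b r t))) \<partial>lborel)"
    unfolding arcsine_measure_def by (rule nn_integral_density) measurable
  also have "\<dots> = (\<integral>\<^sup>+t. h t * indicator {cos (- corner_angle)..cos 0} t \<partial>lborel)"
  proof (rule nn_integral_cong)
    fix t :: real
    have c: "cos (- corner_angle) = corner" "cos 0 = (1::real)" using corner_angle by simp_all
    show "ennreal (indicator {-1..1} t / (pi * sqrt (1 - t\<^sup>2))) *
      (indicator (airfoil_subarc b r) (airfoil_Uinv b r t) * ennreal (f (airfoil_Uinv b r t)))
       = h t * indicator {cos (- corner_angle)..cos 0} t"
    proof (cases "t \<in> {-1..1}")
      case True
      have "airfoil_Uinv b r t \<in> airfoil_subarc b r \<longleftrightarrow> t \<in> {corner..1}"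
        unfolding airfoil_subarc_eq[OF r] airfoil_Uinv_eq[OF r True]
        using inj_on_image_mem_iff[OF inj_on_arc_real[of UNIV], of t "{corner..1}"] by simp
      then show ?thesis using True unfolding c h_def by (auto simp: indicator_def)
    next
      case False
      then have "t \<notin> {corner..1}" using corner_bounds by auto
      then show ?thesis using False unfolding c by simp
    qed
  qed
  also have "\<dots> = (\<integral>\<^sup>+x. h (cos x) * ennreal (- sin x) * indicator {- corner_angle..0} x \<partial>lborel)"
  proof (rule nn_integral_substitution_aux[OF hm])
    show "(cos has_real_derivative - sin x) (at x)" for x :: real by (auto intro!: derivative_eq_intros)
    show "continuous_on {- corner_angle..0} (\<lambda>x. - sin x)" by (intro continuous_intros)
    show "0 \<le> - sin x" if "x \<in> {- corner_angle..0}" for x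
      using sin_ge_zero[of "- x"] that corner_angle by simp
  qed (use corner_angle in auto)
  also have "\<dots> = (\<integral>\<^sup>+x. ennreal (f (arc_at (cos x)) / pi) * indicator {- corner_angle<..<0} x \<partial>lborel)"
  proof (rule nn_integral_cong_AE)
    show "AE x in lborel. h (cos x) * ennreal (- sin x) * indicator {- corner_angle..0} x
        = ennreal (f (arc_at (cos x)) / pi) * indicator {- corner_angle<..<0} x"
      using AE_lborel_singleton[of "- corner_angle"] AE_lborel_singleton[of 0]
    proof eventually_elim
      case (elim x)
      show ?case
      proof (cases "x \<in> {- corner_angle..0}")
        case False then show ?thesis by auto
      next
        case True
        then have x: "x \<in> {- corner_angle<..<0}" using elim by auto
        have s: "0 < - sin x" using sin_gt_zero[of "- x"] x corner_angle by simp
        have "sqrt (1 - (cos x)\<^sup>2) = \<bar>sin x\<bar>" by (simp add: sin_squared_eq[symmetric])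
        then have sq: "sqrt (1 - (cos x)\<^sup>2) = - sin x" using s by simp
        have "h (cos x) * ennreal (- sin x) = ennreal (1 / (pi * (- sin x)) * f (airfoil_Uinv b r (cos x)) * (- sin x))"
          unfolding h_def sq using s f(2) by (simp add: ennreal_mult'[symmetric] ennreal_mult''[symmetric])
        also have "1 / (pi * (- sin x)) * f (airfoil_Uinv b r (cos x)) * (- sin x) = f (airfoil_Uinv b r (cos x)) / pi"
          using s by (simp add: field_simps)
        also have "airfoil_Uinv b r (cos x) = arc_at (cos x)"
          by (rule airfoil_Uinv_eq[OF r]) simp
        finally show ?thesis using x True by simp
      qed
    qed
  qed
  finally show ?thesis .
qed

lemma nn_integral_loop_part:
  assumes r: "is_sqrt_V b r" and s: "is_sqrt_arc b s" and f: "continuous_on UNIV f" "\<And>z. 0 \<le> f z"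
  shows "(\<integral>\<^sup>+z. ennreal (f z) \<partial>distr (restrict_measure circle_measure
             (circle_arc (phi_plus b r s (airfoil_i b)) (phi_minus b r s (airfoil_i b)))) borel (phi_inv b r s))
     = (\<integral>\<^sup>+x. ennreal (f (loop_point (cis x)) / (2 * pi)) *
        indicator loop_parameters x \<partial>lborel)"
proof -
  define A where "A = loop_arc"
  have arc: "circle_arc (phi_plus b r s (airfoil_i b)) (phi_minus b r s (airfoil_i b)) = A"
    unfolding phi_at_corner[OF r s] circle_arc_eq A_def ..
  note [measurable] = measurable_phi_inv[OF r s] loop_arc_measurable[folded A_def]
  have fm[measurable]: "(\<lambda>z. ennreal (f z)) \<in> borel_measurable borel"
    using borel_measurable_continuous_onI[OF f(1)] by measurable
  have cism[measurable]: "cis \<in> borel_measurable borel"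
    by (intro borel_measurable_continuous_onI continuous_intros)
  have csets: "sets circle_measure = sets borel" by (simp add: circle_measure_def)
  have cm: "borel_measurable circle_measure = borel_measurable borel" for C :: "'b::topological_space set"
    by (rule measurable_cong_sets[OF csets refl])
  have "(\<integral>\<^sup>+z. ennreal (f z) \<partial>distr (restrict_measure circle_measure A) borel (phi_inv b r s))
      = (\<integral>\<^sup>+p. ennreal (f (phi_inv b r s p)) \<partial>restrict_measure circle_measure A)"
    by (rule nn_integral_distr) (simp_all add: restrict_measure_def csets measurable_phi_inv[OF r s] cong: measurable_cong_sets)
  also have "\<dots> = (\<integral>\<^sup>+p. indicator A p * ennreal (f (phi_inv b r s p)) \<partial>circle_measure)"
  proof (rule nn_integral_restrict_measure)
    show "A \<in> sets circle_measure" unfolding csets by measurable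
    have "(\<lambda>p. ennreal (f (phi_inv b r s p))) \<in> borel_measurable borel" by measurable
    then show "(\<lambda>p. ennreal (f (phi_inv b r s p))) \<in> borel_measurable circle_measure"
      by (simp add: csets cong: measurable_cong_sets)
  qed
  also have "\<dots> = (\<integral>\<^sup>+t. indicator A (cis t) * ennreal (f (phi_inv b r s (cis t)))
      \<partial>density lborel (\<lambda>t. ennreal (indicator {0..<2 * pi} t / (2 * pi))))"
    unfolding circle_measure_def by (rule nn_integral_distr) measurable
  also have "\<dots> = (\<integral>\<^sup>+t. ennreal (indicator {0..<2 * pi} t / (2 * pi)) *
      (indicator A (cis t) * ennreal (f (phi_inv b r s (cis t)))) \<partial>lborel)"
    by (rule nn_integral_density) measurable
  also have "\<dots> = (\<integral>\<^sup>+x. ennreal (f (loop_point (cis x)) / (2 * pi)) *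
        indicator loop_parameters x \<partial>lborel)"
  proof (rule nn_integral_cong_AE)
    show "AE t in lborel. ennreal (indicator {0..<2 * pi} t / (2 * pi)) *
      (indicator A (cis t) * ennreal (f (phi_inv b r s (cis t))))
      = ennreal (f (loop_point (cis t)) / (2 * pi)) *
        indicator loop_parameters t"
      using AE_lborel_singleton[of 0]
    proof eventually_elim
      case (elim t)
      have iff: "cis t \<in> A \<longleftrightarrow> 1 / 2 < Re (b\<^sup>2 * (1 - cis t))" unfolding A_def loop_arc_eq by simp
      show ?case
      proof (cases "t \<in> {0..<2 * pi} \<and> cis t \<in> A")
        case True
        then have "t \<in> loop_parameters"
          unfolding mem_Collect_eq using elim iff by auto
        moreover have "phi_inv b r s (cis t) = loop_point (cis t)"
          using phi_inv_on_arc[OF r s] True by (simp add: A_def)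
        ultimately show ?thesis using True f(2) by (simp add: ennreal_mult'[symmetric])
      next
        case False
        then have "t \<notin> loop_parameters"
          unfolding mem_Collect_eq using iff by auto
        then show ?thesis using False by (auto simp: indicator_def)
      qed
    qed
  qed
  finally show ?thesis unfolding arc .
qed

lemma sets_loop_parameters: "loop_parameters \<in> sets lborel"
proof -
  have "open {x :: real. 0 < x}" "open {x. x < 2 * pi}" "open {x. 1 / 2 < Re (b\<^sup>2 * (1 - cis x))}"
    by (auto intro!: open_Collect_less continuous_intros)
  moreover have "loop_parameters = {x. 0 < x} \<inter> {x. x < 2 * pi} \<inter> {x. 1 / 2 < Re (b\<^sup>2 * (1 - cis x))}" by blast
  ultimately show ?thesis by (auto intro!: borel_open open_Int)
qed

text \<open>Up to a rotation by \<open>\<tau>\<close>, the parameters form an interval of length \<open>2\<pi> - 2 corner_angle\<close>, possibly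
  wrapped around once at \<open>2\<pi>\<close>.\<close>
lemma loop_parameter_length:
  "ennreal (2 * pi - 2 * corner_angle)
     \<le> emeasure lborel loop_parameters" (is "_ \<le> emeasure lborel ?I")
proof -
  define \<tau> where "\<tau> = Arg2pi (cnj b / b)"
  have \<tau>: "0 \<le> \<tau>" "\<tau> < 2 * pi" using Arg2pi_ge_0 Arg2pi_lt_2pi by (auto simp: \<tau>_def)
  have "norm (cnj b / b) = 1" using b_nz by (simp add: norm_divide)
  then have cb: "cnj b / b = cis \<tau>" using Arg2pi_eq[of "cnj b / b"] by (simp add: \<tau>_def cis_conv_exp)
  have shift: "arc_cis \<beta> = cis (\<tau> + \<beta>)" for \<beta> unfolding arc_cis_def cb by (simp add: cis_mult)
  define l where "l = \<tau> + corner_angle"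
  define h where "h = \<tau> + 2 * pi - corner_angle"
  have lh: "0 < l" "h < 4 * pi" "h - l = 2 * pi - 2 * corner_angle" "h - l < 2 * pi" "l < h"
    using \<tau> corner_angle by (auto simp: l_def h_def)
  have arc: "1 / 2 < Re (b\<^sup>2 * (1 - cis x))" if "l < x" "x < h" for x
  proof -
    have "arc_cis (x - \<tau>) \<in> loop_arc"
      using that by (intro imageI) (auto simp: l_def h_def)
    then show ?thesis unfolding loop_arc_eq shift mem_Collect_eq by simp
  qed
  have arc': "1 / 2 < Re (b\<^sup>2 * (1 - cis x))" if "l - 2 * pi < x" "x < h - 2 * pi" for x
  proof -
    have "cis (x + 2 * pi) = cis x" by (simp add: complex_eq_iff)
    then show ?thesis using arc[of "x + 2 * pi"] that by simp
  qed
  note I = sets_loop_parameters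
  consider "h \<le> 2 * pi" | "2 * pi \<le> l" | "l < 2 * pi" "2 * pi < h" by linarith
  then show ?thesis
  proof cases
    case 1
    have "{l<..<h} \<subseteq> ?I"
      unfolding subset_iff mem_Collect_eq greaterThanLessThan_iff using arc 1 lh by (meson less_le_trans less_trans)
    from emeasure_mono[OF this I] show ?thesis using lh by simp
  next
    case 2
    have "0 < x \<and> x < 2 * pi" if "l - 2 * pi < x" "x < h - 2 * pi" for x using that 2 lh by linarith
    then have "{l - 2 * pi<..<h - 2 * pi} \<subseteq> ?I"
      unfolding subset_iff mem_Collect_eq greaterThanLessThan_iff using arc' by blast
    from emeasure_mono[OF this I] show ?thesis using lh by simp
  next
    case 3
    have "0 < x" if "l < x" for x using that lh by linarith
    moreover have "x < 2 * pi" if "x < h - 2 * pi" for x using that lh(2) by linarith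
    moreover have "l - 2 * pi < x" if "0 < x" for x using that 3 by linarith
    moreover have "x < h" if "x < 2 * pi" for x using that 3 by linarith
    ultimately have sub: "{l<..<2 * pi} \<union> {0<..<h - 2 * pi} \<subseteq> ?I"
      unfolding subset_iff mem_Collect_eq Un_iff greaterThanLessThan_iff using arc arc' by blast
    have disj: "{l<..<2 * pi} \<inter> {0<..<h - 2 * pi} = {}" using lh by auto
    have "emeasure lborel ({l<..<2 * pi} \<union> {0<..<h - 2 * pi}) = ennreal (2 * pi - l) + ennreal (h - 2 * pi)"
      using 3 by (subst plus_emeasure[symmetric, OF _ _ disj]) auto
    also have "\<dots> = ennreal (2 * pi - 2 * corner_angle)"
      using 3 lh(3) by (subst ennreal_plus[symmetric]) auto
    finally show ?thesis using emeasure_mono[OF sub I] by simp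
  qed
qed

lemma sets_airfoil_limit_measure: "sets (airfoil_limit_measure b r s) = sets borel"
  unfolding airfoil_limit_measure_def by (subst add_measure(1)) simp_all

lemma nn_integral_limit_measure:
  assumes r: "is_sqrt_V b r" and s: "is_sqrt_arc b s" and f: "continuous_on UNIV f" "\<And>z. 0 \<le> f z"
  shows "(\<integral>\<^sup>+z. ennreal (f z) \<partial>airfoil_limit_measure b r s)
     = (\<integral>\<^sup>+x. ennreal (f (arc_at (cos x)) / pi) * indicator {- corner_angle<..<0} x \<partial>lborel)
     + (\<integral>\<^sup>+x. ennreal (f (loop_point (cis x)) / (2 * pi)) *
        indicator loop_parameters x \<partial>lborel)"
proof -
  have "(\<lambda>z. ennreal (f z)) \<in> borel_measurable borel"
    using borel_measurable_continuous_onI[OF f(1)] by measurable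
  then show ?thesis
    unfolding airfoil_limit_measure_def nn_integral_arc_part[OF r f, symmetric] nn_integral_loop_part[OF r s f, symmetric]
    by (intro nn_integral_add_measure) (simp_all add: restrict_measure_def)
qed

lemma limit_measure_mass:
  assumes r: "is_sqrt_V b r" and s: "is_sqrt_arc b s"
  shows "1 \<le> emeasure (airfoil_limit_measure b r s) UNIV"
proof -
  let ?I = "loop_parameters"
  note I = sets_loop_parameters
  have "1 = ennreal (corner_angle / pi + (2 * pi - 2 * corner_angle) / (2 * pi))"
    by (simp add: diff_divide_distrib)
  also have "\<dots> = ennreal (1 / pi) * ennreal corner_angle + ennreal (1 / (2 * pi)) * ennreal (2 * pi - 2 * corner_angle)"
    using corner_angle by (subst ennreal_plus) (auto simp: ennreal_mult[symmetric])
  also have "\<dots> \<le> ennreal (1 / pi) * emeasure lborel {- corner_angle<..<0} + ennreal (1 / (2 * pi)) * emeasure lborel ?I"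
    using loop_parameter_length corner_angle by (intro add_mono mult_left_mono) auto
  also have "\<dots> = (\<integral>\<^sup>+x. ennreal (1 / pi) * indicator {- corner_angle<..<0} x \<partial>lborel)
      + (\<integral>\<^sup>+x. ennreal (1 / (2 * pi)) * indicator ?I x \<partial>lborel)"
    using I by (simp only: nn_integral_cmult_indicator sets_lborel borel_open[OF open_greaterThanLessThan])
  also have "\<dots> = (\<integral>\<^sup>+z. ennreal 1 \<partial>airfoil_limit_measure b r s)"
    by (rule nn_integral_limit_measure[OF r s, symmetric]) auto
  also have "\<dots> = emeasure (airfoil_limit_measure b r s) UNIV"
    using sets_eq_imp_space_eq[OF sets_airfoil_limit_measure[of r s]] by simp
  finally show ?thesis .
qed

lemma zero_measure_lower_bound:
  fixes f :: "complex \<Rightarrow> real"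
  assumes zeros: "{z. poly P z = 0} = zero_set n" and P: "P \<noteq> 0" and n: "n \<ge> 1"
    and f: "continuous_on UNIV f" "\<And>z. 0 \<le> f z"
  shows "ennreal ((\<Sum>z\<in>arc_zeros n. f z) / real n) + ennreal ((\<Sum>z\<in>loop_zeros n. f z) / real n)
     \<le> (\<integral>\<^sup>+z. ennreal (f z) \<partial>zero_measure n P)"
proof -
  have fin: "finite (zero_set n)" using poly_roots_finite[OF P] zeros by simp
  have fm: "(\<lambda>z. ennreal (f z)) \<in> borel_measurable borel"
    using borel_measurable_continuous_onI[OF f(1)] by measurable
  have disj: "arc_zeros n \<inter> loop_zeros n = {}" by (auto simp: arc_zeros_def loop_zeros_def)
  have sub: "arc_zeros n \<union> loop_zeros n \<subseteq> zero_set n" by (auto simp: arc_zeros_def loop_zeros_def)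
  have finu: "finite (arc_zeros n)" "finite (loop_zeros n)" using fin by (auto simp: arc_zeros_def loop_zeros_def)
  have "ennreal ((\<Sum>z\<in>arc_zeros n. f z) / real n) + ennreal ((\<Sum>z\<in>loop_zeros n. f z) / real n)
      = ennreal ((\<Sum>z\<in>arc_zeros n \<union> loop_zeros n. f z) / real n)"
    using f(2) by (subst ennreal_plus[symmetric])
      (auto simp: sum.union_disjoint[OF finu disj] add_divide_distrib intro!: divide_nonneg_nonneg sum_nonneg)
  also have "\<dots> \<le> ennreal (\<Sum>z\<in>zero_set n. real (order z P) / real n * f z)"
  proof (rule ennreal_leI)
    have "(\<Sum>z\<in>arc_zeros n \<union> loop_zeros n. f z) / real n \<le> (\<Sum>z\<in>zero_set n. f z) / real n"
      using sum_mono2[OF fin sub, of f] f(2) n by (intro divide_right_mono) auto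
    also have "\<dots> = (\<Sum>z\<in>zero_set n. 1 / real n * f z)" by (simp add: sum_divide_distrib)
    also have "\<dots> \<le> (\<Sum>z\<in>zero_set n. real (order z P) / real n * f z)"
    proof (rule sum_mono)
      fix z assume "z \<in> zero_set n"
      then have "poly P z = 0" using zeros by blast
      then have "order z P \<ge> 1" using P order_root by (metis One_nat_def Suc_leI gr0I)
      then have "1 / real n \<le> real (order z P) / real n" using n by (intro divide_right_mono) auto
      then show "1 / real n * f z \<le> real (order z P) / real n * f z" using f(2) by (rule mult_right_mono)
    qed
    finally show "(\<Sum>z\<in>arc_zeros n \<union> loop_zeros n. f z) / real n \<le> (\<Sum>z\<in>zero_set n. real (order z P) / real n * f z)" .
  qed
  also have "\<dots> = (\<Sum>z\<in>zero_set n. ennreal (real (order z P) / real n) * ennreal (f z))"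
    using f(2) by (subst sum_ennreal[symmetric]) (auto simp: ennreal_mult[symmetric])
  also have "\<dots> = (\<integral>\<^sup>+z. ennreal (f z) \<partial>zero_measure n P)"
    using nn_integral_zero_measure[OF _ fm, of P n] fin unfolding zeros by simp
  finally show ?thesis .
qed

end

lemma zero_measure_mass:
  assumes P: "P \<noteq> 0" and deg: "degree P \<le> n" and n: "n \<ge> 1"
  shows "emeasure (zero_measure n P) UNIV \<le> 1"
proof -
  have fin: "finite {z. poly P z = 0}" by (rule poly_roots_finite[OF P])
  have "emeasure (zero_measure n P) UNIV = (\<integral>\<^sup>+z. 1 \<partial>zero_measure n P)" by (simp add: zero_measure_def)
  also have "\<dots> = (\<Sum>z | poly P z = 0. ennreal (real (order z P) / real n))"
    using nn_integral_zero_measure[OF fin, of "\<lambda>_. 1" n] by simp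
  also have "\<dots> = ennreal ((\<Sum>z | poly P z = 0. real (order z P)) / real n)"
    by (subst sum_ennreal) (auto simp: sum_divide_distrib)
  also have "\<dots> \<le> ennreal 1"
  proof (rule ennreal_leI)
    have "(\<Sum>z | poly P z = 0. order z P) \<le> n" using sum_order_le_degree[OF P] deg by simp
    then have "real (\<Sum>z | poly P z = 0. order z P) \<le> real n" by (simp only: of_nat_le_iff)
    then show "(\<Sum>z | poly P z = 0. real (order z P)) / real n \<le> 1" using n by simp
  qed
  finally show ?thesis by simp
qed

theorem theorem4p2:
  fixes R \<theta> :: real and b :: complex and F :: "nat \<Rightarrow> complex poly"
    and r s :: "complex \<Rightarrow> complex"
  assumes "R > 1" and "- pi / 2 < \<theta>" and "\<theta> < pi / 2" and "\<theta> \<noteq> 0"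
    and "R * cos \<theta> > 3 / 2"
    and "b = 1 - of_real R * cis \<theta>"
    and "faber_polynomials (airfoil_map R \<theta>) F"
    and "is_sqrt_V b r"
    and "is_sqrt_arc b s"
  shows "(\<forall>N. open N \<and> airfoil_subarc b r \<union> airfoil_loop b r s \<subseteq> N \<longrightarrow>
            (\<forall>\<^sub>F n in sequentially. \<forall>z. poly (F n) z = 0 \<longrightarrow> z \<in> N))
       \<and> loop_with_corner (airfoil_loop b r s) (airfoil_i b)
       \<and> weak_star_limit (\<lambda>n. zero_measure n (F n)) (airfoil_limit_measure b r s)"
proof -
  note r = \<open>is_sqrt_V b r\<close> and s = \<open>is_sqrt_arc b s\<close> and F = \<open>faber_polynomials (airfoil_map R \<theta>) F\<close>
  have "sin \<theta> \<noteq> 0"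
    using sin_eq_0_pi[of \<theta>] assms(2-4) pi_gt_zero by linarith
  then have "airfoil b" using assms(1,5) by unfold_locales (simp_all add: assms(6))
  then interpret airfoil b .
  define a where "a = of_real R * cis \<theta>"
  have a: "a \<noteq> 0" "b = 1 - a" using assms(1,6) by (auto simp: a_def)
  have zero_iff: "poly (F n) z = 0 \<longleftrightarrow> p ^ n + q ^ n = 1" if "root_pair b z p q" for n z p q
    using faber_closed_form[OF F a_def a b_nz that, of n] a(1) b_nz by simp
  have zeros: "{z. poly (F n) z = 0} = zero_set n" for n
  proof (intro equalityI subsetI)
    fix z assume "z \<in> {z. poly (F n) z = 0}"
    then show "z \<in> zero_set n" using zero_iff by (auto simp: zero_set_def)
  next
    fix z assume z: "z \<in> zero_set n"
    obtain p q where pq: "root_pair b z p q" using root_pair_exists[OF b_nz] .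
    then show "z \<in> {z. poly (F n) z = 0}" using zero_iff[OF pq] z by (auto simp: zero_set_def)
  qed
  have nz: "F n \<noteq> 0" for n
  proof -
    obtain z where z: "larger_modulus b z \<ge> 4 + 1 / (norm b)\<^sup>2" using exists_far_point[OF b_nz] .
    obtain p q where pq: "root_pair b z p q" using root_pair_exists[OF b_nz] .
    have "p ^ n + q ^ n \<noteq> 1"
    proof (cases "n = 0")
      case True then show ?thesis by simp
    next
      case False then show ?thesis using far_zero_free[OF b_nz pq _ z, of n] by simp
    qed
    then show ?thesis using zero_iff[OF pq, of n] by auto
  qed
  have fin: "finite (zero_set n)" for n using poly_roots_finite[OF nz[of n]] zeros by simp
  have "\<forall>\<^sub>F n in sequentially. \<forall>z. poly (F n) z = 0 \<longrightarrow> z \<in> N"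
    if N: "open N" "airfoil_subarc b r \<union> airfoil_loop b r s \<subseteq> N" for N
    using zeros_accumulate[OF b_nz N(1) order_trans[OF critical_set_subset[OF r s] N(2)]]
  proof eventually_elim
    case (elim n)
    show ?case
    proof (intro allI impI)
      fix z assume z: "poly (F n) z = 0"
      obtain p q where pq: "root_pair b z p q" using root_pair_exists[OF b_nz] .
      then show "z \<in> N" using elim zero_iff[OF pq] z by blast
    qed
  qed
  moreover have "weak_star_limit (\<lambda>n. zero_measure n (F n)) (airfoil_limit_measure b r s)"
  proof (rule weak_star_limit_of_lower_bounds)
    show "sets (zero_measure n (F n)) = sets borel" for n by (simp add: zero_measure_def)
    show "sets (airfoil_limit_measure b r s) = sets borel" by (rule sets_airfoil_limit_measure)
    show "\<forall>\<^sub>F n in sequentially. emeasure (zero_measure n (F n)) UNIV \<le> 1"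
      using eventually_ge_at_top[of 1]
      by eventually_elim (rule zero_measure_mass[OF nz degree_faber_le[OF F a_def a b_nz]])
    show "1 \<le> emeasure (airfoil_limit_measure b r s) UNIV" by (rule limit_measure_mass[OF r s])
    fix f :: "complex \<Rightarrow> real" assume f: "continuous_on UNIV f" "\<And>z. 0 \<le> f z"
    have "(\<integral>\<^sup>+z. ennreal (f z) \<partial>airfoil_limit_measure b r s)
        \<le> liminf (\<lambda>n. ennreal ((\<Sum>z\<in>arc_zeros n. f z) / real n)) + liminf (\<lambda>n. ennreal ((\<Sum>z\<in>loop_zeros n. f z) / real n))"
      unfolding nn_integral_limit_measure[OF r s f]
      by (rule add_mono[OF arc_zeros_liminf[OF fin f] loop_zeros_liminf[OF fin f]])
    also have "\<dots> \<le> liminf (\<lambda>n. ennreal ((\<Sum>z\<in>arc_zeros n. f z) / real n) + ennreal ((\<Sum>z\<in>loop_zeros n. f z) / real n))"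
      by (rule liminf_add_le_ennreal)
    also have "\<dots> \<le> liminf (\<lambda>n. \<integral>\<^sup>+z. ennreal (f z) \<partial>zero_measure n (F n))"
    proof (rule Liminf_mono)
      show "\<forall>\<^sub>F n in sequentially. ennreal ((\<Sum>z\<in>arc_zeros n. f z) / real n) + ennreal ((\<Sum>z\<in>loop_zeros n. f z) / real n)
          \<le> (\<integral>\<^sup>+z. ennreal (f z) \<partial>zero_measure n (F n))"
        using eventually_ge_at_top[of 1]
        by eventually_elim (rule zero_measure_lower_bound[OF zeros nz _ f])
    qed
    finally show "(\<integral>\<^sup>+z. ennreal (f z) \<partial>airfoil_limit_measure b r s) \<le> liminf (\<lambda>n. \<integral>\<^sup>+z. ennreal (f z) \<partial>zero_measure n (F n))" .
  qed
  ultimately show ?thesis using loop_with_corner_airfoil[OF r s] by blast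
qed

end
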